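(* Let $F_1$ and $F_2$ be two Lozi maps with parameters in the Misiurewicz set $\mathcal M$. If their sets of kneading sequences coincide, $\mathfrak K_1=\mathfrak K_2$, then $F_1$ and $F_2$ are topologically conjugate on their strange attractors, i.e. there is a homeomorphism $h:\Lambda_{F_1}\to\Lambda_{F_2}$ with $h\circ F_1|_{\Lambda_{F_1}}=F_2\circ h$.
   Context: A Lozi map is $F=L_{a,b}:\mathbb R^2\to\mathbb R^2$, $L_{a,b}(x,y)=(1+y-a|x|,bx)$. The Misiurewicz parameter set is $\mathcal M=\{(a,b)\in\mathbb R^2: b>0,\ a\sqrt2-b>2,\ 2a+b<4\}$. For $(a,b)\in\mathcal M$, $F$ has a hyperbolic fixed point $X=\left(\frac1{1+a-b},\frac b{1+a-b}\right)$ with unstable manifold $W^u$, and $F$ has a strange attractor $\Lambda_F=\overline{W^u}$ (Misiurewicz). Itineraries: an itinerary of $P\in\Lambda_F$ is a bi-infinite sequence $\ldots p_{-1}\cdot p_0p_1\ldots$ of symbols in $\{-,+\}$ such that $F^n(P)$ has non-positive first coordinate if $p_n=-$ and non-negative first coordinate if $p_n=+$ (both symbols are allowed at $n$ if $F^n(P)$ lies on the $y$-axis). Basic critical points are the points of $W^u$ on the $y$-axis; turning points are the images under $F$ of the basic critical points. Kneading sequences are the itineraries of the turning points, and the set of all kneading sequences of $F$ is denoted $\mathfrak K_F$ (with $\mathfrak K_i=\mathfrak K_{F_i}$). *)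

theory Defs
  imports "HOL-Analysis.Analysis"
begin

definition lozi :: "real \<Rightarrow> real \<Rightarrow> real \<times> real \<Rightarrow> real \<times> real" where
  "lozi a b = (\<lambda>(x, y). (1 + y - a * \<bar>x\<bar>, b * x))"

definition misiurewicz_set :: "(real \<times> real) set" where
  "misiurewicz_set = {(a, b). b > 0 \<and> a * sqrt 2 - b > 2 \<and> 2 * a + b < 4}"

lemma bij_lozi:
  assumes "b \<noteq> 0"
  shows "bij (lozi a b)"
  by (rule o_bij[where g = "\<lambda>(u, v). (v / b, u - 1 + a * \<bar>v / b\<bar>)"])
    (use assms in \<open>auto simp: lozi_def fun_eq_iff abs_mult\<close>)

text \<open>
  Integer iterates of a map. Negative iterates use \<^const>\<open>inv\<close> and are only meaningful
  for bijections, such as Lozi maps with \<open>b \<noteq> 0\<close> (lemma \<open>bij_lozi\<close>).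
\<close>
definition int_iter :: "('a \<Rightarrow> 'a) \<Rightarrow> int \<Rightarrow> 'a \<Rightarrow> 'a" where
  "int_iter f n = (if n \<ge> 0 then f ^^ nat n else inv f ^^ nat (- n))"

definition lozi_fixpoint :: "real \<Rightarrow> real \<Rightarrow> real \<times> real" where
  "lozi_fixpoint a b = (1 / (1 + a - b), b / (1 + a - b))"

lemma lozi_fixpoint_fixed:
  assumes "(a, b) \<in> misiurewicz_set"
  shows "lozi a b (lozi_fixpoint a b) = lozi_fixpoint a b"
proof -
  have b: "b > 0" and *: "a * sqrt 2 - b > 2" and **: "2 * a + b < 4"
    using assms by (auto simp: misiurewicz_set_def)
  have "a * sqrt 2 > 0"
    using b * by linarith
  then have "a > 0"
    by (simp add: zero_less_mult_iff)
  moreover have "sqrt 2 < 2"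
    by (simp add: real_less_lsqrt)
  ultimately have "a * sqrt 2 < a * 2"
    by simp
  with b * ** have "1 + a - b > 0"
    by linarith
  then show ?thesis
    by (simp add: lozi_def lozi_fixpoint_def abs_of_pos) (simp add: divide_simps)
qed

definition unstable_manifold :: "('a::topological_space \<Rightarrow> 'a) \<Rightarrow> 'a \<Rightarrow> 'a set" where
  "unstable_manifold f p = {q. (\<lambda>n. (inv f ^^ n) q) \<longlonglongrightarrow> p}"

definition lozi_Wu :: "real \<Rightarrow> real \<Rightarrow> (real \<times> real) set" where
  "lozi_Wu a b = unstable_manifold (lozi a b) (lozi_fixpoint a b)"

definition lozi_attractor :: "real \<Rightarrow> real \<Rightarrow> (real \<times> real) set" where
  "lozi_attractor a b = closure (lozi_Wu a b)"

datatype sign = Minus | Plus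

text \<open>
  A point whose orbit meets the y-axis has several itineraries, so being an itinerary is a
  relation. Position \<open>0\<close> is the symbol just to the right of the dot.
\<close>
definition is_itinerary :: "real \<Rightarrow> real \<Rightarrow> real \<times> real \<Rightarrow> (int \<Rightarrow> sign) \<Rightarrow> bool" where
  "is_itinerary a b P p \<longleftrightarrow> P \<in> lozi_attractor a b \<and>
     (\<forall>n. (p n = Minus \<longrightarrow> fst (int_iter (lozi a b) n P) \<le> 0) \<and>
          (p n = Plus \<longrightarrow> fst (int_iter (lozi a b) n P) \<ge> 0))"

definition basic_critical_points :: "real \<Rightarrow> real \<Rightarrow> (real \<times> real) set" where
  "basic_critical_points a b = {P \<in> lozi_Wu a b. fst P = 0}"

definition turning_points :: "real \<Rightarrow> real \<Rightarrow> (real \<times> real) set" where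
  "turning_points a b = lozi a b ` basic_critical_points a b"

definition kneading_set :: "real \<Rightarrow> real \<Rightarrow> (int \<Rightarrow> sign) set" where
  "kneading_set a b = {p. \<exists>T \<in> turning_points a b. is_itinerary a b T p}"

definition conjugate_on ::
  "'a::topological_space set \<Rightarrow> ('a \<Rightarrow> 'a) \<Rightarrow> 'b::topological_space set \<Rightarrow> ('b \<Rightarrow> 'b) \<Rightarrow> bool" where
  "conjugate_on S f T g \<longleftrightarrow>
     (\<exists>h k. homeomorphism S T h k \<and> (\<forall>x\<in>S. h (f x) = g (h x)))"

end

theory Submission
  imports Defs
begin

text \<open>
  Say that points of the two unstable manifolds are compatible if at all times they lie on the same
  sides of the y-axis, and let \<open>\<Gamma>\<close> be the closure of this relation. Equality of the kneading sets
  makes \<open>\<Gamma>\<close> project onto both attractors, because orbits through basic critical points are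
  dense; it remains to see that \<open>\<Gamma>\<close> is the graph of a bijection.

  Two points coupled to the same point \<open>p\<close> with eventually equal pasts would span an unstable
  segment coupled to \<open>p\<close> alone; it could be folded only when \<open>p\<close> hits the y-axis, never at two
  consecutive times, so it would grow without bound since the squared expansion rate exceeds 2.
  If the pasts differ infinitely often, an analysis of the chords from \<open>p\<close> to nearby points shows
  that at most two points are coupled to \<open>p\<close>, and such \<open>p\<close> form a countable set since their
  orbits hit the y-axis twice. As the attractor does not separate the plane, every map from it to
  the circle has a logarithm, which rules out two-point fibres over a countable set.
\<close>

section \<open>Parameters, orbits and the unstable cone\<close>

text \<open>Compatibility is not transitive: a point on the y-axis is compatible with both sides.
  Hence common itineraries need not identify points, and hits of the y-axis govern every uniqueness
  argument. A segment spanned by two partners of a point must lie in the attractor before anything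
  can be coupled to it. It does because the attractor consists exactly of the points whose whole
  past stays in the convex trapping region \<open>K\<close>. The chord analysis stops at two because
  a hit synchronizes chords in opposite time directions: unstable chords at the times after it,
  steep chords at the times before it. One partner of each kind remains possible, and only the
  topological argument excludes this. The condition \<open>2 * a + b < 4\<close> means
  \<open>\<nu> < 2\<close> and keeps \<open>K\<close> away from the stable line of the left fixed
  point. The condition \<open>a * sqrt 2 - b > 2\<close> gives \<open>\<mu> > sqrt 2\<close>, the
  growth despite folds, and makes the unstable manifold reach across the stable line of
  \<open>X\<close>. The coupling is symmetric in the two maps, so single-valuedness of the swapped
  relation is injectivity.\<close>

lemma int_iter_0 [simp]: "int_iter f 0 x = x"
  by (simp add: int_iter_def)

lemma int_iter_Suc:
  assumes "bij f"
  shows "int_iter f (n + 1) x = f (int_iter f n x)"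
proof -
  consider "n \<ge> 0" | "n = -1" | "n < -1" by linarith
  then show ?thesis
  proof cases
    case 1
    then have "nat (n + 1) = Suc (nat n)" by simp
    with 1 show ?thesis by (simp add: int_iter_def)
  next
    case 2
    with assms show ?thesis by (simp add: int_iter_def bij_is_surj surj_f_inv_f)
  next
    case 3
    then have "nat (- n) = Suc (nat (- (n + 1)))" by simp
    with 3 assms show ?thesis by (simp add: int_iter_def bij_is_surj surj_f_inv_f)
  qed
qed

lemma int_iter_pred:
  assumes "bij f"
  shows "int_iter f (n - 1) x = inv f (int_iter f n x)"
  using int_iter_Suc[OF assms, of "n - 1" x] assms by (simp add: bij_is_inj)

lemma int_iter_add:
  assumes "bij f"
  shows "int_iter f (m + n) x = int_iter f m (int_iter f n x)"
proof (induction m rule: int_induct[where k = 0])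
  case (step1 i)
  then show ?case
    using int_iter_Suc[OF assms, of "i + n" x] int_iter_Suc[OF assms, of i "int_iter f n x"]
    by (simp add: algebra_simps)
next
  case (step2 i)
  then show ?case
    using int_iter_pred[OF assms, of "i + n" x] int_iter_pred[OF assms, of i "int_iter f n x"]
    by (simp add: algebra_simps)
qed simp

lemma same_sign_cases:
  fixes x y :: real
  assumes "x * y \<ge> 0"
  obtains e :: real where "e = 1 \<or> e = -1" "\<bar>x\<bar> = e * x" "\<bar>y\<bar> = e * y"
proof (cases "x \<ge> 0 \<and> y \<ge> 0")
  case True
  then show ?thesis using that[of 1] by simp
next
  case False
  then have "x \<le> 0 \<and> y \<le> 0"
    using assms by (auto simp: zero_le_mult_iff)
  then show ?thesis using that[of "-1"] by simp
qed

text \<open>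
  All parameter conditions become transparent in terms of the eigenvalues \<open>- \<nu>\<close> and \<open>\<kappa>\<close> of the
  derivative at the fixed point: \<open>a = \<nu> - \<kappa>\<close> and \<open>b = \<kappa> * \<nu>\<close>. The numbers \<open>\<mu>\<close> and \<open>s\<close> are the
  smallest expansion rate and the largest slope in the unstable cone: \<open>a = \<mu> + s\<close>, \<open>b = \<mu> * s\<close>.
\<close>

locale lozi_map =
  fixes a b \<nu> \<kappa> \<mu> s :: real
  assumes b_pos: "b > 0" and par1: "a * sqrt 2 - b > 2" and par2: "2 * a + b < 4"
    and a_eq: "a = \<nu> - \<kappa>" and b_eq: "b = \<kappa> * \<nu>" and \<nu>_pos: "\<nu> > 0"
    and a_split: "a = \<mu> + s" and b_split: "b = \<mu> * s" and s_le_\<mu>: "s \<le> \<mu>"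
begin

abbreviation F :: "real \<times> real \<Rightarrow> real \<times> real" where "F \<equiv> lozi a b"
abbreviation orb :: "int \<Rightarrow> real \<times> real \<Rightarrow> real \<times> real" where "orb \<equiv> int_iter (lozi a b)"
abbreviation W :: "(real \<times> real) set" where "W \<equiv> lozi_Wu a b"
abbreviation L :: "(real \<times> real) set" where "L \<equiv> lozi_attractor a b"

text \<open>The inverse of \<open>F\<close>. As \<open>F\<close> sends the y-axis onto the x-axis,
  the two affine pieces of \<open>G\<close> are the half-planes above and below the x-axis.\<close>

definition G :: "real \<times> real \<Rightarrow> real \<times> real" where
  "G v = (snd v / b, fst v - 1 + a * \<bar>snd v / b\<bar>)"

lemma sqrt2_bounds: "141/100 < sqrt 2" "sqrt 2 < 142/100"
  by (rule real_less_rsqrt, simp add: power2_eq_square)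
    (rule real_less_lsqrt, simp_all add: power2_eq_square)

lemma a_pos: "a > 0"
proof -
  have "a * sqrt 2 > 0" using par1 b_pos by linarith
  then show ?thesis by (simp add: zero_less_mult_iff)
qed

lemma \<kappa>_pos: "\<kappa> > 0"
  using b_eq b_pos \<nu>_pos by (simp add: zero_less_mult_iff)

lemma \<nu>_less: "\<nu> < 2"
proof -
  have "(\<nu> - 2) * (2 + \<kappa>) = 2 * a + b - 4"
    unfolding a_eq b_eq by (simp add: algebra_simps)
  then have "(\<nu> - 2) * (2 + \<kappa>) < 0" using par2 by linarith
  then show ?thesis using \<kappa>_pos by (auto simp: mult_less_0_iff)
qed

lemma \<kappa>_bound: "\<kappa> * (sqrt 2 + \<nu>) < sqrt 2 * \<nu> - 2"
  using par1 unfolding a_eq b_eq by (simp add: algebra_simps)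

lemma \<nu>_greater: "\<nu> > sqrt 2"
proof -
  have "0 < \<kappa> * (sqrt 2 + \<nu>)" using \<kappa>_pos \<nu>_pos by (simp add: add_pos_pos)
  then have "0 < sqrt 2 * (\<nu> - sqrt 2)" using \<kappa>_bound by (simp add: right_diff_distrib)
  then show ?thesis by (simp add: zero_less_mult_iff)
qed

text \<open>The upper bound for \<open>\<kappa>\<close> in \<open>\<kappa>_bound\<close> increases
  with \<open>\<nu>\<close>; at \<open>\<nu> = 2\<close> it is about 0.243.\<close>

lemma \<kappa>_less: "\<kappa> < 1/4"
proof (rule ccontr)
  assume "\<not> \<kappa> < 1/4"
  then have "1/4 * (sqrt 2 + \<nu>) \<le> \<kappa> * (sqrt 2 + \<nu>)"
    using \<nu>_pos by (intro mult_right_mono) auto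
  then have "2 + sqrt 2 / 4 < \<nu> * (sqrt 2 - 1/4)"
    using \<kappa>_bound by (simp add: algebra_simps)
  moreover have "\<nu> * (sqrt 2 - 1/4) \<le> 2 * (sqrt 2 - 1/4)"
    using \<nu>_less sqrt2_bounds by (intro mult_right_mono) auto
  ultimately have "2 + sqrt 2 / 4 < 2 * (sqrt 2 - 1/4)" by (rule less_le_trans)
  then have "7 / 4 * sqrt 2 > 5 / 2" by (simp add: algebra_simps)
  then show False using sqrt2_bounds by linarith
qed

lemma \<nu>_bounds: "141/100 < \<nu>" "\<nu> < 2" "0 < \<kappa>" "\<kappa> < 1/4"
  using \<nu>_greater sqrt2_bounds \<nu>_less \<kappa>_pos \<kappa>_less by auto

lemma b_less: "b < 1/2"
proof -
  have "\<kappa> * \<nu> < 1/4 * 2"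
    using \<nu>_bounds by (intro mult_strict_mono) auto
  then show ?thesis using b_eq by simp
qed

text \<open>The first parameter inequality says that the polynomial with roots \<open>\<mu>\<close>
  and \<open>s\<close> is negative at \<open>sqrt 2\<close>, so \<open>sqrt 2\<close> lies strictly
  between the roots.\<close>

lemma \<mu>_gt: "\<mu> > sqrt 2"
proof (rule ccontr)
  assume *: "\<not> \<mu> > sqrt 2"
  have "(sqrt 2 - \<mu>) * (sqrt 2 - s) \<ge> 0" using * s_le_\<mu> by (intro mult_nonneg_nonneg) auto
  moreover have "(sqrt 2 - \<mu>) * (sqrt 2 - s) = 2 - a * sqrt 2 + b"
    using a_split b_split by (simp add: algebra_simps)
  ultimately show False using par1 by linarith
qed

lemma \<mu>_pos: "\<mu> > 0" and \<mu>_gt1: "\<mu> > 1"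
  using \<mu>_gt sqrt2_bounds by linarith+

lemma s_pos: "s > 0"
  using b_split b_pos \<mu>_pos by (simp add: zero_less_mult_iff)

lemma \<mu>_sq: "\<mu> * \<mu> > 2"
proof -
  have "sqrt 2 * sqrt 2 < \<mu> * \<mu>" using \<mu>_gt \<mu>_pos by (intro mult_strict_mono) auto
  then show ?thesis by simp
qed

lemma fst_F: "fst (F v) = 1 + snd v - a * \<bar>fst v\<bar>"
  and snd_F: "snd (F v) = b * fst v"
  by (auto simp: lozi_def case_prod_beta)

lemma bij_F: "bij F"
  using bij_lozi b_pos by simp

lemma FG [simp]: "F (G v) = v" and GF [simp]: "G (F v) = v"
  using b_pos by (auto simp: lozi_def G_def prod_eq_iff case_prod_beta)

lemma inv_F: "inv F = G"
  by (rule inv_equality) auto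

lemma orb_Suc: "orb (n + 1) p = F (orb n p)"
  by (rule int_iter_Suc[OF bij_F])

lemma orb_pred: "orb (n - 1) p = G (orb n p)"
  using int_iter_pred[OF bij_F] by (simp add: inv_F)

lemma orb_add: "orb (m + n) p = orb m (orb n p)"
  by (rule int_iter_add[OF bij_F])

lemma orb_cancel [simp]: "orb n (orb (- n) p) = p" "orb (- n) (orb n p) = p"
  using orb_add[of n "-n" p] orb_add[of "-n" n p] by auto

lemma cont_F: "continuous_on A F"
  unfolding lozi_def case_prod_beta by (intro continuous_intros)

lemma cont_G: "continuous_on A G"
  unfolding G_def using b_pos by (intro continuous_intros) auto

lemma cont_orb: "continuous_on A (orb n)"
proof (induction n arbitrary: A rule: int_induct[where k = 0])
  case base
  then show ?case by simp
next
  case (step1 i)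
  have "orb (i + 1) = F \<circ> orb i" by (auto simp: orb_Suc)
  then show ?case using continuous_on_compose[OF step1(2) cont_F] by metis
next
  case (step2 i)
  have "orb (i - 1) = G \<circ> orb i" by (auto simp: orb_pred)
  then show ?case using continuous_on_compose[OF step2(2) cont_G] by metis
qed

lemma tendsto_orb: "(f \<longlongrightarrow> l) net \<Longrightarrow> ((\<lambda>x. orb n (f x)) \<longlongrightarrow> orb n l) net"
  by (rule continuous_on_tendsto_compose[OF cont_orb[of UNIV n]]) auto

lemma orb_inj: "orb n p = orb n q \<longleftrightarrow> p = q"
  by (metis orb_cancel(2))

lemma orb_nat: "orb (int n) p = (F ^^ n) p"
  by (simp add: int_iter_def)

lemma orb_neg_nat: "orb (- int n) p = (G ^^ n) p"
  by (cases "n = 0") (simp_all add: int_iter_def inv_F)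

section \<open>The unstable cone and the growth of chords\<close>

definition unst :: "real \<times> real \<Rightarrow> bool" where
  "unst w \<longleftrightarrow> \<bar>snd w\<bar> \<le> s * \<bar>fst w\<bar>"

lemma unst_zero: "unst w \<Longrightarrow> fst w = 0 \<Longrightarrow> w = 0"
  by (auto simp: unst_def prod_eq_iff)

lemma unst_scale: "unst w \<Longrightarrow> unst (c *\<^sub>R w)"
  using mult_left_mono[of "\<bar>snd w\<bar>" "s * \<bar>fst w\<bar>" "\<bar>c\<bar>"] by (simp add: unst_def abs_mult mult.left_commute)

text \<open>Both linear parts of \<open>F\<close> turn a slope bound \<open>t\<close> into
  \<open>b / (a - t)\<close>, and \<open>s\<close> is fixed by this since
  \<open>a - s = \<mu>\<close> and \<open>b = \<mu> * s\<close>. The sign \<open>e\<close> selects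
  the branch. The third inequality records the direction of the image chord, which the comparison of
  the two maps needs.\<close>

lemma unst_step:
  assumes "unst w" "e = 1 \<or> e = -1"
  shows "unst (snd w - a * (e * fst w), b * fst w)"
    and "\<bar>snd w - a * (e * fst w)\<bar> \<ge> \<mu> * \<bar>fst w\<bar>"
    and "(snd w - a * (e * fst w)) * (- e * fst w) \<ge> \<mu> * (fst w)\<^sup>2"
proof -
  have w: "\<bar>snd w\<bar> \<le> s * \<bar>fst w\<bar>" using assms by (simp add: unst_def)
  have e: "\<bar>a * (e * fst w)\<bar> = a * \<bar>fst w\<bar>" using assms(2) a_pos by (auto simp: abs_mult)
  show *: "\<bar>snd w - a * (e * fst w)\<bar> \<ge> \<mu> * \<bar>fst w\<bar>"
  proof -
    have "a * \<bar>fst w\<bar> - s * \<bar>fst w\<bar> = \<mu> * \<bar>fst w\<bar>" using a_split by (simp add: algebra_simps)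
    then show ?thesis using w e by linarith
  qed
  have "b * \<bar>fst w\<bar> = s * (\<mu> * \<bar>fst w\<bar>)" using b_split by simp
  also have "\<dots> \<le> s * \<bar>snd w - a * (e * fst w)\<bar>" using * s_pos by simp
  finally show "unst (snd w - a * (e * fst w), b * fst w)"
    using b_pos by (simp add: unst_def abs_mult)
  have "\<bar>e\<bar> = 1" "e * e = 1" using assms(2) by auto
  then have "\<bar>snd w * (- e * fst w)\<bar> = \<bar>snd w\<bar> * \<bar>fst w\<bar>" by (simp add: abs_mult)
  moreover have "\<bar>snd w\<bar> * \<bar>fst w\<bar> \<le> s * \<bar>fst w\<bar> * \<bar>fst w\<bar>" using w by (intro mult_right_mono) auto
  ultimately have "snd w * (- e * fst w) \<ge> - (s * \<bar>fst w\<bar> * \<bar>fst w\<bar>)" by linarith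
  moreover have "\<bar>fst w\<bar> * \<bar>fst w\<bar> = (fst w)\<^sup>2" by (simp add: power2_eq_square)
  ultimately have "snd w * (- e * fst w) \<ge> - (s * (fst w)\<^sup>2)" by (simp add: mult.assoc)
  moreover have "- (a * (e * fst w)) * (- e * fst w) = a * (fst w)\<^sup>2 * (e * e)"
    by (simp add: power2_eq_square)
  moreover have "(snd w - a * (e * fst w)) * (- e * fst w) = snd w * (- e * fst w) + - (a * (e * fst w)) * (- e * fst w)"
    by (simp add: algebra_simps)
  ultimately show "(snd w - a * (e * fst w)) * (- e * fst w) \<ge> \<mu> * (fst w)\<^sup>2"
    using \<open>e * e = 1\<close> a_split by (simp add: algebra_simps)
qed

lemma F_diff:
  assumes "\<bar>fst p\<bar> = e * fst p" "\<bar>fst q\<bar> = e * fst q"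
  shows "F q - F p = (snd (q - p) - a * (e * fst (q - p)), b * fst (q - p))"
  using assms by (auto simp: prod_eq_iff fst_F snd_F algebra_simps)

lemma F_unst:
  assumes "fst p * fst q \<ge> 0" "unst (q - p)"
  shows "unst (F q - F p)" "\<bar>fst (F q - F p)\<bar> \<ge> \<mu> * \<bar>fst (q - p)\<bar>"
proof -
  obtain e :: real where e: "e = 1 \<or> e = -1" "\<bar>fst p\<bar> = e * fst p" "\<bar>fst q\<bar> = e * fst q"
    using same_sign_cases[OF assms(1)] by blast
  show "unst (F q - F p)" "\<bar>fst (F q - F p)\<bar> \<ge> \<mu> * \<bar>fst (q - p)\<bar>"
    using unst_step[OF assms(2) e(1)] F_diff[OF e(2,3)] by simp_all
qed

text \<open>A linear measure of how far a chord lies outside the unstable cone, chosen because each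
  inverse branch multiplies a positive value by at least \<open>\<mu> / b\<close>.\<close>

definition steep_excess :: "real \<times> real \<Rightarrow> real" where
  "steep_excess w = \<bar>snd w\<bar> - s * \<bar>fst w\<bar>"

lemma unst_iff_excess: "unst w \<longleftrightarrow> steep_excess w \<le> 0"
  by (simp add: unst_def steep_excess_def)

lemma steep_excess_back:
  assumes "e = 1 \<or> e = -1"
  shows "steep_excess (v / b, u + a * (e * (v / b))) \<ge> (\<mu> / b) * steep_excess (u, v)"
proof -
  have "\<bar>a * (e * (v / b))\<bar> = a * \<bar>v\<bar> / b" using assms a_pos b_pos by (auto simp: abs_mult)
  then have "\<bar>u + a * (e * (v / b))\<bar> \<ge> a * \<bar>v\<bar> / b - \<bar>u\<bar>" by linarith
  moreover have "a * \<bar>v\<bar> / b = \<mu> * \<bar>v\<bar> / b + s * \<bar>v\<bar> / b" using a_split by (simp add: algebra_simps add_divide_distrib)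
  moreover have "(\<mu> / b) * (s * \<bar>u\<bar>) = \<bar>u\<bar>"
    using b_split b_pos by (metis less_irrefl nonzero_mult_div_cancel_left times_divide_eq_left mult.assoc)
  ultimately show ?thesis
    using b_pos unfolding steep_excess_def by (simp add: right_diff_distrib)
qed

lemma G_diff:
  assumes "fst p * fst q \<ge> 0"
  obtains e :: real where "e = 1 \<or> e = -1" "\<bar>fst p\<bar> = e * fst p" "\<bar>fst q\<bar> = e * fst q"
    "q - p = (snd (F q - F p) / b, fst (F q - F p) + a * (e * (snd (F q - F p) / b)))"
proof -
  obtain e :: real where e: "e = 1 \<or> e = -1" "\<bar>fst p\<bar> = e * fst p" "\<bar>fst q\<bar> = e * fst q"
    using same_sign_cases[OF assms(1)] by blast
  show ?thesis
    using that[OF e] F_diff[OF e(2,3)] b_pos by (simp add: prod_eq_iff)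
qed

lemma \<mu>_div_b: "\<mu> / b > 1" "\<mu> / (2 * b) > 1"
  using \<mu>_gt1 b_pos b_less by (simp_all add: field_simps)

lemma bounded_fst_snd:
  fixes K :: "(real \<times> real) set"
  assumes "bounded K"
  obtains B where "B > 0" "\<And>p q. p \<in> K \<Longrightarrow> q \<in> K \<Longrightarrow> \<bar>fst (q - p)\<bar> \<le> B \<and> \<bar>snd (q - p)\<bar> \<le> B"
proof -
  obtain C where C: "C > 0" "\<forall>x\<in>K. norm x \<le> C" using assms bounded_pos by blast
  have "\<bar>fst (q - p)\<bar> \<le> 2 * C \<and> \<bar>snd (q - p)\<bar> \<le> 2 * C" if "p \<in> K" "q \<in> K" for p q
  proof -
    have "norm p \<le> C" "norm q \<le> C" using C that by auto
    then have "norm (q - p) \<le> 2 * C" using norm_triangle_ineq4[of q p] by linarith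
    then show ?thesis
      by (metis norm_fst_le norm_snd_le order_trans prod.collapse real_norm_def)
  qed
  then show ?thesis using that[of "2 * C"] C by auto
qed

text \<open>A positive \<open>steep_excess\<close> would grow geometrically along the past as long
  as the y-axis does not separate the two orbits, which boundedness excludes.\<close>

lemma past_unst:
  assumes "bounded K"
    and K: "\<And>n. n \<le> 0 \<Longrightarrow> orb n p \<in> K" "\<And>n. n \<le> 0 \<Longrightarrow> orb n q \<in> K"
    and same: "\<And>n. n < 0 \<Longrightarrow> fst (orb n p) * fst (orb n q) \<ge> 0"
  shows "unst (q - p)"
proof (rule ccontr)
  assume "\<not> unst (q - p)"
  then have pos: "steep_excess (q - p) > 0" by (simp add: unst_iff_excess)
  have grow: "steep_excess (orb (- int n) q - orb (- int n) p) \<ge> (\<mu> / b) ^ n * steep_excess (q - p)" for n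
  proof (induction n)
    case (Suc n)
    let ?p = "orb (- int (Suc n)) p" and ?q = "orb (- int (Suc n)) q"
    have F: "F ?p = orb (- int n) p" "F ?q = orb (- int n) q"
      using orb_Suc[of "- int (Suc n)"] by simp_all
    have "fst ?p * fst ?q \<ge> 0" by (rule same) simp
    then obtain e :: real where "e = 1 \<or> e = -1"
      "?q - ?p = (snd (F ?q - F ?p) / b, fst (F ?q - F ?p) + a * (e * (snd (F ?q - F ?p) / b)))"
      using G_diff by blast
    then have "steep_excess (?q - ?p) \<ge> (\<mu> / b) * steep_excess (F ?q - F ?p)"
      using steep_excess_back[of e "fst (F ?q - F ?p)" "snd (F ?q - F ?p)"]
      by (metis prod.collapse)
    also have "(\<mu> / b) * steep_excess (F ?q - F ?p) \<ge> (\<mu> / b) * ((\<mu> / b) ^ n * steep_excess (q - p))"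
      using Suc F \<mu>_pos b_pos by (intro mult_left_mono) auto
    finally show ?case by simp
  qed simp
  obtain B where B: "B > 0" "\<And>p q. p \<in> K \<Longrightarrow> q \<in> K \<Longrightarrow> \<bar>fst (q - p)\<bar> \<le> B \<and> \<bar>snd (q - p)\<bar> \<le> B"
    using bounded_fst_snd[OF assms(1)] by blast
  obtain n where "B / steep_excess (q - p) < (\<mu> / b) ^ n"
    using real_arch_pow \<mu>_div_b by blast
  then have "B < (\<mu> / b) ^ n * steep_excess (q - p)" using pos by (simp add: field_simps)
  also have "\<dots> \<le> steep_excess (orb (- int n) q - orb (- int n) p)" by (rule grow)
  also have "\<dots> \<le> \<bar>snd (orb (- int n) q - orb (- int n) p)\<bar>"
    using s_pos by (simp add: steep_excess_def)
  also have "\<dots> \<le> B" using B(2) K by auto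
  finally show False by simp
qed

lemma future_grow:
  assumes "unst (q - p)" "\<And>i. i < n \<Longrightarrow> fst (orb (int i) p) * fst (orb (int i) q) \<ge> 0"
  shows "unst (orb (int n) q - orb (int n) p) \<and>
    \<bar>fst (orb (int n) q - orb (int n) p)\<bar> \<ge> \<mu> ^ n * \<bar>fst (q - p)\<bar>"
  using assms(2)
proof (induction n)
  case 0
  then show ?case using assms(1) by simp
next
  case (Suc n)
  let ?p = "orb (int n) p" and ?q = "orb (int n) q"
  have eq: "orb (int (Suc n)) p = F ?p" "orb (int (Suc n)) q = F ?q"
    using orb_Suc[of "int n"] by (simp_all add: add.commute)
  have IH: "unst (?q - ?p)" "\<bar>fst (?q - ?p)\<bar> \<ge> \<mu> ^ n * \<bar>fst (q - p)\<bar>"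
    using Suc by simp_all
  have "\<bar>fst (F ?q - F ?p)\<bar> \<ge> \<mu> * \<bar>fst (?q - ?p)\<bar>"
    using F_unst Suc.prems IH by blast
  also have "\<mu> * \<bar>fst (?q - ?p)\<bar> \<ge> \<mu> * (\<mu> ^ n * \<bar>fst (q - p)\<bar>)"
    using IH \<mu>_pos by (intro mult_left_mono) auto
  finally show ?case using F_unst(1)[OF _ IH(1)] Suc.prems eq by simp
qed

lemma future_eq:
  assumes "bounded K" "unst (q - p)"
    and K: "\<And>n. n \<ge> 0 \<Longrightarrow> orb n p \<in> K" "\<And>n. n \<ge> 0 \<Longrightarrow> orb n q \<in> K"
    and same: "\<And>n. n \<ge> 0 \<Longrightarrow> fst (orb n p) * fst (orb n q) \<ge> 0"
  shows "p = q"
proof (rule ccontr)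
  assume "p \<noteq> q"
  then have pos: "\<bar>fst (q - p)\<bar> > 0" using unst_zero[OF assms(2)] by auto
  obtain B where B: "B > 0" "\<And>p q. p \<in> K \<Longrightarrow> q \<in> K \<Longrightarrow> \<bar>fst (q - p)\<bar> \<le> B \<and> \<bar>snd (q - p)\<bar> \<le> B"
    using bounded_fst_snd[OF assms(1)] by blast
  obtain n where "B / \<bar>fst (q - p)\<bar> < \<mu> ^ n"
    using real_arch_pow \<mu>_gt1 by blast
  then have "B < \<mu> ^ n * \<bar>fst (q - p)\<bar>" using pos by (simp add: field_simps)
  also have "\<dots> \<le> \<bar>fst (orb (int n) q - orb (int n) p)\<bar>"
    using future_grow[OF assms(2)] same by simp
  also have "\<dots> \<le> B" using B(2) K by auto
  finally show False by simp
qed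

section \<open>The affine pieces of the map and of its inverse\<close>

lemma convex_comb_sign:
  fixes x y :: real
  assumes "x * y \<ge> 0" "0 \<le> \<theta>" "\<theta> \<le> 1"
  shows "\<bar>(1 - \<theta>) * x + \<theta> * y\<bar> = (1 - \<theta>) * \<bar>x\<bar> + \<theta> * \<bar>y\<bar>"
proof -
  obtain e :: real where e: "e = 1 \<or> e = -1" "\<bar>x\<bar> = e * x" "\<bar>y\<bar> = e * y"
    using same_sign_cases[OF assms(1)] by blast
  have nn: "(1 - \<theta>) * \<bar>x\<bar> + \<theta> * \<bar>y\<bar> \<ge> 0" using assms by simp
  have "(1 - \<theta>) * \<bar>x\<bar> + \<theta> * \<bar>y\<bar> = e * ((1 - \<theta>) * x + \<theta> * y)"
    using e by (simp add: algebra_simps)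
  then show ?thesis using nn e(1) by (elim disjE) simp_all
qed

lemma F_affine:
  assumes "fst p * fst q \<ge> 0" "0 \<le> \<theta>" "\<theta> \<le> 1"
  shows "F ((1 - \<theta>) *\<^sub>R p + \<theta> *\<^sub>R q) = (1 - \<theta>) *\<^sub>R F p + \<theta> *\<^sub>R F q"
proof -
  define A where "A = \<bar>(1 - \<theta>) * fst p + \<theta> * fst q\<bar>"
  have A: "A = (1 - \<theta>) * \<bar>fst p\<bar> + \<theta> * \<bar>fst q\<bar>"
    unfolding A_def by (rule convex_comb_sign[OF assms])
  have "1 + ((1 - \<theta>) * snd p + \<theta> * snd q) - a * A
      = (1 - \<theta>) * (1 + snd p - a * \<bar>fst p\<bar>) + \<theta> * (1 + snd q - a * \<bar>fst q\<bar>)"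
    unfolding A by (simp add: algebra_simps)
  then show ?thesis
    unfolding A_def by (simp add: prod_eq_iff fst_F snd_F distrib_left mult.left_commute)
qed

lemma G_affine:
  assumes "snd p * snd q \<ge> 0" "0 \<le> \<theta>" "\<theta> \<le> 1"
  shows "G ((1 - \<theta>) *\<^sub>R p + \<theta> *\<^sub>R q) = (1 - \<theta>) *\<^sub>R G p + \<theta> *\<^sub>R G q"
proof -
  have *: "\<bar>y / b\<bar> = \<bar>y\<bar> / b" for y using b_pos by simp
  define A where "A = \<bar>(1 - \<theta>) * snd p + \<theta> * snd q\<bar>"
  have A: "A = (1 - \<theta>) * \<bar>snd p\<bar> + \<theta> * \<bar>snd q\<bar>"
    unfolding A_def by (rule convex_comb_sign[OF assms])
  have "(1 - \<theta>) * fst p + \<theta> * fst q - 1 + a * (A / b)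
      = (1 - \<theta>) * (fst p - 1 + a * (\<bar>snd p\<bar> / b)) + \<theta> * (fst q - 1 + a * (\<bar>snd q\<bar> / b))"
    unfolding A by (simp add: algebra_simps add_divide_distrib diff_divide_distrib)
  then show ?thesis
    unfolding A_def G_def * fst_add snd_add fst_scaleR snd_scaleR real_scaleR_def
    by (simp add: prod_eq_iff add_divide_distrib)
qed

lemma F_segment:
  assumes "fst p * fst q \<ge> 0"
  shows "F ` closed_segment p q = closed_segment (F p) (F q)"
  unfolding closed_segment_image_interval image_image
  by (rule image_cong) (auto simp: F_affine[OF assms])

lemma G_segment:
  assumes "snd p * snd q \<ge> 0"
  shows "G ` closed_segment p q = closed_segment (G p) (G q)"
  unfolding closed_segment_image_interval image_image
  by (rule image_cong) (auto simp: G_affine[OF assms])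

end

lemma quadratic_split:
  fixes p q :: real
  assumes "p\<^sup>2 - 4 * q \<ge> 0"
  obtains x y where "p = x + y" "q = x * y" "y \<le> x"
proof
  define r where "r = sqrt (p\<^sup>2 - 4 * q)"
  have r: "r * r = p * p - 4 * q"
    unfolding r_def using assms by (simp add: power2_eq_square)
  show "p = (p + r) / 2 + (p - r) / 2" by (simp add: field_simps)
  have "(p + r) / 2 * ((p - r) / 2) = (p * p - r * r) / 4" by (simp add: field_simps)
  then show "q = (p + r) / 2 * ((p - r) / 2)" using r by simp
  show "(p - r) / 2 \<le> (p + r) / 2" using assms by (simp add: r_def)
qed

lemma lozi_mapI:
  assumes "(a, b) \<in> misiurewicz_set"
  obtains \<nu> \<kappa> \<mu> s where "lozi_map a b \<nu> \<kappa> \<mu> s"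
proof -
  have b: "b > 0" and par1: "a * sqrt 2 - b > 2" and par2: "2 * a + b < 4"
    using assms by (auto simp: misiurewicz_set_def)
  \<comment> \<open>Squaring the first parameter inequality gives
    \<open>2 * a\<^sup>2 > (2 + b)\<^sup>2 \<ge> 8 * b\<close>, hence real \<open>\<mu>\<close> and
    \<open>s\<close>.\<close>
  have "(2 + b)\<^sup>2 < (a * sqrt 2)\<^sup>2"
    using par1 b by (intro power_strict_mono) auto
  then have "(2 + b)\<^sup>2 < 2 * a\<^sup>2" by (simp add: power_mult_distrib)
  moreover have "(2 + b)\<^sup>2 = (2 - b)\<^sup>2 + 8 * b" by (simp add: power2_eq_square algebra_simps)
  moreover have "(2 - b)\<^sup>2 \<ge> 0" by simp
  ultimately have "a\<^sup>2 - 4 * b \<ge> 0" by linarith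
  then obtain \<mu> s where ms: "a = \<mu> + s" "b = \<mu> * s" "s \<le> \<mu>"
    by (rule quadratic_split)
  have "a\<^sup>2 - 4 * (- b) \<ge> 0" using b by simp
  then obtain \<nu> l where nl: "a = \<nu> + l" "- b = \<nu> * l" "l \<le> \<nu>"
    by (rule quadratic_split)
  have "\<nu> > 0"
  proof (rule ccontr)
    assume "\<not> \<nu> > 0"
    then have "\<nu> * l \<ge> 0" using nl(3) by (intro mult_nonpos_nonpos) auto
    with nl(2) b show False by simp
  qed
  then have "lozi_map a b \<nu> (- l) \<mu> s"
    using b par1 par2 nl ms by unfold_locales (auto simp: mult.commute)
  then show ?thesis by (rule that)
qed

section \<open>The trapping region and the unstable manifold\<close>

text \<open>Cut at the zero of \<open>f\<close> and keep the longer piece: at most a factor 2 is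
  lost, and nothing if the ends are not separated. It is used with \<open>fst\<close> for
  \<open>F\<close> and with \<open>snd\<close> for \<open>G\<close>.\<close>

lemma halve_segment:
  fixes p q :: "'a::real_vector"
  assumes "linear f"
  obtains p' q' c where "closed_segment p' q' \<subseteq> closed_segment p q" "q' - p' = c *\<^sub>R (q - p)"
    "c \<ge> 1/2" "c \<le> 1" "f p * f q \<ge> 0 \<Longrightarrow> c = 1" "f p' * f q' \<ge> (0::real)"
proof (cases "f p * f q \<ge> 0")
  case True
  then show ?thesis using that[of p q 1] by simp
next
  case False
  define \<theta> where "\<theta> = f p / (f p - f q)"
  define r where "r = (1 - \<theta>) *\<^sub>R p + \<theta> *\<^sub>R q"
  have opp: "f p > 0 \<and> f q < 0 \<or> f p < 0 \<and> f q > 0"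
    using False by (auto simp: not_le mult_less_0_iff)
  then have \<theta>: "0 \<le> \<theta>" "\<theta> \<le> 1"
    unfolding \<theta>_def by (auto simp: divide_simps)
  have "f r = (1 - \<theta>) * f p + \<theta> * f q"
    using assms by (simp add: r_def linear_add linear_scale)
  also have "\<dots> = f p - \<theta> * (f p - f q)" by (simp add: algebra_simps)
  also have "\<dots> = 0" using opp by (auto simp: \<theta>_def)
  finally have r0: "f r = 0" .
  have r_in: "r \<in> closed_segment p q"
    using \<theta> by (auto simp: r_def in_segment)
  have rq: "q - r = (1 - \<theta>) *\<^sub>R (q - p)" and pr: "r - p = \<theta> *\<^sub>R (q - p)"
    by (simp_all add: r_def algebra_simps)
  show ?thesis
  proof (cases "\<theta> \<ge> 1/2")
    case True
    then show ?thesis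
      using that[of p r \<theta>] \<theta> r0 r_in pr False subset_closed_segment[of p r p q] by auto
  next
    case F: False
    then show ?thesis
      using that[of r q "1 - \<theta>"] \<theta> r0 r_in rq False subset_closed_segment[of r q p q] by auto
  qed
qed

context lozi_map
begin

text \<open>The point \<open>(z, 0)\<close> is the turning point belonging to the critical point
  \<open>(0, \<kappa> * z)\<close>; it is the right end of \<open>D\<close>.\<close>

definition z :: real where "z = 1 / (1 - \<kappa>)"
definition x0 :: real where "x0 = z / (1 + \<nu>)"
definition r1 :: real where "r1 = \<nu> / (\<nu> - 1)"
definition r2 :: real where "r2 = \<nu> / (1 + \<nu>)"
definition X :: "real \<times> real" where "X = (x0, \<kappa> * \<nu> * x0)"

text \<open>Four affine functions given by their zero lines: \<open>T\<close> by the unstable line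
  of \<open>X\<close>, \<open>B\<close> by the image of that line under the left branch,
  \<open>\<Phi>\<close> by the stable line of the fixed point in the left half-plane,
  \<open>\<Psi>\<close> by the stable line of \<open>X\<close>. Hence the multipliers
  \<open>\<kappa>\<close>, \<open>\<nu>\<close> and \<open>- \<nu>\<close> of \<open>T\<close>,
  \<open>\<Phi>\<close> and \<open>\<Psi>\<close> under \<open>F\<close>.\<close>

definition T :: "real \<times> real \<Rightarrow> real" where "T v = \<kappa> * fst v + snd v - \<kappa> * z"
definition B :: "real \<times> real \<Rightarrow> real" where "B v = (\<nu> - 2 * \<kappa>) * snd v - \<kappa> * \<nu> * (fst v - z)"
definition \<Phi> :: "real \<times> real \<Rightarrow> real" where "\<Phi> v = \<nu> * fst v + snd v + r1"
definition \<Psi> :: "real \<times> real \<Rightarrow> real" where "\<Psi> v = \<nu> * fst v - snd v - r2"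
text \<open>The value of \<open>\<Phi>\<close> at \<open>F (z, 0)\<close>.\<close>

definition \<epsilon> :: real where "\<epsilon> = \<nu> * (r1 - (\<nu> - 2 * \<kappa>) * z)"

text \<open>The third side runs through \<open>F (z, 0)\<close>, at positive distance from the
  stable line \<open>\<Phi> = 0\<close>. This gap rules out pasts that remain in the left
  half-plane.\<close>

definition K :: "(real \<times> real) set" where "K = {v. T v \<le> 0 \<and> B v \<ge> 0 \<and> \<Phi> v \<ge> \<epsilon>}"
text \<open>A piece of the unstable line of \<open>X\<close> that joins
  \<open>(0, \<kappa> * z)\<close> to its image \<open>(z, 0)\<close>. It is invariant under
  \<open>G\<close>, so its forward images exhaust the unstable manifold.\<close>

definition D :: "(real \<times> real) set" where "D = {v. T v = 0 \<and> 0 \<le> fst v \<and> fst v \<le> z}"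

lemma r1_mult: "r1 * \<nu> = r1 + \<nu>"
proof -
  have "r1 * (\<nu> - 1) = \<nu>" using \<nu>_bounds by (simp add: r1_def)
  then show ?thesis by (simp add: right_diff_distrib)
qed

lemma r2_mult: "r2 * \<nu> = \<nu> - r2"
proof -
  have "r2 * (1 + \<nu>) = \<nu>" using \<nu>_bounds by (simp add: r2_def)
  then show ?thesis by (simp add: distrib_left)
qed

lemma r2_pos: "r2 > 0"
  using \<nu>_bounds by (simp add: r2_def)

lemma x0_mult: "x0 + \<nu> * x0 = z"
proof -
  have "x0 * (1 + \<nu>) = z" using \<nu>_bounds by (simp add: x0_def)
  then show ?thesis by (simp add: algebra_simps)
qed

lemma fst_F': "fst (F v) = 1 + snd v - (\<nu> - \<kappa>) * \<bar>fst v\<bar>"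
  and snd_F': "snd (F v) = \<kappa> * \<nu> * fst v"
  using fst_F[of v] snd_F[of v] a_eq b_eq by auto

lemma z_eq: "z = 1 + \<kappa> * z"
  using \<nu>_bounds by (simp add: z_def field_simps)

lemma z_gt: "z > 1"
  using \<nu>_bounds by (simp add: z_def)

lemma lozi_fixpoint_eq: "lozi_fixpoint a b = X"
proof -
  have "1 + a - b = (1 + \<nu>) * (1 - \<kappa>)" by (simp add: a_eq b_eq algebra_simps)
  then show ?thesis by (simp add: lozi_fixpoint_def X_def x0_def z_def b_eq mult.commute)
qed

text \<open>Geometrically, the stable line of \<open>X\<close> meets the y-axis strictly below the
  line \<open>B = 0\<close>. The inequality also keeps \<open>(0, -1)\<close> out of
  \<open>K\<close>.\<close>

lemma par_ineq1: "(\<nu> - 2 * \<kappa>) * (1 - \<kappa>) > \<kappa> * (1 + \<nu>)"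
proof -
  have "\<nu> * (1 - 2 * \<kappa>) \<ge> (141/100) * (1 - 2 * \<kappa>)"
    using \<nu>_bounds by (intro mult_right_mono) auto
  moreover have "(1/4 - \<kappa>) * (1/4 - \<kappa>) \<ge> 0" by simp
  then have "2 * \<kappa> * \<kappa> \<ge> \<kappa> - 1/8" by (simp add: algebra_simps)
  moreover have "(141/100) * (1 - 2 * \<kappa>) - 3 * \<kappa> + (\<kappa> - 1/8) > (0::real)"
  proof -
    have "482/100 * \<kappa> < 482/400" using \<nu>_bounds by simp
    then show ?thesis by (simp add: algebra_simps)
  qed
  moreover have "(\<nu> - 2 * \<kappa>) * (1 - \<kappa>) - \<kappa> * (1 + \<nu>) = \<nu> * (1 - 2 * \<kappa>) - 3 * \<kappa> + 2 * \<kappa> * \<kappa>"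
    by (simp add: algebra_simps)
  ultimately show ?thesis by linarith
qed

text \<open>Equivalent to \<open>\<Psi> \<le> 0\<close> at \<open>F (F (z, 0))\<close>: this point
  lies on or to the left of the stable line of \<open>X\<close>. It follows from
  \<open>\<kappa>_bound\<close> multiplied by \<open>3 * \<nu>\<^sup>2 - 2\<close>; the remaining
  difference has the factor \<open>\<nu> - sqrt 2\<close>.\<close>

lemma par_ineq2: "\<kappa> * (3 * \<nu>\<^sup>2 - 2) \<le> \<nu>^3 - 2 * \<nu>"
proof -
  have nn: "3 * \<nu>\<^sup>2 - 2 > 0"
  proof -
    have "1 < \<nu>\<^sup>2" using \<nu>_bounds by (simp add: one_less_power)
    then show ?thesis by simp
  qed
  have sq: "sqrt 2 * sqrt 2 = 2" by simp
  have "\<kappa> * (sqrt 2 + \<nu>) * (3 * \<nu>\<^sup>2 - 2) \<le> (sqrt 2 * \<nu> - 2) * (3 * \<nu>\<^sup>2 - 2)"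
    using \<kappa>_bound nn by (intro mult_right_mono) auto
  also have "\<dots> \<le> (sqrt 2 + \<nu>) * (\<nu>^3 - 2 * \<nu>)"
  proof -
    have "(sqrt 2 + \<nu>) * (\<nu>^3 - 2 * \<nu>) - (sqrt 2 * \<nu> - 2) * (3 * \<nu>\<^sup>2 - 2)
        = (\<nu> - sqrt 2) * (\<nu>\<^sup>2 * (\<nu> - sqrt 2) + 2 * \<nu> + 2 * sqrt 2)
          + (sqrt 2 * sqrt 2 - 2) * (2 - \<nu>\<^sup>2)"
      by (simp add: algebra_simps power2_eq_square power3_eq_cube)
    also have "\<dots> = (\<nu> - sqrt 2) * (\<nu>\<^sup>2 * (\<nu> - sqrt 2) + 2 * \<nu> + 2 * sqrt 2)"
      unfolding sq by simp
    also have "\<dots> \<ge> 0"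
      using \<nu>_greater \<nu>_pos by (intro mult_nonneg_nonneg add_nonneg_nonneg) auto
    finally show ?thesis by simp
  qed
  finally have "(sqrt 2 + \<nu>) * (\<kappa> * (3 * \<nu>\<^sup>2 - 2)) \<le> (sqrt 2 + \<nu>) * (\<nu>^3 - 2 * \<nu>)"
    by (simp add: mult.commute mult.left_commute)
  moreover have "sqrt 2 + \<nu> > 0" using \<nu>_pos by (simp add: add_pos_pos)
  ultimately show ?thesis by simp
qed

lemma slope_pos: "\<nu> - 3 * \<kappa> > 0" "\<nu> - 2 * \<kappa> > 0"
  using \<nu>_bounds by auto

text \<open>The sign is that of \<open>2 - \<nu>\<close>, so this is the condition
  \<open>2 * a + b < 4\<close>: \<open>F (z, 0)\<close> stays to the right of the stable line of the
  left fixed point.\<close>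

lemma \<epsilon>_pos: "\<epsilon> > 0"
proof -
  have "r1 - (\<nu> - 2 * \<kappa>) * z = ((2 - \<nu>) * (\<nu> - \<kappa>)) * z / (\<nu> - 1)"
  proof -
    have n: "\<nu> = \<nu> * (z - \<kappa> * z)" using z_eq by simp
    have "(r1 - (\<nu> - 2 * \<kappa>) * z) * (\<nu> - 1) = \<nu> - (\<nu> - 2 * \<kappa>) * (\<nu> - 1) * z"
      using r1_mult by (simp add: algebra_simps)
    also have "\<dots> = \<nu> * (z - \<kappa> * z) - (\<nu> - 2 * \<kappa>) * (\<nu> - 1) * z" using n by linarith
    also have "\<dots> = ((2 - \<nu>) * (\<nu> - \<kappa>)) * z" by (simp add: algebra_simps)
    finally show ?thesis using \<nu>_bounds by (simp add: eq_divide_eq)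
  qed
  moreover have "\<dots> > 0"
    using \<nu>_bounds z_gt by (intro divide_pos_pos mult_pos_pos) auto
  ultimately show ?thesis unfolding \<epsilon>_def using \<nu>_pos by (intro mult_pos_pos) auto
qed

lemma \<epsilon>_le: "\<epsilon> \<le> r1"
proof -
  have "(\<nu> - 2 * \<kappa>) * z \<ge> (1 - \<kappa>) * z"
    using \<nu>_bounds z_gt by (intro mult_right_mono) auto
  moreover have "(1 - \<kappa>) * z = 1" using z_eq by (simp add: left_diff_distrib)
  ultimately have "\<nu> * ((\<nu> - 2 * \<kappa>) * z) \<ge> \<nu> * 1" using \<nu>_pos by (intro mult_left_mono) auto
  moreover have "\<epsilon> = r1 + \<nu> - \<nu> * ((\<nu> - 2 * \<kappa>) * z)"
    using r1_mult unfolding \<epsilon>_def by (simp add: right_diff_distrib mult.commute)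
  ultimately show ?thesis by simp
qed

lemma T_F: "fst v \<ge> 0 \<Longrightarrow> T (F v) = \<kappa> * T v"
proof -
  assume "fst v \<ge> 0"
  then have "T (F v) = \<kappa> * (\<kappa> * fst v + snd v + 1 - z)"
    by (simp add: T_def fst_F' snd_F' algebra_simps)
  moreover have "1 - z = - (\<kappa> * z)" using z_eq by linarith
  ultimately show ?thesis by (simp add: T_def)
qed

lemma B_F: "fst v \<le> 0 \<Longrightarrow> B (F v) = - (\<kappa> * \<nu> * T v)"
proof -
  assume "fst v \<le> 0"
  then have "B (F v) = - (\<kappa> * \<nu> * (\<kappa> * fst v + snd v + 1 - z))"
    by (simp add: B_def fst_F' snd_F' algebra_simps)
  moreover have "1 - z = - (\<kappa> * z)" using z_eq by linarith
  ultimately show ?thesis by (simp add: T_def)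
qed

lemma \<Phi>_F: "fst v \<le> 0 \<Longrightarrow> \<Phi> (F v) = \<nu> * \<Phi> v"
proof -
  assume *: "fst v \<le> 0"
  show ?thesis using * r1_mult by (simp add: \<Phi>_def fst_F' snd_F' algebra_simps)
qed

lemma \<Psi>_F: "fst v \<ge> 0 \<Longrightarrow> \<Psi> (F v) = - \<nu> * \<Psi> v"
proof -
  assume *: "fst v \<ge> 0"
  show ?thesis using * r2_mult by (simp add: \<Psi>_def fst_F' snd_F' algebra_simps)
qed

lemma fst_le_z:
  assumes "T v \<le> 0" "B v \<ge> 0"
  shows "fst v \<le> z"
proof (cases "snd v \<ge> 0")
  case True
  then have "\<kappa> * fst v \<le> \<kappa> * z" using assms(1) by (simp add: T_def)
  then show ?thesis using \<kappa>_pos by simp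
next
  case False
  then have "(\<nu> - 2 * \<kappa>) * snd v \<le> 0" using slope_pos by (intro mult_nonneg_nonpos) auto
  then have "\<kappa> * \<nu> * (fst v - z) \<le> 0" using assms(2) by (simp add: B_def)
  then show ?thesis using \<kappa>_pos \<nu>_pos by (simp add: mult_le_0_iff)
qed

lemma T_nonpos_of_snd:
  assumes "fst v \<le> z" "snd v \<le> 0"
  shows "T v \<le> 0"
proof -
  have "\<kappa> * fst v \<le> \<kappa> * z" using assms(1) \<kappa>_pos by (intro mult_left_mono) auto
  then show ?thesis using assms(2) unfolding T_def by linarith
qed

lemma B_nonneg_of_snd:
  assumes "fst v \<le> z" "snd v \<ge> 0"
  shows "B v \<ge> 0"
proof -
  have "\<kappa> * \<nu> * (fst v - z) \<le> 0" using assms \<kappa>_pos \<nu>_pos by (intro mult_nonneg_nonpos) auto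
  moreover have "(\<nu> - 2 * \<kappa>) * snd v \<ge> 0" using assms slope_pos by simp
  ultimately show ?thesis by (simp add: B_def)
qed

lemma F_K:
  assumes "v \<in> K"
  shows "F v \<in> K"
proof -
  have v: "T v \<le> 0" "B v \<ge> 0" "\<Phi> v \<ge> \<epsilon>" using assms by (auto simp: K_def)
  show ?thesis
  proof (cases "fst v \<ge> 0")
    case True
    have t: "T (F v) \<le> 0" using T_F[OF True] v \<kappa>_pos by (simp add: mult_nonneg_nonpos)
    have sn: "snd (F v) \<ge> 0" using True b_pos by (simp add: snd_F)
    then have "\<kappa> * fst (F v) \<le> \<kappa> * z" using t by (simp add: T_def)
    then have "fst (F v) \<le> z" using \<kappa>_pos by simp
    then have bt: "B (F v) \<ge> 0" using sn by (rule B_nonneg_of_snd)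
    \<comment> \<open>On the right half-plane the level lines of \<open>\<Phi> (F v)\<close> have
      slope \<open>d\<close>, while \<open>B v \<ge> 0\<close> bounds \<open>v\<close> below by a
      line through \<open>(z, 0)\<close> of slope \<open>\<kappa> * \<nu> / d\<close>, at most
      \<open>d\<close>. So the minimum is attained at \<open>(z, 0)\<close>, with value
      \<open>\<epsilon>\<close>.\<close>
    define d where "d = \<nu> - 2 * \<kappa>"
    have d: "d > 0" "d * d \<ge> \<kappa> * \<nu>"
    proof -
      show "d > 0" using slope_pos by (simp add: d_def)
      have "d \<ge> 91/100" using \<nu>_bounds by (simp add: d_def)
      then have "91/100 * (91/100) \<le> d * d" by (intro mult_mono) auto
      moreover have "\<kappa> * \<nu> < 1/2" using b_less b_eq by simp
      ultimately show "d * d \<ge> \<kappa> * \<nu>" by simp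
    qed
    have "fst v \<le> z" using fst_le_z v by blast
    then have "(d * d - \<kappa> * \<nu>) * (z - fst v) \<ge> 0" using d by (intro mult_nonneg_nonneg) auto
    moreover have "d * snd v \<ge> \<kappa> * \<nu> * (fst v - z)" using v(2) by (simp add: B_def d_def)
    ultimately have "d * (snd v - d * fst v) \<ge> d * (- d * z)"
      by (simp add: algebra_simps)
    then have "snd v - d * fst v \<ge> - d * z"
      using d(1) by (rule mult_left_le_imp_le)
    moreover have "\<Phi> (F v) = \<nu> * (snd v - d * fst v + r1)"
    proof -
      show ?thesis using True r1_mult by (simp add: \<Phi>_def d_def fst_F' snd_F' algebra_simps)
    qed
    ultimately have "\<Phi> (F v) \<ge> \<nu> * (r1 - d * z)"
      using \<nu>_pos mult_left_mono[of "r1 - d * z" "snd v - d * fst v + r1" \<nu>] by simp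
    then have "\<Phi> (F v) \<ge> \<epsilon>" by (simp add: \<epsilon>_def d_def)
    with t bt show ?thesis by (simp add: K_def)
  next
    case False
    then have neg: "fst v \<le> 0" by simp
    have bt: "B (F v) \<ge> 0" using B_F[OF neg] v \<kappa>_pos \<nu>_pos by (simp add: mult_nonneg_nonpos)
    have sn: "snd (F v) \<le> 0" using neg b_pos by (simp add: snd_F mult_nonneg_nonpos)
    then have "(\<nu> - 2 * \<kappa>) * snd (F v) \<le> 0" using slope_pos by (intro mult_nonneg_nonpos) auto
    then have "\<kappa> * \<nu> * (fst (F v) - z) \<le> 0" using bt by (simp add: B_def)
    then have "fst (F v) \<le> z" using \<kappa>_pos \<nu>_pos by (simp add: mult_le_0_iff)
    then have t: "T (F v) \<le> 0" using sn by (rule T_nonpos_of_snd)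
    have "\<Phi> (F v) = \<nu> * \<Phi> v" using \<Phi>_F[OF neg] .
    also have "\<dots> \<ge> 1 * \<Phi> v" using v \<epsilon>_pos \<nu>_bounds by (intro mult_right_mono) auto
    finally show ?thesis using t bt v by (simp add: K_def)
  qed
qed

lemma closed_K: "closed K"
proof -
  have "K = {v. T v \<le> 0} \<inter> {v. 0 \<le> B v} \<inter> {v. \<epsilon> \<le> \<Phi> v}" by (auto simp: K_def)
  then show ?thesis
    unfolding T_def B_def \<Phi>_def
    by (auto intro!: closed_Int closed_Collect_le continuous_intros)
qed

lemma convex_K: "convex K"
proof (rule convexI)
  fix x y :: "real \<times> real" and u v :: real
  assume *: "x \<in> K" "y \<in> K" "0 \<le> u" "0 \<le> v" "u + v = 1"
  have v: "v = 1 - u" using * by simp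
  have T: "T (u *\<^sub>R x + v *\<^sub>R y) = u * T x + v * T y"
    and B: "B (u *\<^sub>R x + v *\<^sub>R y) = u * B x + v * B y"
    and \<Phi>: "\<Phi> (u *\<^sub>R x + v *\<^sub>R y) = u * \<Phi> x + v * \<Phi> y"
    unfolding v by (simp_all add: T_def B_def \<Phi>_def algebra_simps)
  have "u * T x + v * T y \<le> 0" "u * B x + v * B y \<ge> 0"
    using * by (auto simp: K_def intro!: add_nonpos_nonpos mult_nonneg_nonpos)
  moreover have "u * \<Phi> x + v * \<Phi> y \<ge> u * \<epsilon> + v * \<epsilon>"
    using * by (intro add_mono mult_left_mono) (auto simp: K_def)
  moreover have "u * \<epsilon> + v * \<epsilon> = \<epsilon>" unfolding v by (simp add: algebra_simps)
  ultimately show "u *\<^sub>R x + v *\<^sub>R y \<in> K" using T B \<Phi> by (simp add: K_def)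
qed

lemma bounded_box:
  fixes S :: "(real \<times> real) set"
  assumes "\<And>v. v \<in> S \<Longrightarrow> l1 \<le> fst v \<and> fst v \<le> u1 \<and> l2 \<le> snd v \<and> snd v \<le> u2"
  shows "bounded S"
proof -
  have "S \<subseteq> cbox (l1, l2) (u1, u2)"
    using assms by (force simp: cbox_Pair_eq)
  then show ?thesis using bounded_subset bounded_cbox by blast
qed

lemma bounded_K: "bounded K"
proof (rule bounded_box)
  fix v assume "v \<in> K"
  then have v: "T v \<le> 0" "B v \<ge> 0" "\<Phi> v \<ge> \<epsilon>" by (auto simp: K_def)
  define l where "l = - (\<kappa> * z + r1) / (\<nu> - \<kappa>)"
  have "(\<nu> - \<kappa>) * fst v \<ge> - (\<kappa> * z + r1)"
    using v \<epsilon>_pos by (simp add: T_def \<Phi>_def algebra_simps)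
  then have l: "l \<le> fst v" using \<nu>_bounds by (simp add: l_def pos_divide_le_eq mult.commute)
  have u: "fst v \<le> z" using fst_le_z v by blast
  have "\<kappa> * l \<le> \<kappa> * fst v" using l \<kappa>_pos by simp
  then have "snd v \<le> \<kappa> * z - \<kappa> * l" using v by (simp add: T_def)
  moreover have "\<nu> * fst v \<le> \<nu> * z" using u \<nu>_pos by simp
  then have "snd v \<ge> - \<nu> * z - r1" using v \<epsilon>_pos by (simp add: \<Phi>_def)
  ultimately show "l \<le> fst v \<and> fst v \<le> z \<and> - \<nu> * z - r1 \<le> snd v \<and> snd v \<le> \<kappa> * z - \<kappa> * l"
    using l u by blast
qed

lemma compact_K: "compact K"
  using closed_K bounded_K compact_eq_bounded_closed by blast

lemma D_K: "D \<subseteq> K"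
proof
  fix v assume "v \<in> D"
  then have v: "T v = 0" "0 \<le> fst v" "fst v \<le> z" by (auto simp: D_def)
  have "\<kappa> * fst v \<le> \<kappa> * z" using v \<kappa>_pos by simp
  then have sn: "snd v \<ge> 0" using v(1) by (simp add: T_def)
  have "B v \<ge> 0" using B_nonneg_of_snd v sn by blast
  moreover have "\<nu> * fst v \<ge> 0" using v \<nu>_pos by simp
  then have "\<Phi> v \<ge> \<epsilon>" using sn \<epsilon>_le by (simp add: \<Phi>_def)
  ultimately show "v \<in> K" using v by (simp add: K_def)
qed

lemma G_D:
  assumes "v \<in> D"
  shows "G v \<in> D" "fst (G v) - x0 = - (fst v - x0) / \<nu>"
proof -
  have v: "T v = 0" "0 \<le> fst v" "fst v \<le> z" using assms by (auto simp: D_def)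
  have sn: "snd v = \<kappa> * (z - fst v)" using v(1) by (simp add: T_def algebra_simps)
  have f: "fst (G v) = (z - fst v) / \<nu>" unfolding G_def using sn b_eq \<kappa>_pos by simp
  have f0: "fst (G v) \<ge> 0" using f v \<nu>_pos by simp
  have "z - fst v \<le> z * \<nu>"
  proof -
    have "z * 1 \<le> z * \<nu>" using z_gt \<nu>_bounds by (intro mult_left_mono) auto
    then show ?thesis using v by simp
  qed
  then have fz: "fst (G v) \<le> z" using f \<nu>_pos by (simp add: divide_le_eq)
  have "T (F (G v)) = \<kappa> * T (G v)" using T_F[OF f0] .
  then have "T (G v) = 0" using v \<kappa>_pos by simp
  then show "G v \<in> D" using f0 fz by (simp add: D_def)
  have "z = x0 + \<nu> * x0" using x0_mult by simp
  then have "z - fst v - \<nu> * x0 = - (fst v - x0)" by linarith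
  then have "(z - fst v - \<nu> * x0) / \<nu> = - (fst v - x0) / \<nu>" by simp
  then have "(z - fst v) / \<nu> - x0 = - (fst v - x0) / \<nu>"
    using \<nu>_pos by (simp add: diff_divide_distrib)
  then show "fst (G v) - x0 = - (fst v - x0) / \<nu>" using f by simp
qed

lemma X_D: "X \<in> D"
proof -
  have "z = x0 + \<nu> * x0" using x0_mult by simp
  then have "\<kappa> * z = \<kappa> * x0 + \<kappa> * \<nu> * x0" by (metis distrib_left mult.assoc)
  then have "T X = 0" by (simp add: T_def X_def)
  moreover have "x0 > 0" using z_gt \<nu>_pos by (simp add: x0_def)
  moreover have "x0 \<le> z" using x0_mult calculation(2) \<nu>_pos mult_pos_pos[of \<nu> x0] by linarith
  ultimately show ?thesis by (simp add: D_def X_def)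
qed

lemma F_X: "F X = X"
proof -
  have "fst X \<ge> 0" using X_D by (simp add: D_def)
  then have "T (F X) = 0" using T_F X_D by (simp add: D_def)
  have "fst (G X) = fst X" "T (G X) = T X"
    using G_D[OF X_D] X_D by (auto simp: X_def D_def)
  then have "G X = X" by (simp add: T_def prod_eq_iff)
  then show ?thesis using FG by metis
qed

lemma fst_X_pos: "fst X > 0"
  using z_gt \<nu>_pos by (simp add: X_def x0_def)

lemma D_tendsto:
  assumes "v \<in> D"
  shows "(\<lambda>n. (G ^^ n) v) \<longlonglongrightarrow> X"
proof -
  have *: "(G ^^ n) v \<in> D \<and> fst ((G ^^ n) v) - fst X = (- 1 / \<nu>) ^ n * (fst v - fst X)" for n
  proof (induction n)
    case (Suc n)
    then show ?case using G_D[of "(G ^^ n) v"] by (simp add: X_def)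
  qed (use assms in simp)
  have "(\<lambda>n. (- 1 / \<nu>) ^ n * (fst v - fst X)) \<longlonglongrightarrow> 0 * (fst v - fst X)"
    using \<nu>_bounds by (intro tendsto_mult_right LIMSEQ_power_zero) auto
  then have "(\<lambda>n. fst ((G ^^ n) v) - fst X) \<longlonglongrightarrow> 0" using * by simp
  then have 1: "(\<lambda>n. fst ((G ^^ n) v)) \<longlonglongrightarrow> fst X" by (simp add: LIM_zero_iff)
  have sn: "snd w = \<kappa> * (z - fst w)" if "w \<in> D" for w
    using that by (simp add: D_def T_def algebra_simps)
  have "(\<lambda>n. \<kappa> * (z - fst ((G ^^ n) v))) \<longlonglongrightarrow> \<kappa> * (z - fst X)"
    by (intro tendsto_intros 1)
  then have 2: "(\<lambda>n. snd ((G ^^ n) v)) \<longlonglongrightarrow> snd X" using * sn X_D by simp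
  show ?thesis using tendsto_Pair[OF 1 2] by simp
qed

text \<open>A past that tends to \<open>X\<close> finally stays right of the y-axis, where every
  backward step divides \<open>T\<close> by \<open>\<kappa>\<close>. Convergence then forces
  \<open>T = 0\<close>, so the past enters \<open>D\<close>.\<close>

lemma W_iff: "v \<in> W \<longleftrightarrow> (\<exists>n. (G ^^ n) v \<in> D)"
proof
  assume "v \<in> W"
  then have lim: "(\<lambda>n. (G ^^ n) v) \<longlonglongrightarrow> X"
    by (simp add: lozi_Wu_def unstable_manifold_def inv_F lozi_fixpoint_eq)
  then have limf: "(\<lambda>n. fst ((G ^^ n) v)) \<longlonglongrightarrow> fst X" by (rule tendsto_fst)
  have "fst X < z"
    using fst_X_pos \<nu>_pos x0_mult mult_pos_pos[of \<nu> x0] unfolding X_def fst_conv by linarith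
  then have "eventually (\<lambda>n. 0 < fst ((G ^^ n) v) \<and> fst ((G ^^ n) v) < z) sequentially"
    by (intro eventually_conj order_tendstoD[OF limf] fst_X_pos)
  then obtain N where N: "\<And>n. n \<ge> N \<Longrightarrow> 0 < fst ((G ^^ n) v) \<and> fst ((G ^^ n) v) < z"
    unfolding eventually_sequentially by blast
  have pow: "T ((G ^^ N) v) = \<kappa> ^ k * T ((G ^^ (N + k)) v)" for k
  proof (induction k)
    case (Suc k)
    have "fst (G ((G ^^ (N + k)) v)) \<ge> 0" using N[of "N + Suc k"] by simp
    then have "T ((G ^^ (N + k)) v) = \<kappa> * T (G ((G ^^ (N + k)) v))" using T_F FG by metis
    then show ?case using Suc by simp
  qed simp
  have "(\<lambda>k. (G ^^ (N + k)) v) \<longlonglongrightarrow> X"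
    using LIMSEQ_ignore_initial_segment[OF lim, of N] by (simp add: add.commute)
  then have "(\<lambda>k. T ((G ^^ (N + k)) v)) \<longlonglongrightarrow> T X"
    unfolding T_def by (intro tendsto_intros)
  moreover have "(\<lambda>k. \<kappa> ^ k) \<longlonglongrightarrow> 0" using \<nu>_bounds by (intro LIMSEQ_power_zero) auto
  ultimately have "(\<lambda>k. \<kappa> ^ k * T ((G ^^ (N + k)) v)) \<longlonglongrightarrow> 0 * T X" by (intro tendsto_mult)
  then have "(\<lambda>k. T ((G ^^ N) v)) \<longlonglongrightarrow> 0" using pow by simp
  then have "T ((G ^^ N) v) = 0" by (simp add: LIMSEQ_const_iff)
  then have "(G ^^ N) v \<in> D" using N[of N] by (simp add: D_def)
  then show "\<exists>n. (G ^^ n) v \<in> D" ..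
next
  assume "\<exists>n. (G ^^ n) v \<in> D"
  then obtain n where "(G ^^ n) v \<in> D" ..
  then have "(\<lambda>k. (G ^^ (k + n)) v) \<longlonglongrightarrow> X"
    using D_tendsto by (simp add: funpow_add)
  then have "(\<lambda>k. (G ^^ k) v) \<longlonglongrightarrow> X" by (rule LIMSEQ_offset)
  then show "v \<in> W"
    by (simp add: lozi_Wu_def unstable_manifold_def inv_F lozi_fixpoint_eq)
qed

lemma FG_pow [simp]: "(F ^^ n) ((G ^^ n) v) = v" "(G ^^ n) ((F ^^ n) v) = v"
  using orb_cancel[of "int n" v] by (auto simp: orb_nat orb_neg_nat)

lemma F_W: "v \<in> W \<Longrightarrow> F v \<in> W" and G_W: "v \<in> W \<Longrightarrow> G v \<in> W"
proof -
  assume "v \<in> W"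
  then obtain n where n: "(G ^^ n) v \<in> D" using W_iff by blast
  then have "(G ^^ Suc n) (F v) \<in> D" by (simp add: funpow_swap1)
  then show "F v \<in> W" using W_iff by blast
  have "(G ^^ n) (G v) \<in> D" using n G_D by (simp flip: funpow_swap1)
  then show "G v \<in> W" using W_iff by blast
qed

lemma orb_W: "v \<in> W \<Longrightarrow> orb n v \<in> W"
proof (induction n rule: int_induct[where k = 0])
  case (step1 i)
  then show ?case using F_W by (simp add: orb_Suc)
next
  case (step2 i)
  then show ?case using G_W by (simp add: orb_pred)
qed simp

lemma F_pow_K: "v \<in> K \<Longrightarrow> (F ^^ n) v \<in> K"
  by (induction n) (auto simp: F_K)

lemma W_K: "W \<subseteq> K"
proof
  fix v assume "v \<in> W"
  then obtain n where "(G ^^ n) v \<in> D" using W_iff by blast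
  then have "(F ^^ n) ((G ^^ n) v) \<in> K" using D_K F_pow_K by blast
  then show "v \<in> K" by simp
qed

lemma L_K: "L \<subseteq> K"
  using closure_minimal[OF W_K closed_K] by (simp add: lozi_attractor_def)

lemma W_L: "W \<subseteq> L"
  by (simp add: lozi_attractor_def closure_subset)

lemma compact_L: "compact L"
  using compact_K L_K compact_closure[of W] bounded_subset[OF bounded_K W_K]
  by (simp add: lozi_attractor_def)

lemma orb_L: "v \<in> L \<Longrightarrow> orb n v \<in> L"
proof -
  assume v: "v \<in> L"
  have "orb n ` closure W \<subseteq> closure (orb n ` W)"
    by (rule image_closure_subset[OF cont_orb]) (auto intro: closure_subset[THEN subsetD])
  also have "\<dots> \<subseteq> closure W" by (rule closure_mono) (auto simp: orb_W)
  finally show ?thesis using v by (auto simp: lozi_attractor_def)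
qed

lemma D_W: "D \<subseteq> W"
  using W_iff funpow_0 by (metis subsetI)

lemma X_W: "X \<in> W"
  using X_D D_W by blast

lemma convex_D: "convex D"
proof (rule convexI)
  fix x y :: "real \<times> real" and u v :: real
  assume *: "x \<in> D" "y \<in> D" "0 \<le> u" "0 \<le> v" "u + v = 1"
  have v: "v = 1 - u" using * by simp
  have T: "T (u *\<^sub>R x + v *\<^sub>R y) = u * T x + v * T y"
    unfolding v by (simp add: T_def algebra_simps)
  have "u * fst x + v * fst y \<le> u * z + v * z"
    using * by (intro add_mono mult_left_mono) (auto simp: D_def)
  moreover have "u * z + v * z = z" unfolding v by (simp add: algebra_simps)
  ultimately show "u *\<^sub>R x + v *\<^sub>R y \<in> D" using T * by (simp add: D_def)
qed

lemma connected_W: "connected W"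
proof -
  have "W = (\<Union>n. (F ^^ n) ` D)"
  proof
    show "W \<subseteq> (\<Union>n. (F ^^ n) ` D)"
    proof
      fix v assume "v \<in> W"
      then obtain n where "(G ^^ n) v \<in> D" using W_iff by blast
      then show "v \<in> (\<Union>n. (F ^^ n) ` D)" by (metis FG_pow(1) UN_I UNIV_I image_eqI)
    qed
    show "(\<Union>n. (F ^^ n) ` D) \<subseteq> W"
    proof (rule UN_least, rule image_subsetI)
      fix n v assume "v \<in> D"
      then have "(G ^^ n) ((F ^^ n) v) \<in> D" by simp
      then show "(F ^^ n) v \<in> W" using W_iff by blast
    qed
  qed
  moreover have "connected (\<Union>n. (F ^^ n) ` D)"
  proof (rule connected_Union)
    fix S assume "S \<in> range (\<lambda>n. (F ^^ n) ` D)"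
    then obtain n where "S = (F ^^ n) ` D" by blast
    moreover have "continuous_on D (F ^^ n)" using cont_orb[of D "int n"] by (simp add: orb_nat[abs_def])
    ultimately show "connected S" using connected_continuous_image convex_connected[OF convex_D] by blast
  next
    have "(F ^^ n) X = X" for n by (induction n) (auto simp: F_X)
    then have "X \<in> (F ^^ n) ` D" for n using X_D by (metis image_eqI)
    then show "\<Inter> (range (\<lambda>n. (F ^^ n) ` D)) \<noteq> {}" by blast
  qed
  ultimately show ?thesis by simp
qed

lemma W_past:
  assumes "v \<in> W"
  obtains N where "\<And>n. n \<le> N \<Longrightarrow> fst (orb n v) > 0"
proof -
  have "(\<lambda>n. (G ^^ n) v) \<longlonglongrightarrow> X"
    using assms by (simp add: lozi_Wu_def unstable_manifold_def inv_F lozi_fixpoint_eq)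
  then have "(\<lambda>n. fst ((G ^^ n) v)) \<longlonglongrightarrow> fst X" by (rule tendsto_fst)
  then have "eventually (\<lambda>n. 0 < fst ((G ^^ n) v)) sequentially"
    using order_tendstoD(1) fst_X_pos by blast
  then obtain N where N: "\<And>n. n \<ge> N \<Longrightarrow> 0 < fst ((G ^^ n) v)"
    unfolding eventually_sequentially by blast
  have "fst (orb n v) > 0" if "n \<le> - int N" for n
  proof -
    have "n = - int (nat (- n))" "nat (- n) \<ge> N" using that by auto
    then show ?thesis using N orb_neg_nat by metis
  qed
  then show ?thesis by (rule that)
qed

text \<open>The only point of the y-axis that \<open>F\<close> sends to the y-axis is
  \<open>(0, -1)\<close>, and \<open>B\<close> is negative there.\<close>

lemma no_consecutive_hits:
  assumes "v \<in> K" "fst v = 0"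
  shows "fst (F v) \<noteq> 0"
proof
  assume "fst (F v) = 0"
  then have "snd v = - 1" using assms by (simp add: fst_F)
  then have "B v = - (\<nu> - 2 * \<kappa>) + \<kappa> * \<nu> * z" using assms by (simp add: B_def)
  moreover have "\<kappa> * \<nu> * z < \<nu> - 2 * \<kappa>"
  proof -
    have "\<kappa> * \<nu> < (\<nu> - 2 * \<kappa>) * (1 - \<kappa>)" using par_ineq1 \<kappa>_pos by (simp add: algebra_simps)
    then show ?thesis using \<nu>_bounds by (simp add: z_def divide_less_eq)
  qed
  ultimately show False using assms by (simp add: K_def)
qed

end

section \<open>Growth of segments and the topology of the attractor\<close>

context lozi_map
begin

text \<open>The cone of slopes at least \<open>\<mu>\<close> plays for \<open>G\<close> the role of
  the unstable cone for \<open>F\<close>; the folding line is now the x-axis.\<close>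

lemma G_steep:
  assumes "snd p * snd q \<ge> 0" "\<mu> * \<bar>fst (q - p)\<bar> \<le> \<bar>snd (q - p)\<bar>"
  shows "\<mu> * \<bar>fst (G q - G p)\<bar> \<le> \<bar>snd (G q - G p)\<bar>"
    and "\<bar>snd (G q - G p)\<bar> \<ge> (\<mu> / b) * \<bar>snd (q - p)\<bar>"
proof -
  obtain e :: real where e: "e = 1 \<or> e = -1" "\<bar>snd p\<bar> = e * snd p" "\<bar>snd q\<bar> = e * snd q"
    using same_sign_cases[OF assms(1)] by blast
  define u v where "u = fst (q - p)" and "v = snd (q - p)"
  have fG: "fst (G q - G p) = v / b"
    unfolding G_def v_def by (simp add: diff_divide_distrib)
  have "snd (G q - G p) = u + a * (\<bar>snd q\<bar> - \<bar>snd p\<bar>) / b"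
    unfolding G_def u_def using b_pos by (simp add: right_diff_distrib diff_divide_distrib)
  then have sG: "snd (G q - G p) = u + a * (e * v) / b"
    using e by (simp add: v_def right_diff_distrib)
  have "\<bar>a * (e * v) / b\<bar> = a * \<bar>v\<bar> / b" using e(1) a_pos b_pos by (auto simp: abs_mult)
  then have lower: "\<bar>snd (G q - G p)\<bar> \<ge> a * \<bar>v\<bar> / b - \<bar>u\<bar>" unfolding sG by linarith
  have "s * (\<mu> * \<bar>u\<bar>) \<le> s * \<bar>v\<bar>" using assms(2) s_pos by (simp add: u_def v_def)
  then have "b * \<bar>u\<bar> \<le> s * \<bar>v\<bar>" using b_split by (simp add: mult.left_commute mult.assoc)
  then have "\<bar>u\<bar> \<le> s * \<bar>v\<bar> / b" using b_pos by (simp add: pos_le_divide_eq mult.commute)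
  moreover have "a * \<bar>v\<bar> / b = \<mu> * \<bar>v\<bar> / b + s * \<bar>v\<bar> / b"
    using a_split by (simp add: distrib_right add_divide_distrib)
  ultimately show 1: "\<bar>snd (G q - G p)\<bar> \<ge> (\<mu> / b) * \<bar>snd (q - p)\<bar>"
    using lower by (simp add: v_def)
  then show "\<mu> * \<bar>fst (G q - G p)\<bar> \<le> \<bar>snd (G q - G p)\<bar>"
    unfolding fG v_def[symmetric] using b_pos by (simp add: abs_divide)
qed

text \<open>A fold costs at most a factor 2, and \<open>\<mu> / (2 * b)\<close> still exceeds 1, so
  growth survives even a fold at every step.\<close>

lemma steep_segment_growth:
  assumes "\<mu> * \<bar>fst (q - p)\<bar> \<le> \<bar>snd (q - p)\<bar>"
  shows "\<exists>p' q'. closed_segment p' q' \<subseteq> (G ^^ n) ` closed_segment p q \<and>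
    \<mu> * \<bar>fst (q' - p')\<bar> \<le> \<bar>snd (q' - p')\<bar> \<and> \<bar>snd (q' - p')\<bar> \<ge> (\<mu> / (2 * b)) ^ n * \<bar>snd (q - p)\<bar>"
proof (induction n)
  case 0
  then show ?case using assms by (intro exI[of _ p] exI[of _ q]) simp
next
  case (Suc n)
  then obtain p1 q1 where 1: "closed_segment p1 q1 \<subseteq> (G ^^ n) ` closed_segment p q"
    "\<mu> * \<bar>fst (q1 - p1)\<bar> \<le> \<bar>snd (q1 - p1)\<bar>" "\<bar>snd (q1 - p1)\<bar> \<ge> (\<mu> / (2 * b)) ^ n * \<bar>snd (q - p)\<bar>"
    by blast
  have lin: "linear (snd :: real \<times> real \<Rightarrow> real)" by (rule linear_snd)
  obtain p2 q2 c where 2: "closed_segment p2 q2 \<subseteq> closed_segment p1 q1" "q2 - p2 = c *\<^sub>R (q1 - p1)"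
    "c \<ge> 1/2" "snd p2 * snd q2 \<ge> 0"
    using halve_segment[OF lin, of p1 q1] by metis
  have len: "\<bar>snd (q2 - p2)\<bar> = c * \<bar>snd (q1 - p1)\<bar>" "\<bar>fst (q2 - p2)\<bar> = c * \<bar>fst (q1 - p1)\<bar>"
    unfolding 2(2) using 2(3) by (simp_all add: abs_mult)
  have st: "\<mu> * \<bar>fst (q2 - p2)\<bar> \<le> \<bar>snd (q2 - p2)\<bar>"
    unfolding len using 1(2) 2(3) by (simp add: mult.left_commute)
  note g = G_steep[OF 2(4) st]
  have "closed_segment (G p2) (G q2) \<subseteq> (G ^^ Suc n) ` closed_segment p q"
  proof -
    have "closed_segment (G p2) (G q2) = G ` closed_segment p2 q2"
      using G_segment[OF 2(4)] by simp
    also have "\<dots> \<subseteq> G ` (G ^^ n) ` closed_segment p q" using 1(1) 2(1) by blast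
    finally show ?thesis by (simp add: image_comp)
  qed
  moreover have "\<bar>snd (G q2 - G p2)\<bar> \<ge> (\<mu> / (2 * b)) ^ Suc n * \<bar>snd (q - p)\<bar>"
  proof -
    have "(\<mu> / (2 * b)) ^ Suc n * \<bar>snd (q - p)\<bar> \<le> (\<mu> / b) * (1/2 * \<bar>snd (q1 - p1)\<bar>)"
    proof -
      have "(\<mu> / (2 * b)) * ((\<mu> / (2 * b)) ^ n * \<bar>snd (q - p)\<bar>) \<le> (\<mu> / (2 * b)) * \<bar>snd (q1 - p1)\<bar>"
        using 1(3) \<mu>_pos b_pos by (intro mult_left_mono) auto
      then show ?thesis by (simp add: mult.assoc)
    qed
    also have "\<dots> \<le> (\<mu> / b) * (c * \<bar>snd (q1 - p1)\<bar>)"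
      using 2(3) \<mu>_pos b_pos by (intro mult_left_mono mult_right_mono) auto
    also have "\<dots> \<le> \<bar>snd (G q2 - G p2)\<bar>" using g(2) len by simp
    finally show ?thesis .
  qed
  ultimately show ?case using g(1) by blast
qed

lemma vertical_escape:
  assumes "bounded S" "h \<noteq> 0"
  obtains N where "\<And>n. n \<ge> N \<Longrightarrow> \<not> (G ^^ n) ` closed_segment y (y + (0, h)) \<subseteq> S"
proof -
  obtain C where C: "C > 0" "\<And>p q. p \<in> S \<Longrightarrow> q \<in> S \<Longrightarrow> \<bar>fst (q - p)\<bar> \<le> C \<and> \<bar>snd (q - p)\<bar> \<le> C"
    using bounded_fst_snd[OF assms(1)] by blast
  obtain N where N: "C / \<bar>h\<bar> < (\<mu> / (2 * b)) ^ N"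
    using real_arch_pow \<mu>_div_b by blast
  have "\<not> (G ^^ n) ` closed_segment y (y + (0, h)) \<subseteq> S" if "n \<ge> N" for n
  proof
    assume sub: "(G ^^ n) ` closed_segment y (y + (0, h)) \<subseteq> S"
    have "\<mu> * \<bar>fst (y + (0, h) - y)\<bar> \<le> \<bar>snd (y + (0, h) - y)\<bar>" by simp
    from steep_segment_growth[OF this, of n] obtain p q where
      pq: "closed_segment p q \<subseteq> (G ^^ n) ` closed_segment y (y + (0, h))"
      "\<bar>snd (q - p)\<bar> \<ge> (\<mu> / (2 * b)) ^ n * \<bar>h\<bar>"
      by auto
    have "p \<in> S" "q \<in> S" using pq(1) sub by auto
    then have "\<bar>snd (q - p)\<bar> \<le> C" using C by blast
    moreover have "(\<mu> / (2 * b)) ^ N \<le> (\<mu> / (2 * b)) ^ n"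
      using that \<mu>_div_b by (intro power_increasing) auto
    then have "C / \<bar>h\<bar> < (\<mu> / (2 * b)) ^ n" using N by simp
    then have "C < (\<mu> / (2 * b)) ^ n * \<bar>h\<bar>" using assms(2) by (simp add: pos_divide_less_eq)
    ultimately show False using pq(2) by simp
  qed
  then show ?thesis by (rule that)
qed

section \<open>A triangle with invariant sides, and the attractor as the set of points with past in
  \<open>K\<close>\<close>

definition Tri :: "(real \<times> real) set" where "Tri = {v. T v \<le> 0 \<and> B v \<ge> 0 \<and> \<Psi> v \<ge> 0}"

lemma bounded_Tri: "bounded Tri"
proof (rule bounded_box)
  fix v assume "v \<in> Tri"
  then have v: "T v \<le> 0" "B v \<ge> 0" "\<Psi> v \<ge> 0" by (auto simp: Tri_def)
  define d where "d = \<nu> - 2 * \<kappa>"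
  have d: "d - \<kappa> > 0" using slope_pos by (simp add: d_def)
  have u: "fst v \<le> z" using fst_le_z v by blast
  have "\<nu> * fst v \<le> \<nu> * z" using u \<nu>_pos by simp
  then have y: "snd v \<le> \<nu> * z" using v r2_pos by (simp add: \<Psi>_def)
  have "\<kappa> * (\<nu> * fst v) \<ge> \<kappa> * snd v" using v r2_pos \<kappa>_pos by (simp add: \<Psi>_def)
  then have "(d - \<kappa>) * snd v \<ge> - (\<kappa> * \<nu> * z)" using v(2) by (simp add: B_def d_def algebra_simps)
  then have yl: "snd v \<ge> - (\<kappa> * \<nu> * z) / (d - \<kappa>)"
    unfolding pos_divide_le_eq[OF d] by (simp add: mult.commute)
  then have "\<nu> * fst v \<ge> - (\<kappa> * \<nu> * z) / (d - \<kappa>)" using v r2_pos by (simp add: \<Psi>_def)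
  then have "fst v \<ge> - (\<kappa> * \<nu> * z) / (d - \<kappa>) / \<nu>"
    unfolding pos_divide_le_eq[OF \<nu>_pos] by (simp add: mult.commute)
  then show "- (\<kappa> * \<nu> * z) / (d - \<kappa>) / \<nu> \<le> fst v \<and> fst v \<le> z \<and>
      - (\<kappa> * \<nu> * z) / (d - \<kappa>) \<le> snd v \<and> snd v \<le> \<nu> * z"
    using u y yl by blast
qed

lemma closed_Tri: "closed Tri"
proof -
  have "Tri = {v. T v \<le> 0} \<inter> {v. 0 \<le> B v} \<inter> {v. 0 \<le> \<Psi> v}" by (auto simp: Tri_def)
  then show ?thesis
    unfolding T_def B_def \<Psi>_def
    by (auto intro!: closed_Int closed_Collect_le continuous_intros)
qed

lemma frontier_Tri:
  assumes "v \<in> frontier Tri"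
  shows "v \<in> Tri" "T v = 0 \<or> B v = 0 \<or> \<Psi> v = 0"
proof -
  show v: "v \<in> Tri" using assms closed_Tri frontier_subset_closed by blast
  show "T v = 0 \<or> B v = 0 \<or> \<Psi> v = 0"
  proof (rule ccontr)
    assume "\<not> ?thesis"
    then have "v \<in> {v. T v < 0} \<inter> {v. 0 < B v} \<inter> {v. 0 < \<Psi> v}"
      using v by (auto simp: Tri_def less_le)
    moreover have "open ({v. T v < 0} \<inter> {v. 0 < B v} \<inter> {v. 0 < \<Psi> v})"
      unfolding T_def B_def \<Psi>_def
      by (intro open_Int open_Collect_less continuous_intros)
    moreover have "{v. T v < 0} \<inter> {v. 0 < B v} \<inter> {v. 0 < \<Psi> v} \<subseteq> Tri" by (auto simp: Tri_def)
    ultimately have "v \<in> interior Tri" by (meson interiorI)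
    then show False using assms by (simp add: frontier_def)
  qed
qed

lemma Tri_top:
  assumes "v \<in> Tri" "T v = 0"
  shows "v \<in> W"
proof -
  have v: "B v \<ge> 0" "\<Psi> v \<ge> 0" using assms by (auto simp: Tri_def)
  have "(\<nu> + \<kappa>) * fst v \<ge> r2 + \<kappa> * z" using v(2) assms(2) by (simp add: T_def \<Psi>_def algebra_simps)
  moreover have "\<kappa> * z > 0" using \<kappa>_pos z_gt by simp
  ultimately have "(\<nu> + \<kappa>) * fst v \<ge> 0" using r2_pos by linarith
  then have "fst v \<ge> 0" using \<nu>_pos \<kappa>_pos by (simp add: zero_le_mult_iff)
  moreover have "fst v \<le> z" using fst_le_z assms(2) v by simp
  ultimately show ?thesis using assms(2) D_W by (auto simp: D_def)
qed

text \<open>The bottom side is contained in \<open>F (F D)\<close>: pulled back twice it lands in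
  \<open>D\<close>, because by \<open>par_ineq2\<close> its left corner does not lie beyond
  \<open>F (F (z, 0))\<close>.\<close>

lemma Tri_bottom:
  assumes "v \<in> Tri" "B v = 0"
  shows "v \<in> W"
proof -
  have v: "T v \<le> 0" "\<Psi> v \<ge> 0" using assms by (auto simp: Tri_def)
  define w where "w = G v"
  have Fw: "F w = v" by (simp add: w_def)
  have "fst v \<le> z" using fst_le_z assms(2) v by simp
  then have "\<kappa> * \<nu> * (fst v - z) \<le> 0" using \<kappa>_pos \<nu>_pos by (intro mult_nonneg_nonpos) auto
  then have "(\<nu> - 2 * \<kappa>) * snd v \<le> 0" using assms(2) by (simp add: B_def)
  then have "snd v \<le> 0" using slope_pos by (simp add: mult_le_0_iff)
  then have w0: "fst w \<le> 0" unfolding w_def G_def using b_pos by (simp add: divide_le_0_iff)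
  have "- (\<kappa> * \<nu> * T w) = 0" using B_F[OF w0] Fw assms(2) by simp
  then have Tw: "T w = 0" using \<kappa>_pos \<nu>_pos by simp
  then have sw: "snd w = \<kappa> * (z - fst w)" by (simp add: T_def algebra_simps)
  have fv: "fst v = z + (\<nu> - 2 * \<kappa>) * fst w"
    using fst_F'[of w] Fw w0 sw z_eq by (simp add: algebra_simps)
  have sv: "snd v = \<kappa> * \<nu> * fst w" using snd_F'[of w] Fw by simp
  have "\<nu> * (z + (\<nu> - 3 * \<kappa>) * fst w) \<ge> r2"
    using v(2) by (simp add: \<Psi>_def fv sv algebra_simps)
  moreover have "r2 = \<nu> * (1 / (1 + \<nu>))" by (simp add: r2_def)
  ultimately have \<Psi>': "z + (\<nu> - 3 * \<kappa>) * fst w \<ge> 1 / (1 + \<nu>)"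
    using \<nu>_pos by (metis mult_le_cancel_left_pos)
  \<comment> \<open>The number \<open>- ((\<nu> - 1) * z)\<close> is the first coordinate of
    \<open>F (z, 0)\<close>, the left end of the image of \<open>D\<close>.\<close>
  have "z - 1 / (1 + \<nu>) \<le> (\<nu> - 3 * \<kappa>) * ((\<nu> - 1) * z)"
  proof -
    define q where "q = 1 / (1 + \<nu>)"
    have q: "q * (1 + \<nu>) = 1" using \<nu>_pos by (simp add: q_def)
    have z1: "(1 - \<kappa>) * z = 1" using z_eq by (simp add: left_diff_distrib)
    have "(z - q) * (1 + \<nu>) = z * (1 + \<nu>) - (1 - \<kappa>) * z"
      using q z1 by (simp add: left_diff_distrib)
    also have "\<dots> = z * (\<nu> + \<kappa>)" by (simp add: algebra_simps)
    also have "\<dots> \<le> z * (\<nu>^3 - \<nu> - \<kappa> * (3 * \<nu>\<^sup>2 - 3))"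
      using par_ineq2 z_gt by (intro mult_left_mono) (auto simp: algebra_simps)
    also have "\<dots> = (\<nu> - 3 * \<kappa>) * ((\<nu> - 1) * z) * (1 + \<nu>)"
      by (simp add: algebra_simps power2_eq_square power3_eq_cube)
    finally have "z - q \<le> (\<nu> - 3 * \<kappa>) * ((\<nu> - 1) * z)"
      using \<nu>_pos by (simp add: mult_le_cancel_right)
    then show ?thesis by (simp add: q_def)
  qed
  then have "(\<nu> - 3 * \<kappa>) * (- ((\<nu> - 1) * z)) \<le> (\<nu> - 3 * \<kappa>) * fst w"
    using \<Psi>' by simp
  then have fw: "- ((\<nu> - 1) * z) \<le> fst w" using slope_pos(1) by (rule mult_left_le_imp_le)
  define w' where "w' = G w"
  have fw': "fst w' = (z - fst w) / \<nu>" unfolding w'_def G_def using sw b_eq \<kappa>_pos by simp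
  have f0: "fst w' \<ge> 0" using fw' w0 z_gt \<nu>_pos by simp
  have "z - fst w \<le> z * \<nu>" using fw by (simp add: algebra_simps)
  then have fz: "fst w' \<le> z" using fw' \<nu>_pos by (simp add: divide_le_eq)
  have "\<kappa> * T w' = 0" using T_F[OF f0] Tw by (simp add: w'_def)
  then have "T w' = 0" using \<kappa>_pos by simp
  then have "w' \<in> D" using f0 fz by (simp add: D_def)
  then have "F (F w') \<in> W" using D_W F_W by blast
  then show ?thesis by (simp add: w'_def w_def)
qed

lemma x0_\<kappa>: "x0 * (1 - \<kappa>) = 1 - r2"
proof -
  have "x0 * (1 - \<kappa>) * (1 + \<nu>) = (1 - \<kappa>) * (x0 + \<nu> * x0)" by (simp add: algebra_simps)
  also have "\<dots> = 1" using z_eq by (simp add: x0_mult left_diff_distrib)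
  also have "1 = (1 - r2) * (1 + \<nu>)" using r2_mult by (simp add: algebra_simps)
  finally show ?thesis using \<nu>_pos by simp
qed

lemma \<Psi>_X: "\<kappa> * \<nu> * x0 = \<nu> * x0 - r2"
proof -
  have "\<nu> * (x0 * (1 - \<kappa>)) = \<nu> - r2 * \<nu>" unfolding x0_\<kappa> by (simp add: right_diff_distrib mult.commute)
  then show ?thesis using r2_mult by (simp add: algebra_simps)
qed

text \<open>By \<open>par_ineq1\<close> this side stays in the right half-plane. There
  \<open>F\<close> maps its line into itself and contracts towards \<open>X\<close> by the factor
  \<open>\<kappa>\<close>.\<close>

lemma Tri_left:
  assumes "v \<in> Tri" "\<Psi> v = 0"
  shows "dist ((F ^^ n) v) X \<le> \<kappa> ^ n * ((1 + \<nu>) * x0)"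
proof -
  have v: "T v \<le> 0" "B v \<ge> 0" using assms by (auto simp: Tri_def)
  have inv: "\<Psi> ((F ^^ n) v) = 0 \<and> 0 \<le> fst ((F ^^ n) v) \<and> fst ((F ^^ n) v) \<le> x0 \<and>
      fst ((F ^^ n) v) - x0 = \<kappa> ^ n * (fst v - x0)" for n
  proof (induction n)
    case 0
    have sv: "snd v = \<nu> * fst v - r2" using assms by (simp add: \<Psi>_def)
    have "\<kappa> * \<nu> * z \<le> (\<nu> - 2 * \<kappa>) * r2"
    proof -
      have "(\<nu> - 2 * \<kappa>) * r2 * ((1 - \<kappa>) * (1 + \<nu>)) = \<nu> * ((\<nu> - 2 * \<kappa>) * (1 - \<kappa>))"
        using \<nu>_pos by (simp add: r2_def)
      moreover have "\<kappa> * \<nu> * z * ((1 - \<kappa>) * (1 + \<nu>)) = \<nu> * (\<kappa> * (1 + \<nu>))"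
        using \<nu>_bounds by (simp add: z_def)
      moreover have "\<nu> * (\<kappa> * (1 + \<nu>)) \<le> \<nu> * ((\<nu> - 2 * \<kappa>) * (1 - \<kappa>))"
        using par_ineq1 \<nu>_pos by simp
      ultimately have "\<kappa> * \<nu> * z * ((1 - \<kappa>) * (1 + \<nu>)) \<le> (\<nu> - 2 * \<kappa>) * r2 * ((1 - \<kappa>) * (1 + \<nu>))"
        by linarith
      moreover have "(1 - \<kappa>) * (1 + \<nu>) > 0" using \<nu>_bounds by simp
      ultimately show ?thesis by (rule mult_right_le_imp_le)
    qed
    moreover have "\<nu> * ((\<nu> - 3 * \<kappa>) * fst v) \<ge> (\<nu> - 2 * \<kappa>) * r2 - \<kappa> * \<nu> * z"
      using v(2) by (simp add: B_def sv algebra_simps)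
    ultimately have "\<nu> * ((\<nu> - 3 * \<kappa>) * fst v) \<ge> 0" by linarith
    then have f0: "fst v \<ge> 0" using \<nu>_pos slope_pos(1) by (simp add: zero_le_mult_iff)
    have "(\<kappa> + \<nu>) * fst v \<le> \<kappa> * z + r2" using v(1) by (simp add: T_def sv algebra_simps)
    also have "\<dots> = (\<kappa> + \<nu>) * x0" using \<Psi>_X by (simp add: algebra_simps flip: x0_mult)
    finally have "fst v \<le> x0" using \<kappa>_pos \<nu>_pos by (simp add: mult_le_cancel_left)
    then show ?case using f0 assms by simp
  next
    case (Suc n)
    define w where "w = (F ^^ n) v"
    have w: "\<Psi> w = 0" "0 \<le> fst w" "fst w \<le> x0" "fst w - x0 = \<kappa> ^ n * (fst v - x0)"
      using Suc by (simp_all add: w_def)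
    have sw: "snd w = \<nu> * fst w - r2" using w(1) by (simp add: \<Psi>_def)
    have "fst (F w) - x0 = \<kappa> * (fst w - x0)"
      using fst_F'[of w] w(2) sw x0_\<kappa> by (simp add: algebra_simps)
    moreover have "\<kappa> * (fst w - x0) \<le> 0" using w \<kappa>_pos by (simp add: mult_nonneg_nonpos)
    moreover have "\<kappa> * (fst w - x0) \<ge> - x0"
    proof -
      have "\<kappa> * (x0 - fst w) \<le> 1 * (x0 - fst w)" using w \<nu>_bounds by (intro mult_right_mono) auto
      moreover have "\<kappa> * (fst w - x0) = - (\<kappa> * (x0 - fst w))" by (simp add: algebra_simps)
      ultimately show ?thesis using w by simp
    qed
    ultimately have "0 \<le> fst (F w)" "fst (F w) \<le> x0" "fst (F w) - x0 = \<kappa> * (fst w - x0)" by auto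
    then show ?case using \<Psi>_F[OF w(2)] w by (simp add: w_def)
  qed
  define w where "w = (F ^^ n) v"
  have w: "\<Psi> w = 0" "fst w - x0 = \<kappa> ^ n * (fst v - x0)" using inv[of n] by (simp_all add: w_def)
  have v0: "0 \<le> fst v" "fst v \<le> x0" using inv[of 0] by simp_all
  have s: "snd w - snd X = \<nu> * (fst w - x0)"
    using w(1) \<Psi>_X by (simp add: X_def \<Psi>_def algebra_simps)
  have "dist w X \<le> \<bar>fst w - fst X\<bar> + \<bar>snd w - snd X\<bar>"
    unfolding dist_norm using norm_Pair_le[of "fst (w - X)" "snd (w - X)"] by (simp del: fst_diff snd_diff) simp
  also have "\<dots> = (1 + \<nu>) * \<bar>fst w - x0\<bar>"
  proof -
    have "\<bar>\<nu> * (fst w - x0)\<bar> = \<nu> * \<bar>fst w - x0\<bar>" using \<nu>_pos by (simp only: abs_mult abs_of_pos)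
    then show ?thesis unfolding s by (simp add: X_def distrib_right)
  qed
  also have "\<dots> = (1 + \<nu>) * (\<kappa> ^ n * (x0 - fst v))"
    using v0 \<kappa>_pos by (simp add: w(2) abs_mult)
  also have "\<dots> \<le> (1 + \<nu>) * (\<kappa> ^ n * x0)"
    using v0 \<kappa>_pos \<nu>_pos by (intro mult_left_mono) auto
  finally show ?thesis by (simp add: w_def mult.left_commute)
qed

text \<open>
  A short vertical segment through \<open>y\<close>, pulled back far enough, sticks out of the triangle
  bounded by pieces of the unstable manifold and of the stable manifold of the fixed point;
  hence some point of it lies in \<open>W\<close> or close to \<open>X\<close>.
\<close>

lemma K_past_in_L:
  assumes "\<And>n. (G ^^ n) y \<in> K"
  shows "y \<in> L"
proof (cases "\<forall>N. \<exists>n\<ge>N. \<Psi> ((G ^^ n) y) \<ge> 0")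
  case True
  show ?thesis unfolding lozi_attractor_def closure_approachable
  proof (intro allI impI)
    fix e :: real assume "e > 0"
    define J where "J = closed_segment y (y + (0, e / 3))"
    have distJ: "dist j y \<le> e / 3" if "j \<in> J" for j
    proof -
      have "dist j y \<le> dist (y + (0, e / 3)) y"
        using that dist_in_closed_segment[of j y "y + (0, e / 3)"]
        by (simp add: J_def dist_commute)
      then show ?thesis using \<open>e > 0\<close> by (simp add: dist_norm norm_Pair)
    qed
    obtain N1 where N1: "\<And>n. n \<ge> N1 \<Longrightarrow> \<not> (G ^^ n) ` J \<subseteq> Tri"
      using vertical_escape[OF bounded_Tri, of "e / 3" y] \<open>e > 0\<close> unfolding J_def by auto
    have "(\<lambda>n. \<kappa> ^ n * ((1 + \<nu>) * x0)) \<longlonglongrightarrow> 0 * ((1 + \<nu>) * x0)"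
      using \<nu>_bounds by (intro tendsto_mult_right LIMSEQ_power_zero) auto
    then have "eventually (\<lambda>n. \<kappa> ^ n * ((1 + \<nu>) * x0) < e / 3) sequentially"
      using \<open>e > 0\<close> by (intro order_tendstoD(2)[of _ "0 * ((1 + \<nu>) * x0)"]) auto
    then obtain N2 where N2: "\<And>n. n \<ge> N2 \<Longrightarrow> \<kappa> ^ n * ((1 + \<nu>) * x0) < e / 3"
      unfolding eventually_sequentially by blast
    obtain n where n: "n \<ge> max N1 N2" "\<Psi> ((G ^^ n) y) \<ge> 0" using True by blast
    have "connected ((G ^^ n) ` J)"
    proof (rule connected_continuous_image)
      show "continuous_on J (G ^^ n)"
        using cont_orb[of J "- int n"] by (simp add: orb_neg_nat[abs_def])
      show "connected J" by (simp add: J_def)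
    qed
    moreover have "(G ^^ n) y \<in> Tri" using assms[of n] n(2) by (simp add: K_def Tri_def)
    then have "(G ^^ n) ` J \<inter> Tri \<noteq> {}" by (auto simp: J_def)
    moreover have "(G ^^ n) ` J - Tri \<noteq> {}" using N1 n(1) by auto
    ultimately have "(G ^^ n) ` J \<inter> frontier Tri \<noteq> {}" by (rule connected_Int_frontier)
    then obtain j where j: "j \<in> J" "(G ^^ n) j \<in> frontier Tri" by blast
    define g where "g = (G ^^ n) j"
    have jg: "j = (F ^^ n) g" by (simp add: g_def)
    have g: "g \<in> Tri" "T g = 0 \<or> B g = 0 \<or> \<Psi> g = 0" using frontier_Tri j(2) by (auto simp: g_def)
    show "\<exists>w\<in>W. dist w y < e"
    proof (cases "\<Psi> g = 0")
      case True
      have "dist j X \<le> \<kappa> ^ n * ((1 + \<nu>) * x0)" unfolding jg by (rule Tri_left[OF g(1) True])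
      also have "\<dots> < e / 3" using N2 n(1) by simp
      finally have "dist X y < e"
        using distJ[OF j(1)] \<open>e > 0\<close> dist_triangle[of X y j] by (simp add: dist_commute)
      then show ?thesis using X_W by blast
    next
      case False
      then have "g \<in> W" using g Tri_top Tri_bottom by blast
      then have "j \<in> W" using orb_W[of g "int n"] by (simp add: jg orb_nat)
      moreover have "dist j y < e" using distJ[OF j(1)] \<open>e > 0\<close> by simp
      ultimately show ?thesis by blast
    qed
  qed
next
  case False
  \<comment> \<open>Now the past is finally left of the stable line of \<open>X\<close>. A point
    with \<open>\<Psi> < 0\<close> right of the y-axis would have an image with
    \<open>\<Psi> > 0\<close>, so the past stays in the left half-plane. There \<open>\<Phi>\<close>
    shrinks backwards by the factor \<open>\<nu>\<close>, against
    \<open>\<Phi> \<ge> \<epsilon>\<close>.\<close>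
  then obtain N where N: "\<And>n. n \<ge> N \<Longrightarrow> \<Psi> ((G ^^ n) y) < 0" by (meson not_le)
  have neg: "fst ((G ^^ Suc n) y) \<le> 0" if "n \<ge> N" for n
  proof (rule ccontr)
    assume "\<not> ?thesis"
    then have "\<Psi> (F ((G ^^ Suc n) y)) = - \<nu> * \<Psi> ((G ^^ Suc n) y)" by (intro \<Psi>_F) simp
    moreover have "\<Psi> ((G ^^ Suc n) y) < 0" using N that by (meson le_SucI)
    ultimately have "\<Psi> ((G ^^ n) y) > 0" using \<nu>_pos by (simp add: mult_pos_neg)
    then show False using N[OF that] by simp
  qed
  have pow: "\<Phi> ((G ^^ N) y) = \<nu> ^ k * \<Phi> ((G ^^ (N + k)) y)" for k
  proof (induction k)
    case (Suc k)
    have "\<Phi> (F ((G ^^ Suc (N + k)) y)) = \<nu> * \<Phi> ((G ^^ Suc (N + k)) y)"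
      by (rule \<Phi>_F[OF neg]) simp
    then show ?case using Suc by simp
  qed simp
  obtain k where "\<Phi> ((G ^^ N) y) / \<epsilon> < \<nu> ^ k"
    using real_arch_pow[of \<nu>] \<nu>_bounds by auto
  then have "\<Phi> ((G ^^ N) y) < \<nu> ^ k * \<epsilon>" using \<epsilon>_pos by (simp add: pos_divide_less_eq)
  also have "\<dots> \<le> \<nu> ^ k * \<Phi> ((G ^^ (N + k)) y)"
    using assms[of "N + k"] \<nu>_pos by (simp add: K_def)
  finally show ?thesis using pow[of k] by simp
qed

lemma connected_compl_L: "connected (- L)"
proof -
  have dim: "2 \<le> DIM(real \<times> real)" by simp
  have "\<exists>U. connected U \<and> y \<in> U \<and> - K \<subseteq> U \<and> U \<subseteq> - L" if "y \<notin> L" for y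
  proof -
    have "open (- L)" using compact_L by (simp add: compact_imp_closed open_Compl)
    then obtain e where e: "e > 0" "ball y e \<subseteq> - L" using \<open>y \<notin> L\<close> openE by blast
    define J where "J = closed_segment y (y + (0, e / 2))"
    have JL: "J \<subseteq> - L"
    proof -
      have "y + (0, e / 2) \<in> ball y e" using e(1) by (simp add: dist_norm norm_Pair)
      then have "J \<subseteq> ball y e" unfolding J_def using e(1) by (intro closed_segment_subset) auto
      then show ?thesis using e by blast
    qed
    have "e / 2 \<noteq> 0" using e(1) by simp
    then obtain N where "\<not> (G ^^ N) ` J \<subseteq> K"
      using vertical_escape[OF bounded_K] unfolding J_def by (metis order_refl)
    then obtain j where j: "j \<in> J" "(G ^^ N) j \<notin> K" by blast
    define A where "A = (F ^^ N) ` (- K)"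
    have "connected (- K)" by (rule connected_complement_bounded_convex[OF bounded_K convex_K dim])
    moreover have "continuous_on (- K) (F ^^ N)"
      using cont_orb[of "- K" "int N"] by (simp add: orb_nat[abs_def])
    ultimately have cA: "connected A" unfolding A_def by (rule connected_continuous_image[rotated])
    have jA: "j \<in> A" unfolding A_def using j(2) by (metis ComplI FG_pow(1) image_eqI)
    have KA: "- K \<subseteq> A"
    proof
      fix v assume "v \<in> - K"
      then have "(G ^^ N) v \<in> - K" using F_pow_K FG_pow(1) by (metis ComplD ComplI)
      then show "v \<in> A" unfolding A_def by (metis FG_pow(1) image_eqI)
    qed
    have AL: "A \<subseteq> - L"
    proof
      fix v assume "v \<in> A"
      then obtain w where w: "w \<notin> K" "v = (F ^^ N) w" unfolding A_def by auto
      show "v \<in> - L"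
      proof
        assume "v \<in> L"
        then have "orb (- int N) v \<in> L" by (rule orb_L)
        then have "w \<in> L" using w(2) by (simp add: orb_neg_nat)
        then show False using L_K w(1) by blast
      qed
    qed
    have "connected (J \<union> A)"
      using cA j(1) jA by (intro connected_Un) (auto simp: J_def)
    moreover have "y \<in> J \<union> A" by (simp add: J_def)
    ultimately show ?thesis using KA JL AL by (intro exI[of _ "J \<union> A"]) auto
  qed
  then obtain U where U: "\<And>y. y \<notin> L \<Longrightarrow> connected (U y) \<and> y \<in> U y \<and> - K \<subseteq> U y \<and> U y \<subseteq> - L"
    by metis
  have "K \<noteq> UNIV" using bounded_K not_bounded_UNIV by metis
  then obtain k where k: "k \<in> - K" by blast
  have "connected (\<Union>y\<in>-L. U y)"
  proof (rule connected_Union)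
    show "\<Inter> (U ` (- L)) \<noteq> {}" using U k by blast
  qed (use U in auto)
  moreover have "(\<Union>y\<in>-L. U y) = - L" using U by blast
  ultimately show ?thesis by simp
qed

section \<open>Unstable segments under forward iteration\<close>

lemma \<kappa>_le_s: "\<kappa> \<le> s"
proof -
  have "\<kappa> * \<nu> = s * \<mu>" using b_eq b_split by (simp add: mult.commute)
  moreover have "\<mu> \<le> \<nu>" using a_eq a_split s_pos \<kappa>_pos by linarith
  ultimately have "\<kappa> * \<nu> \<le> s * \<nu>" using s_pos by simp
  then show ?thesis using \<nu>_pos by simp
qed

lemma D_unst:
  assumes "p \<in> D" "q \<in> D"
  shows "unst (q - p)"
proof -
  have "snd (q - p) = - \<kappa> * fst (q - p)"
    using assms by (simp add: D_def T_def algebra_simps)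
  then show ?thesis
    using \<kappa>_le_s \<kappa>_pos by (simp add: unst_def abs_mult mult_right_mono)
qed

text \<open>Every chord of \<open>D\<close>, however short, is unstable, so at some time the y-axis
  must separate its ends; otherwise \<open>future_eq\<close> would identify them.\<close>

lemma critical_dense:
  assumes "p \<in> W" "e > 0"
  obtains q n where "q \<in> W" "dist q p < e" "fst (orb n q) = 0"
proof -
  obtain m where d: "(G ^^ m) p \<in> D" using assms W_iff by blast
  define d where "d = (G ^^ m) p"
  have pd: "p = orb (int m) d" by (simp add: d_def orb_nat)
  have "isCont (orb (int m)) d" using cont_orb[of UNIV "int m"] continuous_on_eq_continuous_at by blast
  then obtain \<delta> where \<delta>: "\<delta> > 0" "\<And>x. dist x d < \<delta> \<Longrightarrow> dist (orb (int m) x) p < e"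
    unfolding continuous_at_eps_delta using assms(2) pd by metis
  obtain t where t: "t \<in> D" "t \<noteq> d"
  proof (cases "d = X")
    case True
    have "(0, \<kappa> * z) \<in> D" using z_gt by (simp add: D_def T_def)
    moreover have "(0, \<kappa> * z) \<noteq> d" using True fst_X_pos by (metis fst_conv less_irrefl)
    ultimately show ?thesis using that by blast
  next
    case False
    then show ?thesis using that X_D by blast
  qed
  define \<eta> where "\<eta> = min 1 (\<delta> / (2 * norm (t - d)))"
  have nt: "norm (t - d) > 0" using t by simp
  have \<eta>: "0 < \<eta>" "\<eta> \<le> 1" using \<delta> nt by (auto simp: \<eta>_def)
  define d' where "d' = (1 - \<eta>) *\<^sub>R d + \<eta> *\<^sub>R t"
  have dD: "d \<in> D" using d by (simp add: d_def)
  have d'D: "d' \<in> D" unfolding d'_def using \<eta> dD t convex_D by (simp add: convexD)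
  have dd': "d' - d = \<eta> *\<^sub>R (t - d)" by (simp add: d'_def algebra_simps)
  have "\<eta> * norm (t - d) \<le> (\<delta> / (2 * norm (t - d))) * norm (t - d)"
    by (rule mult_right_mono) (auto simp: \<eta>_def)
  then have "norm (d' - d) \<le> (\<delta> / (2 * norm (t - d))) * norm (t - d)"
    unfolding dd' using \<eta> by simp
  then have near: "dist d' d < \<delta>" using nt \<delta> by (simp add: dist_norm)
  have ne: "d \<noteq> d'" using dd' \<eta> t by auto
  have un: "unst (d' - d)" by (rule D_unst[OF dD d'D])
  have "\<exists>n\<ge>0. fst (orb n d) * fst (orb n d') < 0"
  proof (rule ccontr)
    assume "\<not> ?thesis"
    then have "d = d'"
      using future_eq[OF bounded_K un] dD d'D D_W W_K orb_W by (metis not_le subsetD)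
    then show False using ne by simp
  qed
  then obtain n where n: "fst (orb n d) * fst (orb n d') < 0" by blast
  define S where "S = (\<lambda>v. fst (orb n v)) ` closed_segment d d'"
  have conS: "connected S" unfolding S_def
    by (intro connected_continuous_image continuous_on_fst cont_orb connected_segment)
  have inS: "fst (orb n d) \<in> S" "fst (orb n d') \<in> S" by (auto simp: S_def)
  consider "fst (orb n d) < 0 \<and> 0 < fst (orb n d')" | "fst (orb n d') < 0 \<and> 0 < fst (orb n d)"
    using n by (auto simp: mult_less_0_iff)
  then have "0 \<in> S"
  proof cases
    case 1
    then show ?thesis using connectedD_interval[OF conS inS(1) inS(2)] by simp
  next
    case 2
    then show ?thesis using connectedD_interval[OF conS inS(2) inS(1)] by simp
  qed
  then obtain r where r: "r \<in> closed_segment d d'" "fst (orb n r) = 0" by (auto simp: S_def)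
  have rD: "r \<in> D" using closed_segment_subset[OF dD d'D convex_D] r(1) by blast
  have "dist r d \<le> dist d d'" using dist_in_closed_segment[OF r(1)] by (simp add: dist_commute)
  then have "dist (orb (int m) r) p < e" using \<delta> near by (simp add: dist_commute)
  moreover have "orb (int m) r \<in> W" using rD D_W orb_W by blast
  moreover have "fst (orb (n - int m) (orb (int m) r)) = 0"
    using r(2) orb_add[of "n - int m" "int m" r] by simp
  ultimately show ?thesis by (intro that)
qed

text \<open>
  The condition \<open>\<mu>\<^sup>2 > 2\<close> makes an unstable segment grow as long as it is not folded at two
  consecutive times.
\<close>

lemma segment_growth:
  assumes "unst (q - p)" "bounded S"
    and S: "\<And>n v. v \<in> closed_segment p q \<Longrightarrow> orb (int n) v \<in> S"
    and fold: "\<And>n v w. v \<in> closed_segment p q \<Longrightarrow> w \<in> closed_segment p q \<Longrightarrow>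
      fst (orb (int n) v) * fst (orb (int n) w) < 0 \<Longrightarrow> H n"
    and H: "\<And>n. \<not> (H n \<and> H (Suc n))"
  shows "p = q"
proof (rule ccontr)
  assume "p \<noteq> q"
  then have pos: "\<bar>fst (q - p)\<bar> > 0" using unst_zero[OF assms(1)] by auto
  define good where "good n l \<longleftrightarrow> (\<exists>p' q'. closed_segment p' q' \<subseteq> orb (int n) ` closed_segment p q \<and>
    unst (q' - p') \<and> \<bar>fst (q' - p')\<bar> \<ge> l)" for n l
  have step: "good (Suc n) (if H n then \<mu> / 2 * l else \<mu> * l)" if g: "good n l" "l \<ge> 0" for n l
  proof -
    obtain p1 q1 where 1: "closed_segment p1 q1 \<subseteq> orb (int n) ` closed_segment p q"
      "unst (q1 - p1)" "\<bar>fst (q1 - p1)\<bar> \<ge> l"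
      using g unfolding good_def by blast
    have lin: "linear (fst :: real \<times> real \<Rightarrow> real)" by (rule linear_fst)
    obtain p2 q2 c where 2: "closed_segment p2 q2 \<subseteq> closed_segment p1 q1" "q2 - p2 = c *\<^sub>R (q1 - p1)"
      "c \<ge> 1/2" "fst p1 * fst q1 \<ge> 0 \<Longrightarrow> c = 1" "fst p2 * fst q2 \<ge> 0"
      using halve_segment[OF lin, of p1 q1] by metis
    have c: "c \<ge> (if H n then 1/2 else 1)"
    proof (cases "H n")
      case False
      have "p1 \<in> orb (int n) ` closed_segment p q" "q1 \<in> orb (int n) ` closed_segment p q"
        using 1(1) by auto
      then obtain v w where "v \<in> closed_segment p q" "w \<in> closed_segment p q"
        "p1 = orb (int n) v" "q1 = orb (int n) w" by blast
      then have "fst p1 * fst q1 \<ge> 0" using fold[of v w n] False by force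
      then show ?thesis using 2(4) by simp
    qed (use 2(3) in simp)
    have un: "unst (q2 - p2)" using unst_scale[OF 1(2)] 2(2) by simp
    note g = F_unst[OF 2(5) un]
    have "closed_segment (F p2) (F q2) \<subseteq> orb (int (Suc n)) ` closed_segment p q"
    proof -
      have "closed_segment (F p2) (F q2) = F ` closed_segment p2 q2"
        using F_segment[OF 2(5)] by simp
      also have "\<dots> \<subseteq> F ` orb (int n) ` closed_segment p q" using 1(1) 2(1) by blast
      also have "\<dots> = orb (int (Suc n)) ` closed_segment p q"
        using orb_Suc[of "int n"] by (simp add: image_image add.commute)
      finally show ?thesis .
    qed
    moreover have "\<bar>fst (F q2 - F p2)\<bar> \<ge> (if H n then \<mu> / 2 * l else \<mu> * l)"
    proof -
      have "(if H n then 1/2 else 1) * l \<le> c * \<bar>fst (q1 - p1)\<bar>"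
        using c 1(3) g(1) \<open>l \<ge> 0\<close> by (intro mult_mono) (auto split: if_splits)
      then have "\<mu> * ((if H n then 1/2 else 1) * l) \<le> \<mu> * \<bar>fst (q2 - p2)\<bar>"
        using 2(2,3) \<mu>_pos by (simp add: abs_mult)
      also have "\<dots> \<le> \<bar>fst (F q2 - F p2)\<bar>" by (rule g(2))
      finally show ?thesis by (simp split: if_splits)
    qed
    ultimately show ?thesis using g(1) unfolding good_def by blast
  qed
  have mono: "good n l \<Longrightarrow> l' \<le> l \<Longrightarrow> good n l'" for n l l'
    unfolding good_def by (meson order_trans)
  have two: "good (2 * m) ((\<mu> * \<mu> / 2) ^ m * \<bar>fst (q - p)\<bar>)" for m
  proof (induction m)
    case 0
    show ?case unfolding good_def using assms(1)
      by (intro exI[of _ p] exI[of _ q]) simp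
  next
    case (Suc m)
    define l where "l = (\<mu> * \<mu> / 2) ^ m * \<bar>fst (q - p)\<bar>"
    have l: "l \<ge> 0" by (simp add: l_def)
    define l1 where "l1 = (if H (2 * m) then \<mu> / 2 * l else \<mu> * l)"
    have l1: "l1 \<ge> 0" using l \<mu>_pos by (simp add: l1_def)
    have "good (Suc (2 * m)) l1" using step[OF Suc[folded l_def] l] by (simp add: l1_def)
    from step[OF this l1]
    have "good (Suc (Suc (2 * m))) (if H (Suc (2 * m)) then \<mu> / 2 * l1 else \<mu> * l1)" .
    moreover have "(\<mu> * \<mu> / 2) * l \<le> (if H (Suc (2 * m)) then \<mu> / 2 * l1 else \<mu> * l1)"
      using H[of "2 * m"] l \<mu>_pos by (auto simp: l1_def)
    ultimately have "good (Suc (Suc (2 * m))) ((\<mu> * \<mu> / 2) * l)" by (rule mono)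
    then show ?case by (simp add: l_def mult.assoc)
  qed
  obtain C where C: "C > 0" "\<And>p q. p \<in> S \<Longrightarrow> q \<in> S \<Longrightarrow> \<bar>fst (q - p)\<bar> \<le> C \<and> \<bar>snd (q - p)\<bar> \<le> C"
    using bounded_fst_snd[OF assms(2)] by blast
  obtain m where "C / \<bar>fst (q - p)\<bar> < (\<mu> * \<mu> / 2) ^ m"
    using real_arch_pow[of "\<mu> * \<mu> / 2"] \<mu>_sq by auto
  then have m: "C < (\<mu> * \<mu> / 2) ^ m * \<bar>fst (q - p)\<bar>" using pos by (simp only: pos_divide_less_eq)
  obtain p' q' where pq: "closed_segment p' q' \<subseteq> orb (int (2 * m)) ` closed_segment p q"
    "\<bar>fst (q' - p')\<bar> \<ge> (\<mu> * \<mu> / 2) ^ m * \<bar>fst (q - p)\<bar>"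
    using two[of m] unfolding good_def by blast
  have "orb (int (2 * m)) ` closed_segment p q \<subseteq> S" using S by blast
  then have "p' \<in> S" "q' \<in> S" using pq(1) by auto
  then have "\<bar>fst (q' - p')\<bar> \<le> C" using C by blast
  then show False using pq(2) m by simp
qed

end

section \<open>Two-point fibres over non-separating plane continua\<close>

text \<open>If 0 separated \<open>A\<close> from \<open>B\<close>, it would weakly separate
  \<open>C\<close> from \<open>D\<close> in the same order, contrary to the opposite signs of the
  differences.\<close>

lemma sign_lock:
  fixes A B C D :: real
  assumes "A * C \<ge> 0" "B * D \<ge> 0" "(A - B) * (C - D) < 0"
  obtains e :: real where "e = 1 \<or> e = -1" "\<bar>A\<bar> = e * A" "\<bar>B\<bar> = e * B" "\<bar>C\<bar> = e * C" "\<bar>D\<bar> = e * D"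
proof -
  have "(A \<ge> 0 \<and> B \<ge> 0 \<and> C \<ge> 0 \<and> D \<ge> 0) \<or> (A \<le> 0 \<and> B \<le> 0 \<and> C \<le> 0 \<and> D \<le> 0)"
    using assms unfolding zero_le_mult_iff mult_less_0_iff by linarith
  then show ?thesis
  proof
    assume "A \<ge> 0 \<and> B \<ge> 0 \<and> C \<ge> 0 \<and> D \<ge> 0"
    then show ?thesis using that[of 1] by simp
  next
    assume "A \<le> 0 \<and> B \<le> 0 \<and> C \<le> 0 \<and> D \<le> 0"
    then show ?thesis using that[of "-1"] by simp
  qed
qed

text \<open>Transport to \<open>complex\<close>, the setting of
  \<open>Borsukian_separation_compact\<close>.\<close>

lemma Borsukian_plane:
  fixes S :: "(real \<times> real) set"
  assumes "compact S" "connected (- S)"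
  shows "Borsukian S"
proof -
  define f where "f = (\<lambda>v :: real \<times> real. Complex (fst v) (snd v))"
  define g where "g = (\<lambda>w. (Re w, Im w))"
  have fg: "f (g w) = w" "g (f v) = v" for v w by (simp_all add: f_def g_def)
  have cf: "continuous_on A f" for A
  proof -
    have "f = (\<lambda>v. complex_of_real (fst v) + \<i> * complex_of_real (snd v))"
      by (auto simp: f_def complex_eq_iff)
    then show ?thesis by (simp add: continuous_intros)
  qed
  have cg: "continuous_on A g" for A unfolding g_def by (intro continuous_intros)
  have "homeomorphism S (f ` S) f g"
    by (rule homeomorphismI[OF cf cg]) (use fg in auto)
  then have hom: "f ` S homeomorphic S" by (metis homeomorphic_def homeomorphic_sym)
  have "bij f" by (rule o_bij[of g f]) (auto simp: fg fun_eq_iff)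
  then have "- (f ` S) = f ` (- S)" by (simp add: bij_image_Compl_eq)
  then have "connected (- (f ` S))" using connected_continuous_image[OF cf assms(2)] by simp
  moreover have "compact (f ` S)" using compact_continuous_image[OF cf assms(1)] .
  ultimately have "Borsukian (f ` S)" by (simp add: Borsukian_separation_compact)
  then show ?thesis using hom homeomorphic_Borsukian by blast
qed

text \<open>
  If the fibre over \<open>p\<close> were \<open>{q, r}\<close> with \<open>q \<noteq> r\<close>, the function \<open>k\<close> below, which separates the
  two points by \<open>2 * pi\<close>, would induce a map of the base to the circle without a logarithm.
\<close>

lemma two_point_fibre_trivial:
  fixes \<Gamma> :: "('a::euclidean_space \<times> 'b::euclidean_space) set"
  assumes "compact \<Gamma>" "connected \<Gamma>" "Borsukian (fst ` \<Gamma>)"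
    and E: "countable {x. \<exists>y z. (x, y) \<in> \<Gamma> \<and> (x, z) \<in> \<Gamma> \<and> y \<noteq> z}"
    and pq: "(p, q) \<in> \<Gamma>" and pr: "(p, r) \<in> \<Gamma>"
    and fib: "\<And>y. (p, y) \<in> \<Gamma> \<Longrightarrow> y = q \<or> y = r"
  shows "q = r"
proof (rule ccontr)
  assume "q \<noteq> r"
  define d where "d = dist q r / 3"
  have d: "d > 0" using \<open>q \<noteq> r\<close> by (simp add: d_def)
  have disj: "\<not> (dist y q \<le> d \<and> dist y r \<le> d)" for y
  proof
    assume *: "dist y q \<le> d \<and> dist y r \<le> d"
    have "dist q r \<le> dist y q + dist y r" using dist_triangle[of q r y] by (simp add: dist_commute)
    also have "\<dots> \<le> 2 * d" using * by linarith
    also have "\<dots> < dist q r" using d by (simp add: d_def)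
    finally show False by simp
  qed
  define A where "A = \<Gamma> \<inter> {z. dist (snd z) q \<le> d}"
  define B where "B = \<Gamma> \<inter> {z. dist (snd z) r \<le> d}"
  \<comment> \<open>The part of \<open>\<Gamma>\<close> away from both \<open>q\<close> and
    \<open>r\<close>. Its projection is compact and misses \<open>p\<close>, so every fibre close to
    \<open>p\<close> lies near \<open>q\<close> or \<open>r\<close>.\<close>
  define R where "R = \<Gamma> \<inter> {z. d \<le> dist (snd z) q} \<inter> {z. d \<le> dist (snd z) r}"
  have cl: "closed {z :: 'a \<times> 'b. dist (snd z) c \<le> d}" "closed {z :: 'a \<times> 'b. d \<le> dist (snd z) c}" for c
    by (intro closed_Collect_le continuous_intros)+
  have compacts: "compact A" "compact B" "compact R"
    unfolding A_def B_def R_def using assms(1) cl by (simp_all add: compact_Int_closed)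
  have fst_compact: "compact (fst ` C)" if "compact C" for C :: "('a \<times> 'b) set"
    using that by (intro compact_continuous_image continuous_intros)
  have "p \<notin> fst ` R" using fib d by (force simp: R_def)
  then have "p \<in> - (fst ` R)" "open (- (fst ` R))"
    using fst_compact[OF compacts(3)] by (auto simp: compact_imp_closed open_Compl)
  then obtain \<rho>0 where \<rho>0: "\<rho>0 > 0" "ball p \<rho>0 \<subseteq> - (fst ` R)" using openE by blast
  \<comment> \<open>Only countably many radii are distances from \<open>p\<close> to base points
    with several partners. With another radius \<open>\<rho>\<close>, the set \<open>T0\<close> of
    base points in the closed ball whose fibres come near both \<open>q\<close> and \<open>r\<close>
    is closed and misses the sphere.\<close>
  have "uncountable {0<..<\<rho>0}" using \<rho>0 by (simp add: uncountable_open_interval)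
  then have "\<not> {0<..<\<rho>0} \<subseteq> dist p ` {x. \<exists>y z. (x, y) \<in> \<Gamma> \<and> (x, z) \<in> \<Gamma> \<and> y \<noteq> z}"
    using countable_image[OF E] countable_subset by blast
  then obtain \<rho> where \<rho>: "0 < \<rho>" "\<rho> < \<rho>0"
    "\<And>x y z. (x, y) \<in> \<Gamma> \<Longrightarrow> (x, z) \<in> \<Gamma> \<Longrightarrow> y \<noteq> z \<Longrightarrow> dist p x \<noteq> \<rho>"
    by fastforce
  have near: "dist y q < d \<or> dist y r < d" if "(x, y) \<in> \<Gamma>" "x \<in> ball p \<rho>" for x y
  proof -
    have "x \<in> ball p \<rho>0" using that(2) \<rho>(2) by simp
    then have "x \<notin> fst ` R" using \<rho>0(2) by blast
    then show ?thesis using that(1) by (force simp: R_def not_le)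
  qed
  define T0 where "T0 = fst ` A \<inter> fst ` B \<inter> cball p \<rho>"
  have "closed T0" unfolding T0_def
    using fst_compact compacts by (intro closed_Int closed_cball compact_imp_closed) auto
  have T0_ball: "T0 \<subseteq> ball p \<rho>"
  proof
    fix x assume x: "x \<in> T0"
    then obtain y z where yz: "(x, y) \<in> \<Gamma>" "(x, z) \<in> \<Gamma>" "dist y q \<le> d" "dist z r \<le> d"
      by (auto simp: T0_def A_def B_def)
    then have "y \<noteq> z" using disj by blast
    then have "dist p x \<noteq> \<rho>" using \<rho> yz by blast
    then show "x \<in> ball p \<rho>" using x by (simp add: T0_def)
  qed
  have pT0: "p \<in> T0"
    using pq pr d \<rho> by (force simp: T0_def A_def B_def)
  obtain \<tau> :: "'a \<Rightarrow> real" where \<tau>: "continuous_on UNIV \<tau>" "\<And>x. x \<in> T0 \<Longrightarrow> \<tau> x = 1"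
    "\<And>x. x \<in> - ball p \<rho> \<Longrightarrow> \<tau> x = 0"
  proof -
    have dis: "T0 \<inter> - ball p \<rho> = {}" using T0_ball by blast
    have "closed (- ball p \<rho>)" by (simp add: closed_Compl)
    then show ?thesis
      by (rule Urysohn[OF \<open>closed T0\<close> _ dis, where a = 1 and b = "0::real"]) (rule that)
  qed
  obtain \<sigma> :: "'b \<Rightarrow> real" where \<sigma>: "continuous_on UNIV \<sigma>" "\<And>y. y \<in> cball q d \<Longrightarrow> \<sigma> y = 1"
    "\<And>y. y \<in> cball r d \<Longrightarrow> \<sigma> y = - 1"
  proof -
    have "cball q d \<inter> cball r d = {}" using disj by (auto simp: dist_commute)
    then show ?thesis
      by (rule Urysohn[OF closed_cball closed_cball, where a = 1 and b = "-1::real"]) (rule that)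
  qed
  \<comment> \<open>Inside the ball, a fibre on which \<open>\<sigma>\<close> takes both values lies
    over \<open>T0\<close>, where \<open>\<tau> = 1\<close>, so \<open>k\<close> is
    \<open>pi\<close> or \<open>- pi\<close> on it. On every other fibre \<open>k\<close> is
    constant. Thus \<open>exp (\<i> * k)\<close> descends to the base.\<close>
  define k where "k = (\<lambda>z. pi * (\<tau> (fst z) * \<sigma> (snd z)))"
  have contk: "continuous_on \<Gamma> k" unfolding k_def
    by (intro continuous_intros continuous_on_compose2[OF \<tau>(1)] continuous_on_compose2[OF \<sigma>(1)]) auto
  define c where "c = (\<lambda>z. exp (\<i> * complex_of_real (k z)))"
  have contc: "continuous_on \<Gamma> c" unfolding c_def
    by (intro continuous_intros contk)
  have c_eq: "c (x, y) = c (x, z)" if "(x, y) \<in> \<Gamma>" "(x, z) \<in> \<Gamma>" for x y z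
  proof (cases "x \<in> ball p \<rho>")
    case False
    then show ?thesis using \<tau>(3) by (simp add: c_def k_def)
  next
    case True
    have \<sigma>_cases: "(dist w q < d \<and> \<sigma> w = 1) \<or> (dist w r < d \<and> \<sigma> w = - 1)" if "(x, w) \<in> \<Gamma>" for w
      using near[OF that True] \<sigma>(2,3)[of w] by (auto simp: dist_commute)
    show ?thesis
    proof (cases "\<sigma> y = \<sigma> z")
      case False
      have memA: "x \<in> fst ` A" if "(x, w) \<in> \<Gamma>" "dist w q < d" for w
        using that by (intro image_eqI[of x fst "(x, w)"]) (auto simp: A_def)
      have memB: "x \<in> fst ` B" if "(x, w) \<in> \<Gamma>" "dist w r < d" for w
        using that by (intro image_eqI[of x fst "(x, w)"]) (auto simp: B_def)
      have "x \<in> fst ` A \<and> x \<in> fst ` B"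
        using \<sigma>_cases[OF that(1)] \<sigma>_cases[OF that(2)] False memA[OF that(1)] memA[OF that(2)]
          memB[OF that(1)] memB[OF that(2)] by auto
      then have "x \<in> T0" using True by (simp add: T0_def)
      then have t: "\<tau> x = 1" by (rule \<tau>(2))
      have m1: "c (x, w) = - 1" if "(x, w) \<in> \<Gamma>" for w
      proof -
        have "k (x, w) = pi \<or> k (x, w) = - pi"
          using \<sigma>_cases[OF that] t by (auto simp: k_def)
        then show ?thesis
          using exp_pi_i' by (auto simp: c_def exp_minus)
      qed
      show ?thesis using m1 that by simp
    qed (simp add: c_def k_def)
  qed
  define \<phi> where "\<phi> x = c (x, SOME y. (x, y) \<in> \<Gamma>)" for x
  have \<phi>: "\<phi> (fst z) = c z" if "z \<in> \<Gamma>" for z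
  proof -
    obtain x y where z: "z = (x, y)" by (cases z)
    have "(x, SOME y. (x, y) \<in> \<Gamma>) \<in> \<Gamma>" using that unfolding z by (rule someI)
    then have "c (x, SOME y. (x, y) \<in> \<Gamma>) = c (x, y)" by (rule c_eq) (use that z in simp)
    then show ?thesis by (simp add: \<phi>_def z)
  qed
  have "continuous_on (fst ` \<Gamma>) \<phi>"
  proof (rule continuous_from_closed_graph)
    show "compact (sphere (0::complex) 1)" by simp
    show "\<phi> \<in> fst ` \<Gamma> \<rightarrow> sphere 0 1" using \<phi> by (auto simp: c_def)
    have "(\<lambda>x. (x, \<phi> x)) ` fst ` \<Gamma> = (\<lambda>z. (fst z, c z)) ` \<Gamma>"
      unfolding image_image by (rule image_cong) (auto simp: \<phi>)
    moreover have "compact ((\<lambda>z. (fst z, c z)) ` \<Gamma>)"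
      using assms(1) contc by (intro compact_continuous_image continuous_intros)
    ultimately show "closed ((\<lambda>x. (x, \<phi> x)) ` fst ` \<Gamma>)" by (simp add: compact_imp_closed)
  qed
  moreover have "\<phi> \<in> fst ` \<Gamma> \<rightarrow> sphere 0 1" using \<phi> by (auto simp: c_def)
  ultimately have "\<exists>g. continuous_on (fst ` \<Gamma>) (complex_of_real \<circ> g) \<and>
      (\<forall>x\<in>fst ` \<Gamma>. \<phi> x = exp (\<i> * of_real (g x)))"
    using Borsukian_continuous_logarithm_circle_real[THEN iffD1, OF assms(3)] by metis
  then obtain g where g: "continuous_on (fst ` \<Gamma>) (complex_of_real \<circ> g)"
    "\<And>x. x \<in> fst ` \<Gamma> \<Longrightarrow> \<phi> x = exp (\<i> * of_real (g x))"
    by blast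
  \<comment> \<open>The logarithm on the base minus \<open>k\<close> has values in the multiples of
    \<open>2 * pi\<close>, hence is constant on the connected \<open>\<Gamma>\<close>. Over
    \<open>p\<close> the logarithm has one value but \<open>k\<close> has two.\<close>
  define h where "h = (\<lambda>z. complex_of_real (g (fst z)) - complex_of_real (k z))"
  have "continuous_on \<Gamma> (\<lambda>z. (complex_of_real \<circ> g) (fst z))"
    by (rule continuous_on_compose2[OF g(1)]) (auto intro: continuous_intros)
  then have conth: "continuous_on \<Gamma> h" unfolding h_def
    by (intro continuous_intros contk) (simp add: o_def)
  have h_int: "\<exists>n::int. h z = complex_of_real (2 * pi * of_int n)" if "z \<in> \<Gamma>" for z
  proof -
    have "exp (\<i> * complex_of_real (g (fst z))) = exp (\<i> * complex_of_real (k z))"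
      using g(2)[of "fst z"] \<phi>[OF that] that by (simp add: c_def)
    then obtain n :: int where "\<i> * complex_of_real (g (fst z)) = \<i> * complex_of_real (k z) + of_int (2 * n) * pi * \<i>"
      using exp_eq by blast
    then have "\<i> * h z = \<i> * complex_of_real (2 * pi * of_int n)"
      by (simp add: h_def algebra_simps)
    then show ?thesis by auto
  qed
  have "h constant_on \<Gamma>"
  proof (rule continuous_discrete_range_constant[OF assms(2) conth])
    fix x assume x: "x \<in> \<Gamma>"
    have "2 * pi \<le> norm (h y - h x)" if y: "y \<in> \<Gamma>" "h y \<noteq> h x" for y
    proof -
      obtain n m :: int where nm: "h x = complex_of_real (2 * pi * of_int n)" "h y = complex_of_real (2 * pi * of_int m)"
        using h_int x y by meson
      then have "m \<noteq> n" using y by auto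
      then have "1 \<le> \<bar>real_of_int (m - n)\<bar>" by linarith
      moreover have "h y - h x = complex_of_real (2 * pi * of_int (m - n))"
        unfolding nm by (simp add: algebra_simps)
      then have "norm (h y - h x) = 2 * pi * \<bar>real_of_int (m - n)\<bar>"
        by (simp only: norm_of_real abs_mult) simp
      ultimately show ?thesis by simp
    qed
    then show "\<exists>e>0. \<forall>y. y \<in> \<Gamma> \<and> h y \<noteq> h x \<longrightarrow> e \<le> norm (h y - h x)"
      using pi_gt_zero by (intro exI[of _ "2 * pi"]) auto
  qed
  then have "h (p, q) = h (p, r)" using pq pr by (auto simp: constant_on_def)
  then have "k (p, q) = k (p, r)" by (simp add: h_def)
  moreover have "k (p, q) = pi" "k (p, r) = - pi"
    using \<tau>(2)[OF pT0] \<sigma>(2)[of q] \<sigma>(3)[of r] d by (simp_all add: k_def)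
  ultimately show False using pi_gt_zero by simp
qed

section \<open>Coupled orbits\<close>

context lozi_map
begin

lemma orb_comb:
  assumes "\<And>n. n < 0 \<Longrightarrow> fst (orb n p) * fst (orb n q) \<ge> 0" "0 \<le> \<theta>" "\<theta> \<le> 1"
  shows "orb (- int n) ((1 - \<theta>) *\<^sub>R p + \<theta> *\<^sub>R q) = (1 - \<theta>) *\<^sub>R orb (- int n) p + \<theta> *\<^sub>R orb (- int n) q"
proof (induction n)
  case (Suc n)
  have m: "- int (Suc n) = - int n - 1" by simp
  have "F ((1 - \<theta>) *\<^sub>R orb (- int (Suc n)) p + \<theta> *\<^sub>R orb (- int (Suc n)) q)
      = (1 - \<theta>) *\<^sub>R orb (- int n) p + \<theta> *\<^sub>R orb (- int n) q"
    using F_affine[OF assms(1)[of "- int (Suc n)"] assms(2,3)] orb_Suc[of "- int (Suc n)"] by simp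
  then have "G (orb (- int n) ((1 - \<theta>) *\<^sub>R p + \<theta> *\<^sub>R q))
      = (1 - \<theta>) *\<^sub>R orb (- int (Suc n)) p + \<theta> *\<^sub>R orb (- int (Suc n)) q"
    using Suc by (metis GF)
  then show ?case unfolding m orb_pred by simp
qed simp

text \<open>The y-axis is mapped into the x-axis, so two such points have images with a horizontal,
  hence unstable, difference. If their sides agree up to time \<open>g\<close>, this difference
  expands, yet both ends finally lie on the y-axis. So the sign pattern determines the
  point.\<close>

lemma finite_hits: "finite {v. fst v = 0 \<and> fst (orb (int (Suc g)) v) = 0}" (is "finite ?H")
proof -
  define c where "c v = {i \<in> {..<g}. fst (orb (int (Suc i)) v) \<ge> 0}" for v
  have "inj_on c ?H"
  proof (rule inj_onI)
    fix v w assume v: "v \<in> ?H" and w: "w \<in> ?H" and eq: "c v = c w"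
    have same: "fst (orb (int i) (F v)) * fst (orb (int i) (F w)) \<ge> 0" if "i < g" for i
    proof -
      have orb: "orb (int i) (F u) = orb (int (Suc i)) u" for u
        using orb_add[of "int i" 1 u] orb_Suc[of 0 u] by (simp add: add.commute)
      have "fst (orb (int (Suc i)) v) \<ge> 0 \<longleftrightarrow> fst (orb (int (Suc i)) w) \<ge> 0"
        using eq that unfolding c_def by blast
      then show ?thesis unfolding orb by (auto simp: zero_le_mult_iff)
    qed
    have un: "unst (F w - F v)" using v w s_pos by (simp add: unst_def snd_F)
    have "orb (int (Suc g)) u = orb (int g) (F u)" for u
      using orb_add[of "int g" 1 u] orb_Suc[of 0 u] by (simp add: add.commute)
    then have "fst (orb (int g) (F w) - orb (int g) (F v)) = 0" using v w by simp
    then have "\<mu> ^ g * \<bar>fst (F w - F v)\<bar> \<le> 0" using future_grow[OF un same, of g] by simp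
    then have "fst (F w - F v) = 0"
      using zero_less_power[OF \<mu>_pos, of g] by (auto simp: mult_le_0_iff)
    then have "F w - F v = 0" using un unst_zero by blast
    then show "v = w" by (metis GF eq_iff_diff_eq_0)
  qed
  moreover have "finite (c ` ?H)"
    by (rule finite_subset[of _ "Pow {..<g}"]) (auto simp: c_def)
  ultimately show ?thesis by (rule finite_imageD[rotated])
qed

lemma countable_two_hits: "countable {v. \<exists>m n. m < n \<and> fst (orb m v) = 0 \<and> fst (orb n v) = 0}"
proof -
  have "{v. \<exists>m n. m < n \<and> fst (orb m v) = 0 \<and> fst (orb n v) = 0}
      \<subseteq> (\<Union>m. \<Union>g. orb (- m) ` {v. fst v = 0 \<and> fst (orb (int (Suc g)) v) = 0})"
  proof clarify
    fix x y m n assume mn: "m < n" "fst (orb m (x, y)) = 0" "fst (orb n (x, y)) = 0"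
    define w where "w = orb m (x, y)"
    define g where "g = nat (n - m - 1)"
    have g: "int (Suc g) = n - m" using mn(1) by (simp add: g_def)
    have "orb (int (Suc g)) w = orb n (x, y)" unfolding g w_def using orb_add[of "n - m" m] by simp
    then have "fst w = 0 \<and> fst (orb (int (Suc g)) w) = 0" using mn by (simp add: w_def)
    moreover have "(x, y) = orb (- m) w" by (simp add: w_def)
    ultimately show "(x, y) \<in> (\<Union>m. \<Union>g. orb (- m) ` {v. fst v = 0 \<and> fst (orb (int (Suc g)) v) = 0})"
      by blast
  qed
  then show ?thesis
    by (rule countable_subset) (intro countable_UN countable_image uncountable_infinite countable_finite finite_hits countableI_type)
qed

end

text \<open>The assumptions are symmetric under exchange of the maps. The condition
  \<open>approx\<close> yields connectedness of \<open>\<Gamma>\<close> and the nearby coupled pairs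
  from which chords are formed.\<close>

locale lozi_coupling =
  M1: lozi_map a1 b1 \<nu>1 \<kappa>1 \<mu>1 s1 + M2: lozi_map a2 b2 \<nu>2 \<kappa>2 \<mu>2 s2
  for a1 b1 \<nu>1 \<kappa>1 \<mu>1 s1 a2 b2 \<nu>2 \<kappa>2 \<mu>2 s2 :: real +
  fixes \<Gamma> :: "((real \<times> real) \<times> (real \<times> real)) set"
  assumes compact_\<Gamma>: "compact \<Gamma>"
    and onto1: "fst ` \<Gamma> = lozi_attractor a1 b1" and onto2: "snd ` \<Gamma> = lozi_attractor a2 b2"
    and compat: "(p, q) \<in> \<Gamma> \<Longrightarrow>
      fst (int_iter (lozi a1 b1) n p) * fst (int_iter (lozi a2 b2) n q) \<ge> 0"
    and shift: "(p, q) \<in> \<Gamma> \<Longrightarrow> (int_iter (lozi a1 b1) n p, int_iter (lozi a2 b2) n q) \<in> \<Gamma>"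
    and approx: "\<Gamma> \<subseteq> closure (\<Gamma> \<inter> lozi_Wu a1 b1 \<times> lozi_Wu a2 b2)"
begin

lemma \<Gamma>_L: "(p, q) \<in> \<Gamma> \<Longrightarrow> p \<in> M1.L" "(p, q) \<in> \<Gamma> \<Longrightarrow> q \<in> M2.L"
  using onto1 onto2 by force+

lemma \<Gamma>_K: "(p, q) \<in> \<Gamma> \<Longrightarrow> M1.orb n p \<in> M1.K" "(p, q) \<in> \<Gamma> \<Longrightarrow> M2.orb n q \<in> M2.K"
  using \<Gamma>_L M1.orb_L M2.orb_L M1.L_K M2.L_K by blast+

text \<open>
  Coupled unstable chords point in the same direction; otherwise the two chords would never be
  separated by the y-axis, and an unstable chord cannot stay bounded forever.
\<close>

lemma chord_order:
  assumes "(p, r) \<in> \<Gamma>" "(p', r') \<in> \<Gamma>" "M1.unst (p' - p)" "M2.unst (r' - r)"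
  shows "fst (p' - p) * fst (r' - r) \<ge> 0"
proof (rule ccontr)
  assume neg: "\<not> ?thesis"
  define d1 where "d1 n = M1.orb (int n) p' - M1.orb (int n) p" for n
  define d2 where "d2 n = M2.orb (int n) r' - M2.orb (int n) r" for n
  have lock: "\<exists>e::real. (e = 1 \<or> e = -1) \<and>
      \<bar>fst (M1.orb (int n) p')\<bar> = e * fst (M1.orb (int n) p') \<and>
      \<bar>fst (M1.orb (int n) p)\<bar> = e * fst (M1.orb (int n) p) \<and>
      \<bar>fst (M2.orb (int n) r')\<bar> = e * fst (M2.orb (int n) r') \<and>
      \<bar>fst (M2.orb (int n) r)\<bar> = e * fst (M2.orb (int n) r)"
    if "fst (d1 n) * fst (d2 n) < 0" for n
  proof -
    have "(fst (M1.orb (int n) p') - fst (M1.orb (int n) p)) *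
        (fst (M2.orb (int n) r') - fst (M2.orb (int n) r)) < 0"
      using that by (simp add: d1_def d2_def)
    then show ?thesis
      using sign_lock[OF compat[OF assms(2), of "int n"] compat[OF assms(1), of "int n"]] by blast
  qed
  have inv: "M1.unst (d1 n) \<and> M2.unst (d2 n) \<and> fst (d1 n) * fst (d2 n) < 0" for n
  proof (induction n)
    case 0
    then show ?case using assms(3,4) neg by (simp add: d1_def d2_def)
  next
    case (Suc n)
    then obtain e :: real where e: "e = 1 \<or> e = -1"
      "\<bar>fst (M1.orb (int n) p')\<bar> = e * fst (M1.orb (int n) p')"
      "\<bar>fst (M1.orb (int n) p)\<bar> = e * fst (M1.orb (int n) p)"
      "\<bar>fst (M2.orb (int n) r')\<bar> = e * fst (M2.orb (int n) r')"
      "\<bar>fst (M2.orb (int n) r)\<bar> = e * fst (M2.orb (int n) r)"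
      using lock by blast
    have D1: "d1 (Suc n) = (snd (d1 n) - a1 * (e * fst (d1 n)), b1 * fst (d1 n))"
      using M1.F_diff[OF e(3,2)] M1.orb_Suc[of "int n"] by (simp add: d1_def add.commute)
    have D2: "d2 (Suc n) = (snd (d2 n) - a2 * (e * fst (d2 n)), b2 * fst (d2 n))"
      using M2.F_diff[OF e(5,4)] M2.orb_Suc[of "int n"] by (simp add: d2_def add.commute)
    have ne: "fst (d1 n) \<noteq> 0" "fst (d2 n) \<noteq> 0" using Suc by auto
    have "fst (d1 (Suc n)) * (- e * fst (d1 n)) \<ge> \<mu>1 * (fst (d1 n))\<^sup>2"
      using M1.unst_step(3)[OF _ e(1), of "d1 n"] Suc by (simp add: D1)
    moreover have "\<mu>1 * (fst (d1 n))\<^sup>2 > 0" using ne M1.\<mu>_pos by simp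
    ultimately have p1: "fst (d1 (Suc n)) * (- e * fst (d1 n)) > 0" by linarith
    have "fst (d2 (Suc n)) * (- e * fst (d2 n)) \<ge> \<mu>2 * (fst (d2 n))\<^sup>2"
      using M2.unst_step(3)[OF _ e(1), of "d2 n"] Suc by (simp add: D2)
    moreover have "\<mu>2 * (fst (d2 n))\<^sup>2 > 0" using ne M2.\<mu>_pos by simp
    ultimately have p2: "fst (d2 (Suc n)) * (- e * fst (d2 n)) > 0" by linarith
    have "fst (d1 (Suc n)) * fst (d2 (Suc n)) < 0"
      using p1 p2 e(1) Suc by (auto simp: zero_less_mult_iff mult_less_0_iff)
    then show ?case using M1.unst_step(1)[OF _ e(1)] M2.unst_step(1)[OF _ e(1)] Suc D1 D2 by simp
  qed
  have "r = r'"
  proof (rule M2.future_eq[OF M2.bounded_K assms(4)])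
    fix n :: int assume "n \<ge> 0"
    then obtain m where m: "n = int m" using nonneg_int_cases by blast
    obtain e :: real where e: "e = 1 \<or> e = -1"
      "\<bar>fst (M2.orb n r')\<bar> = e * fst (M2.orb n r')" "\<bar>fst (M2.orb n r)\<bar> = e * fst (M2.orb n r)"
      using lock[of m] inv[of m] unfolding m by blast
    then have "fst (M2.orb n r) * fst (M2.orb n r') = \<bar>fst (M2.orb n r)\<bar> * \<bar>fst (M2.orb n r')\<bar>"
      by auto
    then show "fst (M2.orb n r) * fst (M2.orb n r') \<ge> 0" by simp
  qed (use \<Gamma>_K assms in auto)
  then show False using inv[of 0] by (simp add: d2_def)
qed

text \<open>
  Two points coupled to \<open>p\<close> with equal pasts span an unstable segment in the second attractor,
  all of whose points are coupled to \<open>p\<close> alone. Hence this segment can be folded only at times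
  when the orbit of \<open>p\<close> hits the y-axis, and these are never consecutive.
\<close>

lemma same_past0:
  assumes r: "(p, r) \<in> \<Gamma>" and q: "(p, q) \<in> \<Gamma>"
    and same: "\<And>n. n < 0 \<Longrightarrow> fst (M2.orb n r) * fst (M2.orb n q) \<ge> 0"
  shows "r = q"
proof (rule ccontr)
  assume "r \<noteq> q"
  define y where "y \<theta> = (1 - \<theta>) *\<^sub>R r + \<theta> *\<^sub>R q" for \<theta>
  have un: "M2.unst (M2.orb n q - M2.orb n r)" if "n \<le> 0" for n
  proof (rule M2.past_unst[OF M2.bounded_K])
    fix m :: int
    show "m \<le> 0 \<Longrightarrow> M2.orb m (M2.orb n r) \<in> M2.K" "m \<le> 0 \<Longrightarrow> M2.orb m (M2.orb n q) \<in> M2.K"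
      using \<Gamma>_K r q by (simp_all flip: M2.orb_add)
    show "m < 0 \<Longrightarrow> 0 \<le> fst (M2.orb m (M2.orb n r)) * fst (M2.orb m (M2.orb n q))"
      using same[of "m + n"] that by (simp flip: M2.orb_add)
  qed
  have ne: "fst (M2.orb n r) \<noteq> fst (M2.orb n q)" if "n \<le> 0" for n
    using M2.unst_zero[OF un[OF that]] \<open>r \<noteq> q\<close> M2.orb_inj by auto
  \<comment> \<open>The backward orbit of \<open>y \<theta>\<close> consists of convex combinations
    of points of \<open>K\<close>, so \<open>K_past_in_L\<close> applies.\<close>
  have yL: "y \<theta> \<in> M2.L" if "0 \<le> \<theta>" "\<theta> \<le> 1" for \<theta>
  proof (rule M2.K_past_in_L)
    fix n
    have "(M2.G ^^ n) (y \<theta>) = (1 - \<theta>) *\<^sub>R M2.orb (- int n) r + \<theta> *\<^sub>R M2.orb (- int n) q"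
      using M2.orb_comb[OF same that] unfolding y_def M2.orb_neg_nat by blast
    also have "\<dots> \<in> M2.K"
      using M2.convex_K \<Gamma>_K(2)[OF r] \<Gamma>_K(2)[OF q] that by (simp add: convexD)
    finally show "(M2.G ^^ n) (y \<theta>) \<in> M2.K" .
  qed
  have unq: "M2.unst (q - r)" using un[of 0] by simp
  have dr: "y \<theta> - r = \<theta> *\<^sub>R (q - r)" and dq: "y \<theta> - q = - (1 - \<theta>) *\<^sub>R (q - r)" for \<theta>
    by (simp_all add: y_def algebra_simps)
  \<comment> \<open>The chords to \<open>y \<theta>\<close> from \<open>r\<close> and from
    \<open>q\<close> point in opposite directions. The chord from \<open>p\<close> to
    \<open>x\<close> is unstable and, by \<open>chord_order\<close>, must agree with both, so it
    vanishes.\<close>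
  have only: "x = p" if \<theta>: "0 < \<theta>" "\<theta> < 1" and x: "(x, y \<theta>) \<in> \<Gamma>" for \<theta> x
  proof -
    have un1: "M1.unst (x - p)"
    proof (rule M1.past_unst[OF M1.bounded_K])
      fix n :: int assume n: "n < 0"
      have "n = - int (nat (- n))" using n by simp
      then have yn: "M2.orb n (y \<theta>) = (1 - \<theta>) *\<^sub>R M2.orb n r + \<theta> *\<^sub>R M2.orb n q"
        using M2.orb_comb[OF same, of \<theta> "nat (- n)"] \<theta> by (simp add: y_def)
      define A B C where "A = fst (M2.orb n r)" and "B = fst (M2.orb n q)" and "C = fst (M2.orb n (y \<theta>))"
      have C: "C = (1 - \<theta>) * A + \<theta> * B" using yn by (simp add: A_def B_def C_def)
      have AB: "A * B \<ge> 0" "A \<noteq> B" using same[OF n] ne[of n] n by (simp_all add: A_def B_def)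
      define P Q where "P = fst (M1.orb n p)" and "Q = fst (M1.orb n x)"
      have PA: "P * A \<ge> 0" "P * B \<ge> 0" "Q * C \<ge> 0"
        using compat[OF r, of n] compat[OF q, of n] compat[OF x, of n]
        by (simp_all add: A_def B_def C_def P_def Q_def)
      \<comment> \<open>As \<open>A\<close> and \<open>B\<close> are distinct and on one side of 0,
        the intermediate value \<open>C\<close> is nonzero and lies on that side; this pins down the
        sides of both \<open>P\<close> and \<open>Q\<close>.\<close>
      have "P * Q \<ge> 0"
      proof (rule ccontr)
        assume "\<not> P * Q \<ge> 0"
        then have PQ: "P > 0 \<and> Q < 0 \<or> P < 0 \<and> Q > 0" by (auto simp: not_le mult_less_0_iff)
        then show False
        proof
          assume "P > 0 \<and> Q < 0"
          then have "A \<ge> 0" "B \<ge> 0" "C \<le> 0" using PA by (auto simp: zero_le_mult_iff)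
          moreover from this have "(1 - \<theta>) * A \<ge> 0" "\<theta> * B \<ge> 0" using \<theta> by auto
          ultimately have "(1 - \<theta>) * A = 0" "\<theta> * B = 0" using C by linarith+
          then show False using \<theta> AB(2) by simp
        next
          assume "P < 0 \<and> Q > 0"
          then have "A \<le> 0" "B \<le> 0" "C \<ge> 0" using PA by (auto simp: zero_le_mult_iff)
          moreover from this have "(1 - \<theta>) * A \<le> 0" "\<theta> * B \<le> 0" using \<theta> by (auto simp: mult_le_0_iff)
          ultimately have "(1 - \<theta>) * A = 0" "\<theta> * B = 0" using C by linarith+
          then show False using \<theta> AB(2) by simp
        qed
      qed
      then show "fst (M1.orb n p) * fst (M1.orb n x) \<ge> 0" by (simp add: P_def Q_def)
    qed (use \<Gamma>_K r x in auto)
    have order: "fst (x - p) * fst (y \<theta> - r) \<ge> 0" "fst (x - p) * fst (y \<theta> - q) \<ge> 0"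
      using chord_order[OF r x un1] chord_order[OF q x un1] M2.unst_scale[OF unq] dr dq by metis+
    define E d where "E = fst (x - p)" and "d = fst (q - r)"
    have "d \<noteq> 0" using ne[of 0] by (simp add: d_def)
    have yd: "fst (y \<theta> - r) = \<theta> * d" "fst (y \<theta> - q) = - (1 - \<theta>) * d"
      unfolding dr dq d_def by simp_all
    have "\<theta> * (E * d) \<ge> 0" "(1 - \<theta>) * (E * d) \<le> 0"
      using order unfolding yd E_def[symmetric] by (simp_all add: algebra_simps)
    then have "E * d = 0" using \<theta> by (auto simp: zero_le_mult_iff mult_le_0_iff)
    then have "fst (x - p) = 0" using \<open>d \<noteq> 0\<close> by (simp add: E_def)
    then show "x = p" using M1.unst_zero[OF un1] by simp
  qed
  have yr: "y \<theta> = r + \<theta> *\<^sub>R (q - r)" for \<theta> by (simp add: y_def algebra_simps)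
  have ydiff: "y \<beta> - y \<alpha> = (\<beta> - \<alpha>) *\<^sub>R (q - r)" for \<alpha> \<beta>
    unfolding yr by (simp add: scaleR_left_diff_distrib)
  \<comment> \<open>The middle third keeps \<open>\<theta>\<close> away from 0 and 1, as
    \<open>only\<close> requires.\<close>
  have mem: "(p, v) \<in> \<Gamma>" if v: "v \<in> closed_segment (y (1/3)) (y (2/3))" for v
  proof -
    obtain u where u: "0 \<le> u" "u \<le> 1" "v = (1 - u) *\<^sub>R y (1/3) + u *\<^sub>R y (2/3)"
      using v by (auto simp: in_segment)
    define \<theta> where "\<theta> = (1 + u) / 3"
    have \<theta>: "0 < \<theta>" "\<theta> < 1" using u by (simp_all add: \<theta>_def)
    have "(1 - u) *\<^sub>R (r + \<alpha> *\<^sub>R (q - r)) + u *\<^sub>R (r + \<beta> *\<^sub>R (q - r))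
        = r + ((1 - u) * \<alpha> + u * \<beta>) *\<^sub>R (q - r)" for \<alpha> \<beta>
      by (simp add: algebra_simps)
    moreover have "(1 - u) * (1/3) + u * (2/3) = \<theta>" by (simp add: \<theta>_def field_simps)
    ultimately have "v = y \<theta>" unfolding u(3) yr by metis
    moreover have "y \<theta> \<in> snd ` \<Gamma>" using yL[of \<theta>] \<theta> onto2 by simp
    then obtain x where "(x, y \<theta>) \<in> \<Gamma>" by auto
    ultimately show ?thesis using only \<theta> by blast
  qed
  have "y (1/3) = y (2/3)"
  proof (rule M2.segment_growth[OF _ M2.bounded_K])
    show "M2.unst (y (2/3) - y (1/3))" unfolding ydiff by (rule M2.unst_scale[OF unq])
    fix n
    show "M2.orb (int n) v \<in> M2.K" if "v \<in> closed_segment (y (1/3)) (y (2/3))" for v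
      using \<Gamma>_K(2)[OF mem[OF that]] .
    show "fst (M1.orb (int n) p) = 0"
      if "v \<in> closed_segment (y (1/3)) (y (2/3))" "w \<in> closed_segment (y (1/3)) (y (2/3))"
        "fst (M2.orb (int n) v) * fst (M2.orb (int n) w) < 0" for v w
      using compat[OF mem[OF that(1)], of "int n"] compat[OF mem[OF that(2)], of "int n"] that(3)
      by (auto simp: zero_le_mult_iff mult_less_0_iff)
    show "\<not> (fst (M1.orb (int n) p) = 0 \<and> fst (M1.orb (int (Suc n)) p) = 0)"
      using M1.no_consecutive_hits[OF \<Gamma>_K(1)[OF r, of "int n"]] M1.orb_Suc[of "int n" p]
      by (auto simp: add.commute)
  qed
  then have "(2/3 - 1/3 :: real) *\<^sub>R (q - r) = 0"
    unfolding ydiff[symmetric] by simp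
  then show False using \<open>r \<noteq> q\<close> by simp
qed

lemma same_past:
  assumes r: "(p, r) \<in> \<Gamma>" and q: "(p, q) \<in> \<Gamma>"
    and same: "\<And>n. n < N \<Longrightarrow> fst (M2.orb n r) * fst (M2.orb n q) \<ge> 0"
  shows "r = q"
proof -
  have "M2.orb N r = M2.orb N q"
  proof (rule same_past0[OF shift[OF r] shift[OF q]])
    fix n :: int assume "n < 0"
    then show "fst (M2.orb n (M2.orb N r)) * fst (M2.orb n (M2.orb N q)) \<ge> 0"
      using same[of "n + N"] by (simp flip: M2.orb_add)
  qed
  then show ?thesis by (simp add: M2.orb_inj)
qed

text \<open>By \<open>same_past\<close> the two partners lie strictly on opposite sides at some time
  before \<open>N\<close>. Then \<open>p\<close>, being weakly on both sides, lies on the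
  axis.\<close>

lemma past_hits:
  assumes "(p, r) \<in> \<Gamma>" "(p, q) \<in> \<Gamma>" "r \<noteq> q"
  obtains n where "n < N" "fst (M1.orb n p) = 0"
proof -
  obtain n where n: "n < N" "fst (M2.orb n r) * fst (M2.orb n q) < 0"
    using same_past[OF assms(1,2)] assms(3) by (meson not_le)
  then have "fst (M1.orb n p) = 0"
    using compat[OF assms(1), of n] compat[OF assms(2), of n]
    by (auto simp: zero_le_mult_iff mult_less_0_iff)
  then show ?thesis using that n by blast
qed

lemma unique_over_W:
  assumes "(p, r) \<in> \<Gamma>" "(p, q) \<in> \<Gamma>" "p \<in> M1.W"
  shows "r = q"
proof (rule ccontr)
  assume "r \<noteq> q"
  obtain N where N: "\<And>n. n \<le> N \<Longrightarrow> fst (M1.orb n p) > 0" using M1.W_past[OF assms(3)] by blast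
  obtain n where "n < N" "fst (M1.orb n p) = 0" using past_hits[OF assms(1,2) \<open>r \<noteq> q\<close>] by blast
  then show False using N[of n] by simp
qed

end

section \<open>Conjugacy\<close>

lemma sign_pick:
  fixes P P' R R' :: real
  assumes "P * R \<ge> 0" "P' * R' \<ge> 0" "P \<noteq> 0 \<Longrightarrow> P * P' > 0" "R \<noteq> 0 \<Longrightarrow> R * R' > 0"
  shows "\<exists>e::real. (e = 1 \<or> e = -1) \<and> 0 \<le> e * P \<and> 0 \<le> e * R \<and> 0 \<le> e * P'"
proof -
  have "(P \<ge> 0 \<and> R \<ge> 0 \<and> P' \<ge> 0) \<or> (P \<le> 0 \<and> R \<le> 0 \<and> P' \<le> 0)"
    using assms unfolding zero_le_mult_iff zero_less_mult_iff by linarith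
  then show ?thesis
  proof
    assume "P \<ge> 0 \<and> R \<ge> 0 \<and> P' \<ge> 0"
    then show ?thesis by (intro exI[of _ 1]) simp
  next
    assume "P \<le> 0 \<and> R \<le> 0 \<and> P' \<le> 0"
    then show ?thesis by (intro exI[of _ "-1"]) simp
  qed
qed

lemma sign_eqI:
  fixes e e' x y :: real
  assumes "e = 1 \<or> e = -1" "e' = 1 \<or> e' = -1" "0 \<le> e * x" "0 \<le> e' * y" "x * y > 0"
  shows "e = e'"
  using assms by (auto simp: zero_less_mult_iff)

lemma sign_prod:
  fixes e A A' B B' :: real
  assumes "A * (e * B) > 0" "A' * (e * B') > 0" "B * B' > 0"
  shows "A * A' > 0"
proof -
  have "(A * A') * ((e * e) * (B * B')) > 0"
    using mult_pos_pos[OF assms(1,2)] by (simp add: mult_ac)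
  moreover have "(e * e) * (B * B') \<ge> 0" using assms(3) by simp
  ultimately show ?thesis by (metis mult_nonpos_nonneg not_le)
qed

lemma eventually_same_sign:
  fixes f :: "nat \<Rightarrow> real"
  assumes "f \<longlonglongrightarrow> c"
  shows "eventually (\<lambda>j. c \<noteq> 0 \<longrightarrow> c * f j > 0) sequentially"
proof (cases "c = 0")
  case False
  then have "0 < c * c" using not_real_square_gt_zero by blast
  moreover have "(\<lambda>j. c * f j) \<longlonglongrightarrow> c * c" by (intro tendsto_intros assms)
  ultimately have "eventually (\<lambda>j. c * f j > 0) sequentially" using order_tendstoD(1) by blast
  then show ?thesis by (rule eventually_mono) simp
qed simp

section \<open>Chords to nearby points of the unstable manifold\<close>

context lozi_map
begin

text \<open>For a steep chord the term with \<open>a\<close> dominates, so the branch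
  \<open>e\<close> decides whether pulling back preserves or reverses the vertical
  direction.\<close>

lemma steep_sign:
  assumes "steep_excess (u, v) > 0" "e = 1 \<or> e = -1"
  shows "(u + a * (e * (v / b))) * (e * v) > 0"
proof -
  have uv: "s * \<bar>u\<bar> < \<bar>v\<bar>" using assms(1) by (simp add: steep_excess_def)
  moreover have "0 \<le> s * \<bar>u\<bar>" using s_pos by simp
  ultimately have v: "\<bar>v\<bar> > 0" by linarith
  have "b * \<bar>u\<bar> = \<mu> * (s * \<bar>u\<bar>)" using b_split by simp
  also have "\<dots> < \<mu> * \<bar>v\<bar>" using uv \<mu>_pos by simp
  also have "\<dots> \<le> a * \<bar>v\<bar>" using a_split s_pos by (simp add: mult_right_mono)
  finally have "\<bar>u\<bar> < a * \<bar>v\<bar> / b" using b_pos by (simp add: pos_less_divide_eq mult.commute)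
  then have "\<bar>v\<bar> * \<bar>u\<bar> < \<bar>v\<bar> * (a * \<bar>v\<bar> / b)" using v by (rule mult_strict_left_mono)
  moreover have "\<bar>u * (e * v)\<bar> = \<bar>v\<bar> * \<bar>u\<bar>" using assms(2) by (auto simp: abs_mult)
  moreover have "a * (e * (v / b)) * (e * v) = \<bar>v\<bar> * (a * \<bar>v\<bar> / b)"
    using assms(2) by auto
  moreover have "(u + a * (e * (v / b))) * (e * v) = u * (e * v) + a * (e * (v / b)) * (e * v)"
    by (simp add: distrib_right)
  ultimately show ?thesis by linarith
qed

end

context lozi_coupling
begin

text \<open>
  \<open>chords p r N w e\<close>: the backward orbit of \<open>w 0\<close> consists of the chords from the backward orbit
  of \<open>p\<close> to that of a nearby point of \<open>W\<close>, and \<open>e\<close> records the sides of the y-axis, for this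
  nearby point, for \<open>p\<close>, and for the point \<open>r\<close> coupled to \<open>p\<close>.
\<close>

definition chords ::
  "real \<times> real \<Rightarrow> real \<times> real \<Rightarrow> nat \<Rightarrow> (nat \<Rightarrow> real \<times> real) \<Rightarrow> (nat \<Rightarrow> real) \<Rightarrow> bool" where
  "chords p r N w e \<longleftrightarrow> (\<forall>n\<le>N. w n \<noteq> 0) \<and> (\<forall>n<N. (e n = 1 \<or> e n = -1) \<and>
     w (Suc n) = (snd (w n) / b1, fst (w n) + a1 * (e n * (snd (w n) / b1))) \<and>
     0 \<le> e n * fst (M1.orb (- int (Suc n)) p) \<and> 0 \<le> e n * fst (M2.orb (- int (Suc n)) r) \<and>
     0 \<le> e n * (fst (M1.orb (- int (Suc n)) p) + fst (w (Suc n))))"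

text \<open>A coupled pair of \<open>W\<close> points close to \<open>(p, r)\<close> is, at the last
  \<open>N\<close> times, on the side of \<open>p\<close> and of \<open>r\<close> whenever these are
  off the axis. Its own compatibility then provides one sign for both maps. The chords do not vanish
  because \<open>p\<close> is not in the unstable manifold.\<close>

lemma chords_exist:
  assumes pr: "(p, r) \<in> \<Gamma>" and "p \<notin> M1.W"
  shows "\<exists>w e. chords p r N w e"
proof -
  have "(p, r) \<in> closure (\<Gamma> \<inter> M1.W \<times> M2.W)" using pr approx by blast
  then obtain x where x: "\<And>j. x j \<in> \<Gamma> \<inter> M1.W \<times> M2.W" "x \<longlonglongrightarrow> (p, r)"
    unfolding closure_sequential by blast
  have x1: "(\<lambda>j. fst (x j)) \<longlonglongrightarrow> p" and x2: "(\<lambda>j. snd (x j)) \<longlonglongrightarrow> r"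
    using tendsto_fst[OF x(2)] tendsto_snd[OF x(2)] by simp_all
  define good where "good n j \<longleftrightarrow>
    (fst (M1.orb (- int (Suc n)) p) \<noteq> 0 \<longrightarrow>
      fst (M1.orb (- int (Suc n)) p) * fst (M1.orb (- int (Suc n)) (fst (x j))) > 0) \<and>
    (fst (M2.orb (- int (Suc n)) r) \<noteq> 0 \<longrightarrow>
      fst (M2.orb (- int (Suc n)) r) * fst (M2.orb (- int (Suc n)) (snd (x j))) > 0)" for n j
  have "eventually (good n) sequentially" for n
    unfolding good_def
    by (intro eventually_conj eventually_same_sign tendsto_fst M1.tendsto_orb M2.tendsto_orb x1 x2)
  then have "eventually (\<lambda>j. \<forall>n\<in>{..<N}. good n j) sequentially"
    by (intro eventually_ball_finite) auto
  then obtain j where j: "\<forall>n<N. good n j"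
    unfolding eventually_sequentially by auto
  define p' r' where "p' = fst (x j)" and "r' = snd (x j)"
  have p'r': "(p', r') \<in> \<Gamma>" "p' \<in> M1.W" using x(1)[of j] by (auto simp: p'_def r'_def mem_Times_iff)
  define w where "w n = M1.orb (- int n) p' - M1.orb (- int n) p" for n
  have "\<exists>e::real. (e = 1 \<or> e = -1) \<and> 0 \<le> e * fst (M1.orb (- int (Suc n)) p) \<and>
      0 \<le> e * fst (M2.orb (- int (Suc n)) r) \<and> 0 \<le> e * fst (M1.orb (- int (Suc n)) p')" if "n < N" for n
    using j that unfolding good_def p'_def[symmetric] r'_def[symmetric]
    by (intro sign_pick[OF compat[OF pr] compat[OF p'r'(1)]]) auto
  then obtain e :: "nat \<Rightarrow> real" where e: "\<And>n. n < N \<Longrightarrow> e n = 1 \<or> e n = -1"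
    "\<And>n. n < N \<Longrightarrow> 0 \<le> e n * fst (M1.orb (- int (Suc n)) p)"
    "\<And>n. n < N \<Longrightarrow> 0 \<le> e n * fst (M2.orb (- int (Suc n)) r)"
    "\<And>n. n < N \<Longrightarrow> 0 \<le> e n * fst (M1.orb (- int (Suc n)) p')"
    by metis
  have "chords p r N w e"
    unfolding chords_def
  proof (intro conjI allI impI)
    fix n
    show "w n \<noteq> 0" using p'r'(2) assms(2) M1.orb_inj unfolding w_def by auto
  next
    fix n assume n: "n < N"
    show "e n = 1 \<or> e n = -1" "0 \<le> e n * fst (M1.orb (- int (Suc n)) p)"
      "0 \<le> e n * fst (M2.orb (- int (Suc n)) r)" by (fact e[OF n])+
    show "0 \<le> e n * (fst (M1.orb (- int (Suc n)) p) + fst (w (Suc n)))"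
      using e(4)[OF n] by (simp add: w_def)
    have "\<bar>fst (M1.orb (- int (Suc n)) p)\<bar> = e n * fst (M1.orb (- int (Suc n)) p)"
      "\<bar>fst (M1.orb (- int (Suc n)) p')\<bar> = e n * fst (M1.orb (- int (Suc n)) p')"
      using e[OF n] by auto
    from M1.F_diff[OF this] have "w n = (snd (w (Suc n)) - a1 * (e n * fst (w (Suc n))), b1 * fst (w (Suc n)))"
      using M1.orb_Suc[of "- int (Suc n)"] by (simp add: w_def)
    then have "fst (w n) = snd (w (Suc n)) - a1 * (e n * fst (w (Suc n)))" "snd (w n) = b1 * fst (w (Suc n))"
      by (metis fst_conv, metis snd_conv)
    then show "w (Suc n) = (snd (w n) / b1, fst (w n) + a1 * (e n * (snd (w n) / b1)))"
      using M1.b_pos by (simp add: prod_eq_iff)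
  qed
  then show ?thesis by blast
qed

lemma chordsD:
  assumes "chords p r N w e" "n < N"
  shows "e n = 1 \<or> e n = -1"
    "w (Suc n) = (snd (w n) / b1, fst (w n) + a1 * (e n * (snd (w n) / b1)))"
    "0 \<le> e n * fst (M1.orb (- int (Suc n)) p)" "0 \<le> e n * fst (M2.orb (- int (Suc n)) r)"
    "fst (M1.orb (- int (Suc n)) p) = 0 \<Longrightarrow> 0 \<le> e n * fst (w (Suc n))"
  using assms unfolding chords_def by auto

lemma chords_nz: "chords p r N w e \<Longrightarrow> n \<le> N \<Longrightarrow> w n \<noteq> 0"
  unfolding chords_def by blast

text \<open>Off the axis the position of \<open>p\<close> determines the sign; on the axis the
  horizontal direction of the chord does.\<close>

lemma chords_sign_eq:
  assumes "chords p r N w e" "chords p r' N' w' e'" "n < N" "n < N'"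
    and "fst (w (Suc n)) * fst (w' (Suc n)) > 0"
  shows "e n = e' n"
proof (cases "fst (M1.orb (- int (Suc n)) p) = 0")
  case True
  show ?thesis
    using sign_eqI[OF chordsD(1)[OF assms(1,3)] chordsD(1)[OF assms(2,4)]
      chordsD(5)[OF assms(1,3) True] chordsD(5)[OF assms(2,4) True] assms(5)] .
next
  case False
  then have "fst (M1.orb (- int (Suc n)) p) * fst (M1.orb (- int (Suc n)) p) > 0"
    using not_real_square_gt_zero by blast
  then show ?thesis
    using sign_eqI[OF chordsD(1)[OF assms(1,3)] chordsD(1)[OF assms(2,4)]
      chordsD(3)[OF assms(1,3)] chordsD(3)[OF assms(2,4)]] by blast
qed

lemma chords_same_side:
  assumes "chords p r N w e" "chords p r' N' w' e'" "n < N" "n < N'"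
    and "fst (w (Suc n)) * fst (w' (Suc n)) > 0"
  shows "0 \<le> fst (M2.orb (- int (Suc n)) r) * fst (M2.orb (- int (Suc n)) r')"
  using chords_sign_eq[OF assms] chordsD(1,4)[OF assms(1,3)] chordsD(4)[OF assms(2,4)]
  by (auto simp: zero_le_mult_iff)

lemma chords_steep:
  assumes "chords p r N w e" "M1.steep_excess (w m) > 0" "m \<le> n" "n \<le> N"
  shows "M1.steep_excess (w n) > 0"
  using assms(3,4)
proof (induction n rule: dec_induct)
  case base
  then show ?case using assms(2) by simp
next
  case (step n)
  then have n: "n < N" by simp
  have "M1.steep_excess (w (Suc n)) \<ge> (\<mu>1 / b1) * M1.steep_excess (w n)"
    using M1.steep_excess_back[OF chordsD(1)[OF assms(1) n], of "fst (w n)" "snd (w n)"]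
    by (simp add: chordsD(2)[OF assms(1) n])
  moreover have "(\<mu>1 / b1) * M1.steep_excess (w n) > 0"
    using step n M1.\<mu>_pos M1.b_pos by simp
  ultimately show ?case by linarith
qed

lemma chords_steep_step:
  assumes "chords p r N w e" "M1.steep_excess (w n) > 0" "n < N"
  shows "snd (w (Suc n)) * (e n * snd (w n)) > 0"
  using M1.steep_sign[of "fst (w n)" "snd (w n)" "e n"] chordsD(1,2)[OF assms(1,3)] assms(2) by simp

text \<open>
  After a hit both steep chords point upwards, whatever they did before; from then on they stay
  on the same sides.
\<close>

lemma steep_chords_agree:
  assumes c: "chords p r N w e" "chords p r' N w' e'"
    and steep: "M1.steep_excess (w h) > 0" "M1.steep_excess (w' h) > 0"
    and hit: "fst (M1.orb (- int (Suc h)) p) = 0"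
    and n: "h < n" "n < N"
  shows "0 \<le> fst (M2.orb (- int (Suc n)) r) * fst (M2.orb (- int (Suc n)) r')"
proof -
  have st: "M1.steep_excess (w i) > 0" "M1.steep_excess (w' i) > 0" if "h \<le> i" "i \<le> N" for i
    using chords_steep[OF c(1) steep(1) that] chords_steep[OF c(2) steep(2) that] by auto
  have up: "snd (w (Suc h)) > 0" if "chords p r N w e" "M1.steep_excess (w h) > 0" for r w e
  proof -
    have hN: "h < N" using n by simp
    have "0 \<le> e h * (snd (w h) / b1)" using chordsD(5)[OF that(1) hN hit] chordsD(2)[OF that(1) hN] by simp
    then have "0 \<le> e h * snd (w h)" using M1.b_pos by (simp add: zero_le_divide_iff)
    then show ?thesis using chords_steep_step[OF that hN] by (auto simp: zero_less_mult_iff)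
  qed
  have inv: "snd (w i) * snd (w' i) > 0" if "Suc h \<le> i" "i \<le> N" for i
    using that
  proof (induction i rule: dec_induct)
    case base
    show ?case using up[OF c(1) steep(1)] up[OF c(2) steep(2)] by simp
  next
    case (step i)
    have iN: "i < N" "h \<le> i" "i \<le> N" using step by auto
    have ih: "snd (w i) * snd (w' i) > 0" using step by simp
    have "fst (w (Suc i)) * fst (w' (Suc i)) > 0"
      using ih chordsD(2)[OF c(1) iN(1)] chordsD(2)[OF c(2) iN(1)] M1.b_pos by simp
    then have e: "e i = e' i" using chords_sign_eq[OF c iN(1) iN(1)] by blast
    show ?case
      by (rule sign_prod[OF chords_steep_step[OF c(1) st(1)[OF iN(2,3)] iN(1)]
          chords_steep_step[OF c(2) st(2)[OF iN(2,3)] iN(1), folded e] ih])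
  qed
  have "fst (w (Suc n)) * fst (w' (Suc n)) > 0"
    using inv[of n] n chordsD(2)[OF c(1) n(2)] chordsD(2)[OF c(2) n(2)] M1.b_pos by simp
  then show ?thesis using chords_same_side[OF c n(2) n(2)] by blast
qed

lemma chords_unst_step:
  assumes "chords p r N w e" "n < N" "M1.unst (w (Suc n))"
  shows "fst (w (Suc n)) \<noteq> 0" "fst (w n) * (- e n * fst (w (Suc n))) > 0"
proof -
  show ne: "fst (w (Suc n)) \<noteq> 0"
    using M1.unst_zero[OF assms(3)] chords_nz[OF assms(1), of "Suc n"] assms(2) by auto
  have f: "fst (w n) = snd (w (Suc n)) - a1 * (e n * fst (w (Suc n)))"
    using chordsD(2)[OF assms(1,2)] by simp
  have "fst (w n) * (- e n * fst (w (Suc n))) \<ge> \<mu>1 * (fst (w (Suc n)))\<^sup>2"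
    unfolding f by (rule M1.unst_step(3)[OF assms(3) chordsD(1)[OF assms(1,2)]])
  moreover have "\<mu>1 * (fst (w (Suc n)))\<^sup>2 > 0" using ne M1.\<mu>_pos by simp
  ultimately show "fst (w n) * (- e n * fst (w (Suc n))) > 0" by linarith
qed

text \<open>The image of an unstable chord starting on the y-axis always points to the left.\<close>

lemma unst_chords_agree:
  assumes c: "chords p r N w e" "chords p r' N' w' e'" and h: "h < N" "h < N'"
    and un: "\<And>i. i \<le> Suc h \<Longrightarrow> M1.unst (w i)" "\<And>i. i \<le> Suc h \<Longrightarrow> M1.unst (w' i)"
    and hit: "fst (M1.orb (- int (Suc h)) p) = 0" and n: "n < h"
  shows "0 \<le> fst (M2.orb (- int (Suc n)) r) * fst (M2.orb (- int (Suc n)) r')"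
proof -
  have left: "fst (w h) < 0"
    if "chords p r N w e" "h < N" "M1.unst (w (Suc h))" for r N w e
  proof -
    define t where "t = e h * fst (w (Suc h))"
    have "fst (w h) * t < 0" using chords_unst_step(2)[OF that] by (simp add: t_def)
    moreover have "t \<ge> 0" unfolding t_def by (rule chordsD(5)[OF that(1,2) hit])
    ultimately show ?thesis by (auto simp: mult_less_0_iff)
  qed
  have inv: "fst (w i) * fst (w' i) > 0" if "i \<le> h" for i
    using that
  proof (induction i rule: inc_induct)
    case base
    show ?case using left[OF c(1) h(1) un(1)] left[OF c(2) h(2) un(2)] by (simp add: mult_neg_neg)
  next
    case (step i)
    have i: "i < N" "i < N'" "Suc i \<le> Suc h" using step h by auto
    have e: "e i = e' i" using chords_sign_eq[OF c i(1,2)] step by blast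
    show ?case
      by (rule sign_prod[OF chords_unst_step(2)[OF c(1) i(1) un(1)[OF i(3)]]
          chords_unst_step(2)[OF c(2) i(2) un(2)[OF i(3)], folded e] step.IH])
  qed
  show ?thesis
    by (rule chords_same_side[OF c]) (use inv[of "Suc n"] n h in auto)
qed

text \<open>Steepness persists into the past. So either some chords are unstable up to any
  prescribed time, or all chords are steep from one common time on (\<open>not_thin\<close>). Each
  alternative leaves room for one partner of \<open>p\<close>.\<close>

definition thin :: "real \<times> real \<Rightarrow> real \<times> real \<Rightarrow> bool" where
  "thin p r \<longleftrightarrow> (\<forall>h. \<exists>N w e. h \<le> N \<and> chords p r N w e \<and> (\<forall>i\<le>h. M1.unst (w i)))"

lemma not_thin:
  assumes "\<not> thin p r"
  obtains h where "\<And>N w e n. chords p r N w e \<Longrightarrow> h \<le> n \<Longrightarrow> n \<le> N \<Longrightarrow> M1.steep_excess (w n) > 0"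
proof -
  obtain h where h: "\<And>N w e. h \<le> N \<Longrightarrow> chords p r N w e \<Longrightarrow> \<exists>i\<le>h. \<not> M1.unst (w i)"
    using assms unfolding thin_def by blast
  have "M1.steep_excess (w n) > 0" if "chords p r N w e" "h \<le> n" "n \<le> N" for N w e n
  proof -
    have "\<exists>i\<le>h. \<not> M1.unst (w i)" using h[OF le_trans[OF that(2,3)] that(1)] .
    then obtain i where "i \<le> h" "\<not> M1.unst (w i)" by blast
    then show ?thesis
      using chords_steep[OF that(1), of i n] that by (simp add: M1.unst_iff_excess)
  qed
  then show ?thesis by (rule that)
qed

lemma hit_beyond:
  assumes "(p, r) \<in> \<Gamma>" "(p, q) \<in> \<Gamma>" "r \<noteq> q"
  obtains h where "m \<le> h" "fst (M1.orb (- int (Suc h)) p) = 0"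
proof -
  obtain n where n: "n < - int m" "fst (M1.orb n p) = 0" using past_hits[OF assms] by blast
  define h where "h = nat (- n - 1)"
  have "n = - int (Suc h)" "m \<le> h" using n(1) by (auto simp: h_def)
  then show ?thesis using that n(2) by simp
qed

lemma neg_int_cases':
  assumes "n < - int k"
  obtains i where "k \<le> i" "n = - int (Suc i)"
proof
  show "k \<le> nat (- n - 1)" "n = - int (Suc (nat (- n - 1)))" using assms by auto
qed

text \<open>A hit synchronizes unstable chords at all later times up to 0, and hits occur
  arbitrarily far back, so the sides agree at every negative time.\<close>

lemma thin_unique:
  assumes "(p, r) \<in> \<Gamma>" "(p, q) \<in> \<Gamma>" "thin p r" "thin p q"
  shows "r = q"
proof (rule ccontr)
  assume "r \<noteq> q"
  have "r = q"
  proof (rule same_past0[OF assms(1,2)])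
    fix n :: int assume "n < 0"
    then obtain i where n: "n = - int (Suc i)" using neg_int_cases'[of n 0] by auto
    obtain h where h: "Suc i \<le> h" "fst (M1.orb (- int (Suc h)) p) = 0"
      using hit_beyond[OF assms(1,2) \<open>r \<noteq> q\<close>] by blast
    obtain N w e where 1: "Suc h \<le> N" "chords p r N w e" "\<forall>i\<le>Suc h. M1.unst (w i)"
      using assms(3) unfolding thin_def by blast
    obtain N' w' e' where 2: "Suc h \<le> N'" "chords p q N' w' e'" "\<forall>i\<le>Suc h. M1.unst (w' i)"
      using assms(4) unfolding thin_def by blast
    show "0 \<le> fst (M2.orb n r) * fst (M2.orb n q)"
      unfolding n by (rule unst_chords_agree[OF 1(2) 2(2) _ _ _ _ h(2)]) (use 1 2 h in auto)
  qed
  then show False using \<open>r \<noteq> q\<close> by simp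
qed

text \<open>One hit at which both families are already steep synchronizes them at all earlier times,
  so \<open>same_past\<close> applies.\<close>

lemma not_thin_unique:
  assumes "(p, r) \<in> \<Gamma>" "(p, q) \<in> \<Gamma>" "\<not> thin p r" "\<not> thin p q"
  shows "r = q"
proof (rule ccontr)
  assume ne: "r \<noteq> q"
  then have pW: "p \<notin> M1.W" using unique_over_W assms(1,2) by blast
  obtain k1 where k1: "\<And>N w e n. chords p r N w e \<Longrightarrow> k1 \<le> n \<Longrightarrow> n \<le> N \<Longrightarrow> M1.steep_excess (w n) > 0"
    using not_thin[OF assms(3)] by blast
  obtain k2 where k2: "\<And>N w e n. chords p q N w e \<Longrightarrow> k2 \<le> n \<Longrightarrow> n \<le> N \<Longrightarrow> M1.steep_excess (w n) > 0"
    using not_thin[OF assms(4)] by blast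
  obtain h where h: "max k1 k2 \<le> h" "fst (M1.orb (- int (Suc h)) p) = 0"
    using hit_beyond[OF assms(1,2) ne] by blast
  have "r = q"
  proof (rule same_past[OF assms(1,2), of "- int (Suc h)"])
    fix n :: int assume "n < - int (Suc h)"
    then obtain i where i: "Suc h \<le> i" "n = - int (Suc i)" using neg_int_cases' by blast
    obtain w e where 1: "chords p r (Suc i) w e" using chords_exist[OF assms(1) pW] by blast
    obtain w' e' where 2: "chords p q (Suc i) w' e'" using chords_exist[OF assms(2) pW] by blast
    show "0 \<le> fst (M2.orb n r) * fst (M2.orb n q)"
      unfolding i(2)
      by (rule steep_chords_agree[OF 1 2 k1[OF 1] k2[OF 2] h(2)]) (use h i in auto)
  qed
  then show False using ne by simp
qed

lemma at_most_two:
  assumes "(p, q) \<in> \<Gamma>" "(p, r) \<in> \<Gamma>" "(p, y) \<in> \<Gamma>" "q \<noteq> r"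
  shows "y = q \<or> y = r"
  using thin_unique not_thin_unique assms by metis

text \<open>Over the connected set \<open>W\<close> the relation is the graph of a map, continuous
  because its graph is closed and its values lie in a compact set. By \<open>approx\<close>,
  \<open>\<Gamma>\<close> lies between this graph and its closure.\<close>

lemma connected_\<Gamma>: "connected \<Gamma>"
proof -
  define f where "f x = (SOME y. (x, y) \<in> \<Gamma>)" for x
  have f: "(x, f x) \<in> \<Gamma>" if "x \<in> M1.W" for x
  proof -
    have "x \<in> fst ` \<Gamma>" using that M1.W_L onto1 by blast
    then have "\<exists>y. (x, y) \<in> \<Gamma>" by force
    then show ?thesis unfolding f_def by (rule someI_ex)
  qed
  define g where "g = (\<lambda>x. (x, f x)) ` M1.W"
  have g: "g = (M1.W \<times> M2.L) \<inter> \<Gamma>"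
    unfolding g_def
  proof
    show "(\<lambda>x. (x, f x)) ` M1.W \<subseteq> (M1.W \<times> M2.L) \<inter> \<Gamma>" using f \<Gamma>_L(2)[OF f] by auto
    show "(M1.W \<times> M2.L) \<inter> \<Gamma> \<subseteq> (\<lambda>x. (x, f x)) ` M1.W"
    proof
      fix v assume v: "v \<in> (M1.W \<times> M2.L) \<inter> \<Gamma>"
      obtain x y where xy: "v = (x, y)" by (cases v)
      then have "x \<in> M1.W" "(x, y) \<in> \<Gamma>" using v by auto
      then have "v = (x, f x)" using unique_over_W[OF _ f] xy by blast
      then show "v \<in> (\<lambda>x. (x, f x)) ` M1.W" using \<open>x \<in> M1.W\<close> by blast
    qed
  qed
  have "continuous_on M1.W f"
  proof (subst continuous_closed_graph_eq[OF M2.compact_L])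
    show "f \<in> M1.W \<rightarrow> M2.L" using \<Gamma>_L(2)[OF f] by blast
    show "closedin (top_of_set (M1.W \<times> M2.L)) ((\<lambda>x. (x, f x)) ` M1.W)"
      unfolding g_def[symmetric] g
      by (rule closedin_closed_Int) (rule compact_imp_closed[OF compact_\<Gamma>])
  qed
  then have "connected g" unfolding g_def
    by (intro connected_continuous_image continuous_on_Pair continuous_on_id M1.connected_W)
  moreover have "g \<subseteq> \<Gamma>" unfolding g by blast
  moreover have "\<Gamma> \<subseteq> closure g"
  proof -
    have "\<Gamma> \<inter> M1.W \<times> M2.W \<subseteq> g" unfolding g using M2.W_L by blast
    then show ?thesis using approx closure_mono by (metis order_trans)
  qed
  ultimately show ?thesis by (rule connected_intermediate_closure)
qed

section \<open>From a coupling to a conjugacy\<close>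

lemma functional:
  assumes "(p, q) \<in> \<Gamma>" "(p, r) \<in> \<Gamma>"
  shows "q = r"
proof (rule ccontr)
  assume "q \<noteq> r"
  have "{x. \<exists>y z. (x, y) \<in> \<Gamma> \<and> (x, z) \<in> \<Gamma> \<and> y \<noteq> z}
      \<subseteq> {v. \<exists>m n. m < n \<and> fst (M1.orb m v) = 0 \<and> fst (M1.orb n v) = 0}"
  proof
    fix x assume "x \<in> {x. \<exists>y z. (x, y) \<in> \<Gamma> \<and> (x, z) \<in> \<Gamma> \<and> y \<noteq> z}"
    then obtain y z where *: "(x, y) \<in> \<Gamma>" "(x, z) \<in> \<Gamma>" "y \<noteq> z" by blast
    obtain n where n: "fst (M1.orb n x) = 0" using past_hits[OF *] by blast
    obtain m where "m < n" "fst (M1.orb m x) = 0" using past_hits[OF *] by blast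
    then show "x \<in> {v. \<exists>m n. m < n \<and> fst (M1.orb m v) = 0 \<and> fst (M1.orb n v) = 0}"
      using n by blast
  qed
  then have "countable {x. \<exists>y z. (x, y) \<in> \<Gamma> \<and> (x, z) \<in> \<Gamma> \<and> y \<noteq> z}"
    using M1.countable_two_hits by (rule countable_subset)
  moreover have "Borsukian (fst ` \<Gamma>)"
    unfolding onto1 by (rule Borsukian_plane[OF M1.compact_L M1.connected_compl_L])
  ultimately have "q = r"
    using two_point_fibre_trivial[OF compact_\<Gamma> connected_\<Gamma> _ _ assms] at_most_two[OF assms _ \<open>q \<noteq> r\<close>]
    by blast
  then show False using \<open>q \<noteq> r\<close> by simp
qed

lemma coupling_swap:
  "lozi_coupling a2 b2 \<nu>2 \<kappa>2 \<mu>2 s2 a1 b1 \<nu>1 \<kappa>1 \<mu>1 s1 (prod.swap ` \<Gamma>)"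
proof unfold_locales
  have cs: "continuous_on A (prod.swap :: (real \<times> real) \<times> (real \<times> real) \<Rightarrow> _)" for A
    unfolding prod.swap_def by (intro continuous_intros)
  show "compact (prod.swap ` \<Gamma>)" using compact_continuous_image[OF cs compact_\<Gamma>] .
  show "fst ` prod.swap ` \<Gamma> = lozi_attractor a2 b2" using onto2 by (simp add: image_image)
  show "snd ` prod.swap ` \<Gamma> = lozi_attractor a1 b1" using onto1 by (simp add: image_image)
  fix p q n assume "(p, q) \<in> prod.swap ` \<Gamma>"
  then have "(q, p) \<in> \<Gamma>" by auto
  then show "0 \<le> fst (M2.orb n p) * fst (M1.orb n q)" "(M2.orb n p, M1.orb n q) \<in> prod.swap ` \<Gamma>"
    using compat[of q p n] shift[of q p n] by (auto simp: mult.commute)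
next
  have cs: "continuous_on A (prod.swap :: (real \<times> real) \<times> (real \<times> real) \<Rightarrow> _)" for A
    unfolding prod.swap_def by (intro continuous_intros)
  have "prod.swap ` \<Gamma> \<subseteq> prod.swap ` closure (\<Gamma> \<inter> M1.W \<times> M2.W)" using approx by (rule image_mono)
  also have "\<dots> \<subseteq> closure (prod.swap ` (\<Gamma> \<inter> M1.W \<times> M2.W))"
    by (rule image_closure_subset[OF cs closed_closure closure_subset])
  also have "\<dots> \<subseteq> closure (prod.swap ` \<Gamma> \<inter> M2.W \<times> M1.W)" by (rule closure_mono) auto
  finally show "prod.swap ` \<Gamma> \<subseteq> closure (prod.swap ` \<Gamma> \<inter> M2.W \<times> M1.W)" .
qed

lemma conjugate: "conjugate_on M1.L M1.F M2.L M2.F"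
proof -
  interpret swapped: lozi_coupling a2 b2 \<nu>2 \<kappa>2 \<mu>2 s2 a1 b1 \<nu>1 \<kappa>1 \<mu>1 s1 "prod.swap ` \<Gamma>"
    by (rule coupling_swap)
  have inj: "p = p'" if "(p, q) \<in> \<Gamma>" "(p', q) \<in> \<Gamma>" for p p' q
    using that swapped.functional[of q p p'] by force
  define h where "h p = (THE q. (p, q) \<in> \<Gamma>)" for p
  define k where "k q = (THE p. (p, q) \<in> \<Gamma>)" for q
  have h_eq: "h p = q" if "(p, q) \<in> \<Gamma>" for p q
    unfolding h_def using that functional by blast
  have k_eq: "k q = p" if "(p, q) \<in> \<Gamma>" for p q
    unfolding k_def using that inj by blast
  have h: "(p, h p) \<in> \<Gamma>" if "p \<in> M1.L" for p
  proof -
    have "p \<in> fst ` \<Gamma>" using that onto1 by simp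
    then obtain q where "(p, q) \<in> \<Gamma>" by auto
    then show ?thesis using h_eq by simp
  qed
  have k: "(k q, q) \<in> \<Gamma>" if "q \<in> M2.L" for q
  proof -
    have "q \<in> snd ` \<Gamma>" using that onto2 by simp
    then obtain p where "(p, q) \<in> \<Gamma>" by auto
    then show ?thesis using k_eq by simp
  qed
  have "homeomorphism M1.L M2.L h k"
  proof (rule homeomorphismI)
    show "h ` M1.L \<subseteq> M2.L" "k ` M2.L \<subseteq> M1.L" using h k \<Gamma>_L by blast+
    show "k (h p) = p" if "p \<in> M1.L" for p using h[OF that] k_eq by blast
    show "h (k q) = q" if "q \<in> M2.L" for q using k[OF that] h_eq by blast
    have gh: "(\<lambda>x. (x, h x)) ` M1.L = \<Gamma>" using h h_eq \<Gamma>_L(1) by force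
    show "continuous_on M1.L h"
    proof (rule continuous_from_closed_graph[OF M2.compact_L])
      show "h \<in> M1.L \<rightarrow> M2.L" using \<Gamma>_L(2)[OF h] by blast
      show "closed ((\<lambda>x. (x, h x)) ` M1.L)" unfolding gh by (rule compact_imp_closed[OF compact_\<Gamma>])
    qed
    have gk: "(\<lambda>x. (x, k x)) ` M2.L = prod.swap ` \<Gamma>"
    proof (intro equalityI image_subsetI)
      fix q assume "q \<in> M2.L"
      then have "prod.swap (k q, q) \<in> prod.swap ` \<Gamma>" using k by (intro imageI)
      then show "(q, k q) \<in> prod.swap ` \<Gamma>" by simp
    next
      fix v assume v: "v \<in> \<Gamma>"
      obtain p q where pq: "v = (p, q)" by (cases v)
      then have "prod.swap v = (q, k q)" "q \<in> M2.L" using k_eq[of p q] \<Gamma>_L(2)[of p q] v by simp_all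
      then show "prod.swap v \<in> (\<lambda>x. (x, k x)) ` M2.L" by simp
    qed
    show "continuous_on M2.L k"
    proof (rule continuous_from_closed_graph[OF M1.compact_L])
      show "k \<in> M2.L \<rightarrow> M1.L" using \<Gamma>_L(1)[OF k] by blast
      show "closed ((\<lambda>x. (x, k x)) ` M2.L)"
        unfolding gk by (rule compact_imp_closed[OF swapped.compact_\<Gamma>])
    qed
  qed
  moreover have "h (M1.F x) = M2.F (h x)" if "x \<in> M1.L" for x
    using h_eq[OF shift[OF h[OF that], of 1]] M1.orb_Suc[of 0 x] M2.orb_Suc[of 0 "h x"] by simp
  ultimately show ?thesis unfolding conjugate_on_def by blast
qed

end

text \<open>Nonnegative products at all times amount to a common itinerary, since a zero coordinate
  admits both symbols. In this form the condition is closed and survives limits.\<close>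

definition compatible :: "real \<Rightarrow> real \<Rightarrow> real \<Rightarrow> real \<Rightarrow> ((real \<times> real) \<times> (real \<times> real)) set" where
  "compatible a1 b1 a2 b2 = {(p, q). p \<in> lozi_Wu a1 b1 \<and> q \<in> lozi_Wu a2 b2 \<and>
    (\<forall>n. fst (int_iter (lozi a1 b1) n p) * fst (int_iter (lozi a2 b2) n q) \<ge> 0)}"

lemma compatible_swap: "compatible a2 b2 a1 b1 = prod.swap ` compatible a1 b1 a2 b2"
  by (force simp: compatible_def mult.commute)

text \<open>
  An orbit through a basic critical point is matched with an orbit through a basic critical point
  of the second map by a common kneading sequence; such orbits are dense.
\<close>

lemma compatible_dense:
  assumes "lozi_map a1 b1 \<nu>1 \<kappa>1 \<mu>1 s1" "lozi_map a2 b2 \<nu>2 \<kappa>2 \<mu>2 s2"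
    and "kneading_set a1 b1 \<subseteq> kneading_set a2 b2"
  shows "lozi_attractor a1 b1 \<subseteq> closure (fst ` compatible a1 b1 a2 b2)"
proof -
  interpret M1: lozi_map a1 b1 \<nu>1 \<kappa>1 \<mu>1 s1 by fact
  interpret M2: lozi_map a2 b2 \<nu>2 \<kappa>2 \<mu>2 s2 by fact
  have match: "q \<in> fst ` compatible a1 b1 a2 b2" if q: "q \<in> M1.W" "fst (M1.orb n q) = 0" for q n
  proof -
    define t where "t = M1.orb (n + 1) q"
    have "M1.orb n q \<in> basic_critical_points a1 b1"
      using q M1.orb_W[OF q(1)] by (simp add: basic_critical_points_def)
    then have t: "t \<in> turning_points a1 b1" by (simp add: turning_points_def t_def M1.orb_Suc)
    \<comment> \<open>On the axis both symbols are admissible; \<open>Plus\<close> is an arbitrary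
      choice.\<close>
    define \<iota> where "\<iota> m = (if fst (M1.orb m t) \<ge> 0 then Plus else Minus)" for m
    have "t \<in> M1.L" unfolding t_def using M1.orb_W[OF q(1)] M1.W_L by blast
    then have "is_itinerary a1 b1 t \<iota>" by (auto simp: is_itinerary_def \<iota>_def)
    then have "\<iota> \<in> kneading_set a2 b2" using t assms(3) by (auto simp: kneading_set_def)
    then obtain t' where t': "t' \<in> turning_points a2 b2" "is_itinerary a2 b2 t' \<iota>"
      by (auto simp: kneading_set_def)
    then obtain c where "c \<in> M2.W" "t' = M2.F c"
      unfolding turning_points_def basic_critical_points_def by blast
    then have t'W: "t' \<in> M2.W" using M2.F_W by blast
    have comp: "fst (M1.orb m t) * fst (M2.orb m t') \<ge> 0" for m
      using t'(2) unfolding is_itinerary_def \<iota>_def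
      by (cases "fst (M1.orb m t) \<ge> 0") (auto simp: zero_le_mult_iff split: if_splits)
    \<comment> \<open>The turning point \<open>t\<close> is reached from \<open>q\<close> at time
      \<open>n + 1\<close>, one step after the hit, so the partner of \<open>q\<close> is
      \<open>t'\<close> moved back by \<open>n + 1\<close>.\<close>
    have "fst (M1.orb m q) * fst (M2.orb m (M2.orb (- (n + 1)) t')) \<ge> 0" for m
    proof -
      have "M1.orb (m - (n + 1)) t = M1.orb m q"
        unfolding t_def using M1.orb_add[of "m - (n + 1)" "n + 1" q] by simp
      moreover have "M2.orb (m - (n + 1)) t' = M2.orb m (M2.orb (- (n + 1)) t')"
        by (simp only: diff_conv_add_uminus[of m "n + 1"] M2.orb_add)
      ultimately show ?thesis using comp[of "m - (n + 1)"] by simp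
    qed
    then have "(q, M2.orb (- (n + 1)) t') \<in> compatible a1 b1 a2 b2"
      using q(1) M2.orb_W[OF t'W] by (simp add: compatible_def)
    then show ?thesis by (metis fst_conv image_eqI)
  qed
  have "M1.W \<subseteq> closure (fst ` compatible a1 b1 a2 b2)"
  proof
    fix p assume p: "p \<in> M1.W"
    show "p \<in> closure (fst ` compatible a1 b1 a2 b2)"
      unfolding closure_approachable
    proof (intro allI impI)
      fix e :: real assume "e > 0"
      then obtain q n where "q \<in> M1.W" "dist q p < e" "fst (M1.orb n q) = 0"
        using M1.critical_dense p by blast
      then show "\<exists>y\<in>fst ` compatible a1 b1 a2 b2. dist y p < e" using match by blast
    qed
  qed
  then show ?thesis unfolding lozi_attractor_def by (rule closure_minimal) simp
qed

text \<open>Each inclusion between the kneading sets makes one projection onto; the sign condition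
  and shift invariance pass to the closure by continuity of the iterates.\<close>

lemma coupling_exists:
  assumes "lozi_map a1 b1 \<nu>1 \<kappa>1 \<mu>1 s1" "lozi_map a2 b2 \<nu>2 \<kappa>2 \<mu>2 s2"
    and "kneading_set a1 b1 = kneading_set a2 b2"
  shows "lozi_coupling a1 b1 \<nu>1 \<kappa>1 \<mu>1 s1 a2 b2 \<nu>2 \<kappa>2 \<mu>2 s2 (closure (compatible a1 b1 a2 b2))"
proof -
  interpret M1: lozi_map a1 b1 \<nu>1 \<kappa>1 \<mu>1 s1 by fact
  interpret M2: lozi_map a2 b2 \<nu>2 \<kappa>2 \<mu>2 s2 by fact
  define C where "C = compatible a1 b1 a2 b2"
  have CW: "C \<subseteq> M1.W \<times> M2.W" by (auto simp: C_def compatible_def)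
  have "closure C \<subseteq> closure (M1.W \<times> M2.W)" using CW by (rule closure_mono)
  then have CL: "closure C \<subseteq> M1.L \<times> M2.L" by (simp add: lozi_attractor_def closure_Times)
  have comp: "compact (closure C)"
    using CL compact_Times[OF M1.compact_L M2.compact_L]
    by (meson bounded_subset closed_closure compact_eq_bounded_closed)
  have cl: "closed (fst ` closure C)" "closed (snd ` closure C)"
    using comp by (auto intro!: compact_imp_closed compact_continuous_image continuous_intros)
  show ?thesis unfolding C_def[symmetric]
  proof unfold_locales
    show "compact (closure C)" by fact
    have "M1.L \<subseteq> closure (fst ` C)" unfolding C_def
      by (rule compatible_dense[OF assms(1,2)]) (simp add: assms(3))
    also have "\<dots> \<subseteq> fst ` closure C"
      using cl(1) by (intro closure_minimal image_mono closure_subset)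
    finally have sup: "M1.L \<subseteq> fst ` closure C" .
    have "fst ` closure C \<subseteq> M1.L"
      by (rule image_subsetI) (use CL mem_Times_iff in blast)
    with sup show "fst ` closure C = M1.L" by (rule equalityI[rotated])
    have "fst ` compatible a2 b2 a1 b1 = snd ` C"
      unfolding compatible_swap[of a2 b2 a1 b1] C_def by (simp add: image_image)
    then have "M2.L \<subseteq> closure (snd ` C)"
      using compatible_dense[OF assms(2,1)] assms(3) by simp
    also have "\<dots> \<subseteq> snd ` closure C"
      using cl(2) by (intro closure_minimal image_mono closure_subset)
    finally have sup: "M2.L \<subseteq> snd ` closure C" .
    have "snd ` closure C \<subseteq> M2.L"
      by (rule image_subsetI) (use CL mem_Times_iff in blast)
    with sup show "snd ` closure C = M2.L" by (rule equalityI[rotated])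
  next
    fix p q n assume pq: "(p, q) \<in> closure C"
    define S where "S = {v. 0 \<le> fst (M1.orb n (fst v)) * fst (M2.orb n (snd v))}"
    have c1: "continuous_on UNIV (\<lambda>v. M1.orb n (fst v))" "continuous_on UNIV (\<lambda>v. M2.orb n (snd v))"
      by (rule continuous_on_compose2[OF M1.cont_orb[of UNIV]], auto intro: continuous_intros)
        (rule continuous_on_compose2[OF M2.cont_orb[of UNIV]], auto intro: continuous_intros)
    have "closed S" unfolding S_def by (intro closed_Collect_le continuous_intros c1)
    moreover have "C \<subseteq> S" by (auto simp: C_def compatible_def S_def)
    ultimately have "closure C \<subseteq> S" by (rule closure_minimal[rotated])
    then show "0 \<le> fst (M1.orb n p) * fst (M2.orb n q)" using pq by (auto simp: S_def)
    define \<sigma> where "\<sigma> v = (M1.orb n (fst v), M2.orb n (snd v))" for v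
    have "continuous_on (closure C) \<sigma>" unfolding \<sigma>_def
      by (intro continuous_on_Pair continuous_on_subset[OF c1(1)] continuous_on_subset[OF c1(2)]) auto
    moreover have "\<sigma> ` C \<subseteq> C"
    proof (rule image_subsetI)
      fix v assume "v \<in> C"
      obtain p q where v: "v = (p, q)" by (cases v)
      then have "p \<in> M1.W" "q \<in> M2.W" "\<And>m. 0 \<le> fst (M1.orb m p) * fst (M2.orb m q)"
        using \<open>v \<in> C\<close> by (auto simp: C_def compatible_def)
      then show "\<sigma> v \<in> C"
        using M1.orb_W[of p n] M2.orb_W[of q n]
        by (simp add: v C_def compatible_def \<sigma>_def flip: M1.orb_add M2.orb_add)
    qed
    then have "\<sigma> ` C \<subseteq> closure C" using closure_subset by blast
    ultimately have "\<sigma> ` closure C \<subseteq> closure C" by (intro image_closure_subset) auto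
    then show "(M1.orb n p, M2.orb n q) \<in> closure C" using pq by (force simp: \<sigma>_def)
  next
    have "C \<subseteq> closure C \<inter> M1.W \<times> M2.W" using CW closure_subset by blast
    then show "closure C \<subseteq> closure (closure C \<inter> M1.W \<times> M2.W)" by (rule closure_mono)
  qed
qed

theorem theorem8p4:
  fixes a1 b1 a2 b2 :: real
  assumes "(a1, b1) \<in> misiurewicz_set"
    and "(a2, b2) \<in> misiurewicz_set"
    and "kneading_set a1 b1 = kneading_set a2 b2"
  shows "conjugate_on (lozi_attractor a1 b1) (lozi a1 b1) (lozi_attractor a2 b2) (lozi a2 b2)"
proof -
  obtain \<nu>1 \<kappa>1 \<mu>1 s1 where 1: "lozi_map a1 b1 \<nu>1 \<kappa>1 \<mu>1 s1" using lozi_mapI[OF assms(1)] .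
  obtain \<nu>2 \<kappa>2 \<mu>2 s2 where 2: "lozi_map a2 b2 \<nu>2 \<kappa>2 \<mu>2 s2" using lozi_mapI[OF assms(2)] .
  from lozi_coupling.conjugate[OF coupling_exists[OF 1 2 assms(3)]] show ?thesis .
qed

end
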